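(* Let $d\ge 3$ and let $f_1,\dots,f_d$ be functions on an open subset $U$ of the plane such that $df_i\wedge df_j$ vanishes nowhere on $U$ for all $i\ne j$, so that they are first integrals of a planar $d$-web $W(f_1,\dots,f_d)$. Then the trace of the curvature of the connection $\nabla$ associated to $W(f_1,\dots,f_d)$, viewed as a scalar 2-form on $U$, equals the sum of the Blaschke curvatures of all its sub-3-webs: $$\operatorname{tr}\,\mathrm{Curv}\big(W(f_1,\dots,f_d)\big)=\sum_{1\le i<j<k\le d}\mathrm{Bl}(f_i,f_j,f_k),$$ where $\mathrm{Bl}(f_i,f_j,f_k)$ denotes the Blaschke curvature 2-form of the 3-web $W(f_i,f_j,f_k)$.
   Context: Setting: everything is smooth over $\mathbb R$ (plane $\mathbb R^2$) or holomorphic over $\mathbb C$ (plane $\mathbb C^2$); $(x,y)$ are the coordinates and subscripts $x,y$ denote partial derivatives. A planar $d$-web $W(f_1,\dots,f_d)$ is the family of $d$ pairwise transverse foliations by level curves of functions $f_1,\dots,f_d$ on $U$, with $df_i\wedge df_j$ nowhere zero for $i\neq j$. Universal coefficients: for a function $f$ and integers $a,b\ge 0$, define $C^{a,b}_k(f)$ by the chain rule identity $\partial_x^a\partial_y^b\,(h\circ f)=\sum_{k} C^{a,b}_k(f)\,h^{(k)}(f)$ for all one-variable functions $h$. Equivalently $C^{0,0}_0=1$, $C^{0,0}_k=0$ for $k\ne0$, $C^{a+1,b}_k=\partial_x C^{a,b}_k+f_x C^{a,b}_{k-1}$, $C^{a,b+1}_k=\partial_y C^{a,b}_k+f_y C^{a,b}_{k-1}$.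 In particular $C^{a,b}_{a+b}(f)=f_x^a f_y^b$. Matrices: for $r\ge 2$, $P_r$ is the $r\times d$ matrix whose $(l,i)$ entry is $f_{ix}^{\,r-l}f_{iy}^{\,l-1}$ ($1\le l\le r$, $1\le i\le d$). For $2\le j\le r-1$, $G^j_r$ is the $r\times d$ matrix whose $(l,i)$ entry is $C^{r-l,\,l-1}_{r-j}(f_i)$. Thus the order $r-1$ derivatives of a relation $\sum_i h_i(f_i)=0$ read $G^{r-1}_r\omega^1+\dots+G^2_r\omega^{r-2}+P_r\omega^{r-1}=0$ with $\omega^s=(h_i^{(s)}(f_i))_{1\le i\le d}$. By transversality $P_d$ is invertible. Bundle: let $MM$ be the block matrix with $(d+1)(d-2)/2$ rows and $d(d-2)$ columns, with block rows indexed by $r=2,\dots,d-1$, acting on $\omega=(\omega^1,\dots,\omega^{d-2})$ (each $\omega^s$ having $d$ components) by $(MM\,\omega)_r=\sum_{j=2}^{r-1}G^j_r\,\omega^{r-j}+P_r\,\omega^{r-1}$. Its kernel $E=\ker MM$ is a vector bundle of rank $(d-1)(d-2)/2$ over $U$. Connection: put $A_j=-P_d^{-1}G^j_d$ for $2\le j\le d-1$. Let $\Delta$ be the $d(d-2)\times d(d-2)$ matrix given by $(\Delta\omega)^s=\omega^{s+1}$ for $1\le s\le d-3$ and $(\Delta\omega)^{d-2}=\sum_{j=2}^{d-1}A_j\,\omega^{d-j}$. Let $DD_x$ (resp. $DD_y$) be the block diagonal matrix with $d-2$ diagonal blocks all equal to $\mathrm{diag}(f_{1x},\dots,f_{dx})$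 (resp. $\mathrm{diag}(f_{1y},\dots,f_{dy})$). On the trivial bundle of rank $d(d-2)$ over $U$ define $\nabla^0_{\partial/\partial x}=\partial_x-DD_x\Delta$ and $\nabla^0_{\partial/\partial y}=\partial_y-DD_y\Delta$. This connection preserves $E$, and $\nabla$ is its restriction to $E$. Curvature: the curvature of $\nabla$ is the $\mathrm{End}(E)$-valued 2-form $K\,dx\wedge dy$ with $K=\nabla_{\partial/\partial y}\nabla_{\partial/\partial x}-\nabla_{\partial/\partial x}\nabla_{\partial/\partial y}$, and its trace is the scalar 2-form $\operatorname{tr}\,\mathrm{Curv}(W)=\operatorname{tr}(K)\,dx\wedge dy$. The Blaschke curvature $\mathrm{Bl}(f,g,h)$ of a 3-web $W(f,g,h)$ is the scalar 2-form obtained from this construction in the case $d=3$ (where $E$ has rank 1). *)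

theory Defs
  imports
    "HOL-Analysis.Derivative"
    "Jordan_Normal_Form.Gauss_Jordan_Elimination"
begin

text \<open>
  The ground field is \<open>'k :: real_normed_field\<close>, used at \<open>real\<close> and at \<open>complex\<close>; the plane is
  \<open>'k \<times> 'k\<close>. Functions on an open set \<open>U\<close> are total functions whose values off \<open>U\<close> are irrelevant.
  All indices except the superscripts \<open>s\<close>, \<open>j\<close> and the order \<open>r\<close> are 0-based: functions
  \<open>f 0, \<dots>, f (d - 1)\<close>, rows \<open>l = 0, \<dots>, r - 1\<close>.
\<close>

section \<open>Calculus in the plane\<close>

definition dx :: "('k::real_normed_field \<times> 'k \<Rightarrow> 'k) \<Rightarrow> 'k \<times> 'k \<Rightarrow> 'k" where
  "dx g p = deriv (\<lambda>t. g (t, snd p)) (fst p)"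

definition dy :: "('k::real_normed_field \<times> 'k \<Rightarrow> 'k) \<Rightarrow> 'k \<times> 'k \<Rightarrow> 'k" where
  "dy g p = deriv (\<lambda>t. g (fst p, t)) (snd p)"

primrec times_cont_differentiable :: "nat \<Rightarrow> (real \<times> real) set \<Rightarrow> (real \<times> real \<Rightarrow> real) \<Rightarrow> bool" where
  "times_cont_differentiable 0 V g \<longleftrightarrow> continuous_on V g"
| "times_cont_differentiable (Suc n) V g \<longleftrightarrow>
     (\<forall>p\<in>V. g differentiable (at p)) \<and>
     times_cont_differentiable n V (dx g) \<and> times_cont_differentiable n V (dy g)"

definition smooth_functions :: "(real \<times> real) set \<Rightarrow> (real \<times> real \<Rightarrow> real) set" where
  "smooth_functions V = {g. \<forall>n. times_cont_differentiable n V g}"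

definition holomorphic_functions :: "(complex \<times> complex) set \<Rightarrow> (complex \<times> complex \<Rightarrow> complex) set" where
  "holomorphic_functions V =
     {g. \<forall>p\<in>V. \<exists>a b. (g has_derivative (\<lambda>(u, v). a * u + b * v)) (at p)}"

text \<open>
  A structure sheaf \<open>\<O>\<close> assigns to an open set the admissible functions on it; it is instantiated
  with \<open>smooth_functions\<close> or \<open>holomorphic_functions\<close>.
\<close>

type_synonym 'k sheaf = "('k \<times> 'k) set \<Rightarrow> ('k \<times> 'k \<Rightarrow> 'k) set"

text \<open>A 2-form assigns to each point an alternating bilinear form on tangent vectors.\<close>

type_synonym 'k two_form = "'k \<times> 'k \<Rightarrow> 'k \<times> 'k \<Rightarrow> 'k \<times> 'k \<Rightarrow> 'k"

definition dx_wedge_dy :: "'k::real_normed_field two_form" where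
  "dx_wedge_dy p u v = fst u * snd v - snd u * fst v"

text \<open>The coefficient of \<open>dg \<and> dh\<close> with respect to \<open>dx \<and> dy\<close>:\<close>

definition wedge_d :: "('k::real_normed_field \<times> 'k \<Rightarrow> 'k) \<Rightarrow> ('k \<times> 'k \<Rightarrow> 'k) \<Rightarrow> 'k \<times> 'k \<Rightarrow> 'k" where
  "wedge_d g h p = dx g p * dy h p - dy g p * dx h p"

definition planar_web ::
  "'k::real_normed_field sheaf \<Rightarrow> nat \<Rightarrow> (nat \<Rightarrow> 'k \<times> 'k \<Rightarrow> 'k) \<Rightarrow> ('k \<times> 'k) set \<Rightarrow> bool" where
  "planar_web \<O> d f U \<longleftrightarrow>
     open U \<and> (\<forall>i<d. f i \<in> \<O> U) \<and>
     (\<forall>p\<in>U. \<forall>i<d. \<forall>j<d. i \<noteq> j \<longrightarrow> wedge_d (f i) (f j) p \<noteq> 0)"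

section \<open>The matrices of the web\<close>

text \<open>
  \<open>univ_coeff g a b k\<close> is the coefficient of \<open>h\<^sup>(\<^sup>k\<^sup>)(g)\<close> in \<open>\<partial>\<^sub>x\<^sup>a \<partial>\<^sub>y\<^sup>b (h \<circ> g)\<close>. The two recursions
  (in \<open>a\<close> and in \<open>b\<close>) are compatible because partial derivatives commute; here the derivatives
  in \<open>y\<close> are taken first.
\<close>

fun univ_coeff :: "('k::real_normed_field \<times> 'k \<Rightarrow> 'k) \<Rightarrow> nat \<Rightarrow> nat \<Rightarrow> nat \<Rightarrow> 'k \<times> 'k \<Rightarrow> 'k" where
  "univ_coeff g 0 0 k = (\<lambda>p. if k = 0 then 1 else 0)"
| "univ_coeff g 0 (Suc b) k = (\<lambda>p.
     dy (univ_coeff g 0 b k) p + dy g p * (if k = 0 then 0 else univ_coeff g 0 b (k - 1) p))"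
| "univ_coeff g (Suc a) b k = (\<lambda>p.
     dx (univ_coeff g a b k) p + dx g p * (if k = 0 then 0 else univ_coeff g a b (k - 1) p))"

context
  fixes d :: nat and f :: "nat \<Rightarrow> 'k::real_normed_field \<times> 'k \<Rightarrow> 'k"
begin

definition P_mat :: "nat \<Rightarrow> 'k \<times> 'k \<Rightarrow> 'k mat" where
  "P_mat r p = Matrix.mat r d (\<lambda>(l, i). dx (f i) p ^ (r - 1 - l) * dy (f i) p ^ l)"

definition G_mat :: "nat \<Rightarrow> nat \<Rightarrow> 'k \<times> 'k \<Rightarrow> 'k mat" where
  "G_mat j r p = Matrix.mat r d (\<lambda>(l, i). univ_coeff (f i) (r - 1 - l) l (r - j) p)"

definition A_mat :: "nat \<Rightarrow> 'k \<times> 'k \<Rightarrow> 'k mat" where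
  "A_mat j p = - (the (mat_inverse (P_mat d p)) * G_mat j d p)"

text \<open>
  A vector \<open>\<omega> = (\<omega>\<^sup>1, \<dots>, \<omega>\<^sup>d\<^sup>-\<^sup>2)\<close> is stored as one vector of dimension \<open>d (d - 2)\<close>: the \<open>i\<close>-th entry
  of \<open>\<omega>\<^sup>s\<close> sits at position \<open>(s - 1) d + i\<close>.
\<close>

definition total_dim :: nat where
  "total_dim = d * (d - 2)"

definition block :: "nat \<Rightarrow> 'k Matrix.vec \<Rightarrow> 'k Matrix.vec" where
  "block s \<omega> = Matrix.vec d (\<lambda>i. \<omega> $ ((s - 1) * d + i))"

text \<open>The block row \<open>(MM \<omega>)\<^sub>r\<close>, for \<open>2 \<le> r \<le> d - 1\<close>, and the fibre \<open>E\<^sub>p = ker MM(p)\<close>:\<close>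

definition MM_row :: "'k \<times> 'k \<Rightarrow> nat \<Rightarrow> 'k Matrix.vec \<Rightarrow> 'k Matrix.vec" where
  "MM_row p r \<omega> = Matrix.vec r (\<lambda>l.
     (\<Sum>j = 2..r - 1. (G_mat j r p *\<^sub>v block (r - j) \<omega>) $ l) + (P_mat r p *\<^sub>v block (r - 1) \<omega>) $ l)"

definition fibre :: "'k \<times> 'k \<Rightarrow> 'k Matrix.vec set" where
  "fibre p = {\<omega> \<in> carrier_vec total_dim. \<forall>r\<in>{2..d - 1}. MM_row p r \<omega> = 0\<^sub>v r}"

section \<open>The connection and its curvature\<close>

text \<open>
  Position \<open>a\<close> lies in block \<open>s = a div d + 1\<close>. In the last block row, the block in column
  \<open>t = b div d + 1\<close> is \<open>A\<^sub>d\<^sub>-\<^sub>t\<close>.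
\<close>

definition Delta_mat :: "'k \<times> 'k \<Rightarrow> 'k mat" where
  "Delta_mat p = Matrix.mat total_dim total_dim (\<lambda>(a, b).
     if a div d + 1 \<le> d - 3 then (if b = a + d then 1 else 0)
     else A_mat (d - (b div d + 1)) p $$ (a mod d, b mod d))"

definition DDx_mat :: "'k \<times> 'k \<Rightarrow> 'k mat" where
  "DDx_mat p = mat_diag total_dim (\<lambda>a. dx (f (a mod d)) p)"

definition DDy_mat :: "'k \<times> 'k \<Rightarrow> 'k mat" where
  "DDy_mat p = mat_diag total_dim (\<lambda>a. dy (f (a mod d)) p)"

definition nabla_x :: "('k \<times> 'k \<Rightarrow> 'k Matrix.vec) \<Rightarrow> 'k \<times> 'k \<Rightarrow> 'k Matrix.vec" where
  "nabla_x \<omega> p =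
     Matrix.vec total_dim (\<lambda>a. dx (\<lambda>q. \<omega> q $ a) p) - (DDx_mat p * Delta_mat p) *\<^sub>v \<omega> p"

definition nabla_y :: "('k \<times> 'k \<Rightarrow> 'k Matrix.vec) \<Rightarrow> 'k \<times> 'k \<Rightarrow> 'k Matrix.vec" where
  "nabla_y \<omega> p =
     Matrix.vec total_dim (\<lambda>a. dy (\<lambda>q. \<omega> q $ a) p) - (DDy_mat p * Delta_mat p) *\<^sub>v \<omega> p"

definition K_op :: "('k \<times> 'k \<Rightarrow> 'k Matrix.vec) \<Rightarrow> 'k \<times> 'k \<Rightarrow> 'k Matrix.vec" where
  "K_op \<omega> p = nabla_y (nabla_x \<omega>) p - nabla_x (nabla_y \<omega>) p"

definition sections_E :: "'k sheaf \<Rightarrow> ('k \<times> 'k) set \<Rightarrow> ('k \<times> 'k \<Rightarrow> 'k Matrix.vec) set" where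
  "sections_E \<O> V = {\<omega>. (\<forall>q\<in>V. \<omega> q \<in> fibre q) \<and> (\<forall>a<total_dim. (\<lambda>q. \<omega> q $ a) \<in> \<O> V)}"

text \<open>
  The curvature endomorphism of the fibre \<open>E\<^sub>p\<close>: its value at \<open>v\<close> is the value at \<open>p\<close> of \<open>K \<omega>\<close>
  for any local section \<open>\<omega>\<close> of \<open>E\<close> around \<open>p\<close> with \<open>\<omega>(p) = v\<close>.
\<close>

definition curv_endo :: "'k sheaf \<Rightarrow> 'k \<times> 'k \<Rightarrow> 'k Matrix.vec \<Rightarrow> 'k Matrix.vec" where
  "curv_endo \<O> p v =
     (THE w. \<exists>V \<omega>. open V \<and> p \<in> V \<and> \<omega> \<in> sections_E \<O> V \<and> \<omega> p = v \<and> w = K_op \<omega> p)"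

end

text \<open>
  The trace of an endomorphism \<open>T\<close> of a linear subspace \<open>W\<close> of some \<open>'k\<^sup>n\<close>: the columns of \<open>B\<close>
  form a basis of \<open>W\<close>, and \<open>M\<close> is the matrix of \<open>T\<close> in this basis.
\<close>

definition trace_on :: "nat \<Rightarrow> 'k::field Matrix.vec set \<Rightarrow> ('k Matrix.vec \<Rightarrow> 'k Matrix.vec) \<Rightarrow> 'k" where
  "trace_on n W T = (THE t. \<exists>m B M.
     B \<in> carrier_mat n m \<and> M \<in> carrier_mat m m \<and>
     bij_betw (\<lambda>c. B *\<^sub>v c) (carrier_vec m) W \<and>
     (\<forall>c\<in>carrier_vec m. T (B *\<^sub>v c) = B *\<^sub>v (M *\<^sub>v c)) \<and>
     t = (\<Sum>i<m. M $$ (i, i)))"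

definition trace_Curv ::
  "'k::real_normed_field sheaf \<Rightarrow> nat \<Rightarrow> (nat \<Rightarrow> 'k \<times> 'k \<Rightarrow> 'k) \<Rightarrow> 'k two_form" where
  "trace_Curv \<O> d f p u v =
     trace_on (total_dim d) (fibre d f p) (curv_endo d f \<O> p) * dx_wedge_dy p u v"

definition Blaschke ::
  "'k::real_normed_field sheaf \<Rightarrow> ('k \<times> 'k \<Rightarrow> 'k) \<Rightarrow> ('k \<times> 'k \<Rightarrow> 'k) \<Rightarrow> ('k \<times> 'k \<Rightarrow> 'k) \<Rightarrow> 'k two_form"
  where "Blaschke \<O> g\<^sub>1 g\<^sub>2 g\<^sub>3 = trace_Curv \<O> 3 (\<lambda>i. [g\<^sub>1, g\<^sub>2, g\<^sub>3] ! i)"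

end

theory Submission
  imports
    Defs
    "HOL-Complex_Analysis.Cauchy_Integral_Formula"
    "Jordan_Normal_Form.Determinant"
begin

text \<open>
  The block rows of \<open>MM\<close> are jets: row \<open>(r, l)\<close> is the derivative \<open>\<partial>\<^sub>x\<^sup>a \<partial>\<^sub>y\<^sup>b\<close>, \<open>a + b = r - 1\<close>, of a formal
  relation \<open>\<Sum>\<^sub>i h\<^sub>i(f\<^sub>i)\<close>, and \<open>\<Delta>\<close> is chosen so that the jets of order \<open>d - 1\<close> vanish. The chain rule
  gives \<open>J\<^sub>a\<^sub>b(\<nabla>\<^sub>x \<omega>) = \<partial>\<^sub>x J\<^sub>a\<^sub>b(\<omega>) - J\<^sub>a\<^sub>+\<^sub>1\<^sub>,\<^sub>b(\<omega>)\<close>, and likewise in \<open>y\<close>, for every section \<open>\<omega>\<close> of the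
  trivial bundle. Hence the connection on the quotient by \<open>E\<close> is flat: the curvature of \<open>\<nabla>\<^sup>0\<close> maps
  the whole trivial bundle into \<open>E\<close>, so its trace on \<open>E\<close> is its trace on the trivial bundle, namely
  \<open>\<partial>\<^sub>x tr(DD\<^sub>y \<Delta>) - \<partial>\<^sub>y tr(DD\<^sub>x \<Delta>)\<close>. Only the diagonal of \<open>A\<^sub>2\<close> enters these traces. Row \<open>i\<close> of the
  inverse of the Vandermonde matrix \<open>P\<^sub>d\<close> is the product of the \<open>d - 1\<close> linear forms that vanish at
  \<open>grad f\<^sub>j\<close>, \<open>j \<noteq> i\<close>, and equal \<open>1\<close> at \<open>grad f\<^sub>i\<close>; pairing it with the subleading universal coefficients
  is half the Hessian of \<open>f\<^sub>i\<close> applied as a second order operator to this product, which is a sum over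
  pairs of forms. So the traces are sums over triples \<open>{i, j, k}\<close>, with the same summands as for \<open>d = 3\<close>.
\<close>

unbundle no vec_syntax

section \<open>Structure sheaves\<close>

text \<open>The curvature endomorphism and the trace are definite descriptions, so each must be
  shown to have exactly one value before it can be computed. For the curvature this asks that every
  vector of a fibre extends to a section of \<open>E\<close> and that the curvature is tensorial;
  for the trace, that it is independent of the basis. Comparing with an explicit matrix on the
  trivial bundle settles both and avoids choosing a frame of \<open>E\<close>. Triples appear
  because a second order operator differentiates two factors of the product in row \<open>i\<close>,
  while all the other factors equal 1 at the gradient of \<open>f i\<close>. Each of the two
  differentiated forms involves only \<open>f i\<close> and one further function. The matrix entries
  are built from partial derivatives of every order, so the admissible functions must be stable
  under \<open>dx\<close>, \<open>dy\<close> and division. This locale records exactly such rules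
  and serves both ground fields. In the complex case functions are given only by complex
  differentiability at each point, and stability under \<open>dx\<close> and \<open>dy\<close> is
  itself a theorem.\<close>

locale function_sheaf =
  fixes \<O> :: "'k::real_normed_field sheaf"
  assumes restrict: "g \<in> \<O> V \<Longrightarrow> open V \<Longrightarrow> open V' \<Longrightarrow> V' \<subseteq> V \<Longrightarrow> g \<in> \<O> V'"
    and cong: "g \<in> \<O> V \<Longrightarrow> open V \<Longrightarrow> (\<And>p. p \<in> V \<Longrightarrow> h p = g p) \<Longrightarrow> h \<in> \<O> V"
    and const: "open V \<Longrightarrow> (\<lambda>_. c) \<in> \<O> V"
    and add: "g \<in> \<O> V \<Longrightarrow> h \<in> \<O> V \<Longrightarrow> open V \<Longrightarrow> (\<lambda>p. g p + h p) \<in> \<O> V"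
    and mult: "g \<in> \<O> V \<Longrightarrow> h \<in> \<O> V \<Longrightarrow> open V \<Longrightarrow> (\<lambda>p. g p * h p) \<in> \<O> V"
    and inverse: "g \<in> \<O> V \<Longrightarrow> open V \<Longrightarrow> (\<And>p. p \<in> V \<Longrightarrow> g p \<noteq> 0) \<Longrightarrow> (\<lambda>p. inverse (g p)) \<in> \<O> V"
    and dx_closed: "g \<in> \<O> V \<Longrightarrow> open V \<Longrightarrow> dx g \<in> \<O> V"
    and dy_closed: "g \<in> \<O> V \<Longrightarrow> open V \<Longrightarrow> dy g \<in> \<O> V"
    and has_dx: "g \<in> \<O> V \<Longrightarrow> open V \<Longrightarrow> p \<in> V \<Longrightarrow>
      ((\<lambda>t. g (t, snd p)) has_field_derivative dx g p) (at (fst p))"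
    and has_dy: "g \<in> \<O> V \<Longrightarrow> open V \<Longrightarrow> p \<in> V \<Longrightarrow>
      ((\<lambda>t. g (fst p, t)) has_field_derivative dy g p) (at (snd p))"
    and dx_dy: "g \<in> \<O> V \<Longrightarrow> open V \<Longrightarrow> p \<in> V \<Longrightarrow> dx (dy g) p = dy (dx g) p"

section \<open>Partial derivatives along coordinate lines\<close>

lemma eventually_line:
  fixes V :: "('k::real_normed_field \<times> 'k) set"
  assumes "open V" "p \<in> V"
  shows "\<forall>\<^sub>F t in nhds (fst p). (t, snd p) \<in> V" "\<forall>\<^sub>F t in nhds (snd p). (fst p, t) \<in> V"
proof -
  have "((\<lambda>t. (t, snd p)) \<longlongrightarrow> p) (nhds (fst p))" "((\<lambda>t. (fst p, t)) \<longlongrightarrow> p) (nhds (snd p))"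
    by (rule tendsto_eq_rhs[OF tendsto_Pair[OF filterlim_ident tendsto_const]], simp)
      (rule tendsto_eq_rhs[OF tendsto_Pair[OF tendsto_const filterlim_ident]], simp)
  from this[THEN eventually_compose_filterlim[OF eventually_nhds_in_open[OF assms]]]
  show "\<forall>\<^sub>F t in nhds (fst p). (t, snd p) \<in> V" "\<forall>\<^sub>F t in nhds (snd p). (fst p, t) \<in> V" .
qed

text \<open>A coordinate line through \<open>p\<close> stays in \<open>V\<close> near
  \<open>p\<close>, and \<open>deriv\<close> sees only that part of it. Identities valid on an open
  set can thus be differentiated although the values off that set are arbitrary.\<close>

lemma partial_cong:
  fixes V :: "('k::real_normed_field \<times> 'k) set"
  assumes "open V" "p \<in> V" "\<And>q. q \<in> V \<Longrightarrow> g q = h q"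
  shows "dx g p = dx h p" "dy g p = dy h p"
proof -
  show "dx g p = dx h p" unfolding dx_def
    by (rule deriv_cong_ev) (use eventually_line(1)[OF assms(1,2)] assms(3) in \<open>auto elim: eventually_mono\<close>)
  show "dy g p = dy h p" unfolding dy_def
    by (rule deriv_cong_ev) (use eventually_line(2)[OF assms(1,2)] assms(3) in \<open>auto elim: eventually_mono\<close>)
qed

text \<open>\<open>has_derivative\<close> only provides a real-linear map \<open>D\<close>.
  Homogeneity over \<open>'k\<close> along each axis is what turns its restrictions into
  multiplication by a scalar, hence into field derivatives.\<close>

lemma has_derivative_partials:
  fixes g :: "'k::real_normed_field \<times> 'k \<Rightarrow> 'k"
  assumes "(g has_derivative D) (at p)" "\<And>c u. D (c * u, 0) = c * D (u, 0)" "\<And>c u. D (0, c * u) = c * D (0, u)"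
  shows "((\<lambda>t. g (t, snd p)) has_field_derivative D (1, 0)) (at (fst p))"
    "((\<lambda>t. g (fst p, t)) has_field_derivative D (0, 1)) (at (snd p))"
    "dx g p = D (1, 0)" "dy g p = D (0, 1)"
proof -
  have *: "((\<lambda>t. (t, snd p)) has_derivative (\<lambda>t. (t, 0))) (at (fst p))"
    "((\<lambda>t. (fst p, t)) has_derivative (\<lambda>t. (0, t))) (at (snd p))"
    by (auto intro!: derivative_eq_intros)
  have "D (u, 0) = D (1, 0) * u" "D (0, u) = D (0, 1) * u" for u
    using assms(2)[of u 1] assms(3)[of u 1] by (metis mult.commute mult_1_right)+
  then have D: "(\<lambda>u. D (u, 0)) = (*) (D (1, 0))" "(\<lambda>u. D (0, u)) = (*) (D (0, 1))"
    by blast+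
  show 1: "((\<lambda>t. g (t, snd p)) has_field_derivative D (1, 0)) (at (fst p))"
    using has_derivative_compose[OF *(1), of g D] assms(1) D unfolding has_field_derivative_def by simp
  show 2: "((\<lambda>t. g (fst p, t)) has_field_derivative D (0, 1)) (at (snd p))"
    using has_derivative_compose[OF *(2), of g D] assms(1) D unfolding has_field_derivative_def by simp
  show "dx g p = D (1, 0)" "dy g p = D (0, 1)"
    using 1 2 by (auto simp: dx_def dy_def intro!: DERIV_imp_deriv)
qed

subsection \<open>Smooth functions\<close>

lemma differentiable_partials:
  fixes g :: "real \<times> real \<Rightarrow> real"
  assumes "g differentiable (at p)"
  shows "((\<lambda>t. g (t, snd p)) has_field_derivative dx g p) (at (fst p))"
    "((\<lambda>t. g (fst p, t)) has_field_derivative dy g p) (at (snd p))"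
proof -
  obtain D where D: "(g has_derivative D) (at p)"
    using assms by (auto simp: differentiable_def)
  interpret D: bounded_linear D using D by (rule has_derivative_bounded_linear)
  have "D (c * u, 0) = c * D (u, 0)" "D (0, c * u) = c * D (0, u)" for c u
    using D.scaleR[of c "(u, 0)"] D.scaleR[of c "(0, u)"] by auto
  from has_derivative_partials[OF D this]
  show "((\<lambda>t. g (t, snd p)) has_field_derivative dx g p) (at (fst p))"
    "((\<lambda>t. g (fst p, t)) has_field_derivative dy g p) (at (snd p))" by simp_all
qed

lemma tcd_cong:
  assumes "open V"
  shows "times_cont_differentiable n V g \<Longrightarrow> (\<And>p. p \<in> V \<Longrightarrow> h p = g p) \<Longrightarrow> times_cont_differentiable n V h"
proof (induction n arbitrary: g h)
  case 0
  then show ?case using continuous_on_eq[of V g h] by (metis times_cont_differentiable.simps(1))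
next
  case (Suc n)
  have "h differentiable (at p)" if p: "p \<in> V" for p
  proof -
    obtain D where "(g has_derivative D) (at p)" using Suc.prems(1) p by (auto simp: differentiable_def)
    then have "(h has_derivative D) (at p)"
      using has_derivative_transform_within_open[OF _ assms p, of g D UNIV h] Suc.prems(2) by simp
    then show ?thesis by (auto simp: differentiable_def)
  qed
  moreover have "times_cont_differentiable n V (dx h)" "times_cont_differentiable n V (dy h)"
    using Suc.prems partial_cong[OF assms, of _ h g] by (auto intro: Suc.IH[of "dx g"] Suc.IH[of "dy g"])
  ultimately show ?case by simp
qed

lemma tcd_Suc: "times_cont_differentiable (Suc n) V g \<Longrightarrow> times_cont_differentiable n V g"
proof (induction n arbitrary: g)
  case 0
  then show ?case
    by (auto intro!: continuous_at_imp_continuous_on differentiable_imp_continuous_within)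
next
  case (Suc n)
  then show ?case
    by (subst (asm) times_cont_differentiable.simps) (subst times_cont_differentiable.simps, blast)
qed

lemma tcd_const: "times_cont_differentiable n V (\<lambda>_. c)"
proof (induction n arbitrary: c)
  case (Suc n)
  have "dx (\<lambda>_. c) = (\<lambda>_. 0)" "dy (\<lambda>_. c) = (\<lambda>_. 0)" by (auto simp: dx_def dy_def fun_eq_iff)
  with Suc show ?case by simp
qed simp

lemma partial_arith:
  fixes g h :: "real \<times> real \<Rightarrow> real"
  assumes "g differentiable (at p)" "h differentiable (at p)"
  shows "dx (\<lambda>p. g p + h p) p = dx g p + dx h p" "dy (\<lambda>p. g p + h p) p = dy g p + dy h p"
    "dx (\<lambda>p. g p * h p) p = dx g p * h p + dx h p * g p" "dy (\<lambda>p. g p * h p) p = dy g p * h p + dy h p * g p"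
  using differentiable_partials[OF assms(1)] differentiable_partials[OF assms(2)]
  unfolding dx_def[of "\<lambda>p. g p + h p"] dy_def[of "\<lambda>p. g p + h p"]
    dx_def[of "\<lambda>p. g p * h p"] dy_def[of "\<lambda>p. g p * h p"]
  by (auto intro!: DERIV_imp_deriv derivative_eq_intros)

lemma tcd_add:
  assumes "open V"
  shows "times_cont_differentiable n V g \<Longrightarrow> times_cont_differentiable n V h \<Longrightarrow>
    times_cont_differentiable n V (\<lambda>p. g p + h p)"
proof (induction n arbitrary: g h)
  case (Suc n)
  then have *: "times_cont_differentiable n V (\<lambda>p. dx g p + dx h p)"
    "times_cont_differentiable n V (\<lambda>p. dy g p + dy h p)" by auto
  have "times_cont_differentiable n V (dx (\<lambda>p. g p + h p))"
    "times_cont_differentiable n V (dy (\<lambda>p. g p + h p))"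
    by (rule tcd_cong[OF assms *(1)] tcd_cong[OF assms *(2)], use Suc.prems in \<open>simp add: partial_arith\<close>)+
  with Suc.prems show ?case by simp
qed (auto intro: continuous_intros)

lemma tcd_mult:
  assumes "open V"
  shows "times_cont_differentiable n V g \<Longrightarrow> times_cont_differentiable n V h \<Longrightarrow>
    times_cont_differentiable n V (\<lambda>p. g p * h p)"
proof (induction n arbitrary: g h)
  case (Suc n)
  \<comment> \<open>The product rule involves \<open>g\<close> and \<open>h\<close> themselves next
    to their derivatives, so their order is lowered to that of the induction hypothesis.\<close>
  have "times_cont_differentiable n V g" "times_cont_differentiable n V h"
    using Suc.prems tcd_Suc by blast+
  with Suc have *: "times_cont_differentiable n V (\<lambda>p. dx g p * h p + dx h p * g p)"
    "times_cont_differentiable n V (\<lambda>p. dy g p * h p + dy h p * g p)" by (auto intro!: tcd_add[OF assms])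
  have "times_cont_differentiable n V (dx (\<lambda>p. g p * h p))"
    "times_cont_differentiable n V (dy (\<lambda>p. g p * h p))"
    by (rule tcd_cong[OF assms *(1)] tcd_cong[OF assms *(2)], use Suc.prems in \<open>simp add: partial_arith\<close>)+
  with Suc.prems show ?case by simp
qed (auto intro: continuous_intros)

lemma tcd_inverse:
  assumes "open V" "\<And>p. p \<in> V \<Longrightarrow> g p \<noteq> 0"
  shows "times_cont_differentiable n V g \<Longrightarrow> times_cont_differentiable n V (\<lambda>p. inverse (g p))"
proof (induction n)
  case 0
  then show ?case using assms by (auto intro: continuous_intros)
next
  case (Suc n)
  have "times_cont_differentiable n V (\<lambda>p. inverse (g p))"
    using Suc tcd_Suc by blast
  with Suc.prems have *: "times_cont_differentiable n V (\<lambda>p. (-1) * (inverse (g p) * (dx g p * inverse (g p))))"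
    "times_cont_differentiable n V (\<lambda>p. (-1) * (inverse (g p) * (dy g p * inverse (g p))))"
    using Suc.prems by (intro tcd_mult[OF assms(1)] tcd_const; simp)+
  have **: "dx (\<lambda>p. inverse (g p)) p = (-1) * (inverse (g p) * (dx g p * inverse (g p)))"
    "dy (\<lambda>p. inverse (g p)) p = (-1) * (inverse (g p) * (dy g p * inverse (g p)))" if "p \<in> V" for p
    using differentiable_partials[of g p] Suc.prems that assms(2)[of p]
    unfolding dx_def[of "\<lambda>p. inverse (g p)"] dy_def[of "\<lambda>p. inverse (g p)"]
    by (auto intro!: DERIV_imp_deriv derivative_eq_intros)
  have "times_cont_differentiable n V (dx (\<lambda>p. inverse (g p)))"
    "times_cont_differentiable n V (dy (\<lambda>p. inverse (g p)))"
    by (rule tcd_cong[OF assms(1) *(1)], rule **, assumption)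
      (rule tcd_cong[OF assms(1) *(2)], rule **, assumption)
  moreover have "(\<lambda>p. inverse (g p)) differentiable at p" if "p \<in> V" for p
    using Suc.prems that assms(2) by (intro differentiable_inverse) auto
  ultimately show ?case by simp
qed

section \<open>Symmetry of mixed partial derivatives of smooth functions\<close>

lemma box_near:
  fixes V :: "('k::real_normed_field \<times> 'k) set"
  assumes "open V" "p \<in> V"
  obtains e where "e > 0" "cball (fst p) e \<times> cball (snd p) e \<subseteq> V"
proof -
  obtain A B where AB: "open A" "open B" "fst p \<in> A" "snd p \<in> B" "A \<times> B \<subseteq> V"
    using assms by (metis mem_Times_iff open_prod_elim)
  obtain a b where "a > 0" "cball (fst p) a \<subseteq> A" "b > 0" "cball (snd p) b \<subseteq> B"
    using AB open_contains_cball by metis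
  then have "cball (fst p) (min a b) \<times> cball (snd p) (min a b) \<subseteq> A \<times> B" by auto
  with AB(5) \<open>a > 0\<close> \<open>b > 0\<close> show ?thesis by (intro that[of "min a b"]) auto
qed

text \<open>Both mixed derivatives are limits of \<open>(g(x+h,y+h) - g(x+h,y) - g(x,y+h) + g(x,y)) / h\<^sup>2\<close>,
  by two applications of the mean value theorem.\<close>

lemma mixed_difference:
  fixes g :: "real \<Rightarrow> real \<Rightarrow> real"
  assumes h: "h > 0"
    and gx: "\<And>s t. s \<in> {x..x+h} \<Longrightarrow> t \<in> {y..y+h} \<Longrightarrow> ((\<lambda>s. g s t) has_field_derivative gx s t) (at s)"
    and gxy: "\<And>s t. s \<in> {x..x+h} \<Longrightarrow> t \<in> {y..y+h} \<Longrightarrow> ((\<lambda>t. gx s t) has_field_derivative gxy s t) (at t)"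
  shows "\<exists>s\<in>{x..x+h}. \<exists>t\<in>{y..y+h}. g (x+h) (y+h) - g x (y+h) - g (x+h) y + g x y = h * h * gxy s t"
proof -
  have "\<exists>s. x < s \<and> s < x+h \<and> (g (x+h) (y+h) - g (x+h) y) - (g x (y+h) - g x y) = (x+h - x) * (gx s (y+h) - gx s y)"
    by (rule MVT2) (use h in \<open>auto intro!: derivative_eq_intros gx\<close>)
  then obtain s where s: "x < s" "s < x+h"
    "(g (x+h) (y+h) - g (x+h) y) - (g x (y+h) - g x y) = h * (gx s (y+h) - gx s y)" by auto
  have "\<exists>t. y < t \<and> t < y+h \<and> gx s (y+h) - gx s y = (y+h - y) * gxy s t"
    by (rule MVT2) (use h s in \<open>auto intro!: gxy\<close>)
  then obtain t where "y < t" "t < y+h" "gx s (y+h) - gx s y = h * gxy s t" by auto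
  with s show ?thesis by (intro bexI[of _ s] bexI[of _ t]) (auto simp: algebra_simps)
qed

lemma smooth_dx_dy:
  assumes V: "open V" "p \<in> V" and g: "times_cont_differentiable 2 V g"
  shows "dx (dy g) p = dy (dx g) p"
proof (rule ccontr)
  assume ne: "dx (dy g) p \<noteq> dy (dx g) p"
  \<comment> \<open>Half the gap between the two mixed derivatives: no number can be closer than
    \<open>e\<close> to both of them.\<close>
  define e where "e = \<bar>dx (dy g) p - dy (dx g) p\<bar> / 2"
  have "e > 0" using ne by (simp add: e_def)
  have diff: "q \<in> V \<Longrightarrow> g differentiable (at q)" "q \<in> V \<Longrightarrow> dx g differentiable (at q)"
    "q \<in> V \<Longrightarrow> dy g differentiable (at q)" for q
    using g by (auto simp: numeral_2_eq_2)
  have cont: "continuous_on V (dx (dy g))" "continuous_on V (dy (dx g))"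
    using g by (auto simp: numeral_2_eq_2)
  have "isCont (dx (dy g)) p" "isCont (dy (dx g)) p"
    using cont V by (auto simp: continuous_on_eq_continuous_at)
  then have "\<forall>\<^sub>F q in nhds p. dist (dx (dy g) q) (dx (dy g) p) < e"
     "\<forall>\<^sub>F q in nhds p. dist (dy (dx g) q) (dy (dx g) p) < e"
    using \<open>e > 0\<close> by (auto simp: isCont_def tendsto_at_iff_tendsto_nhds intro: tendstoD)
  then have "\<forall>\<^sub>F q in nhds p. dist (dx (dy g) q) (dx (dy g) p) < e \<and>
     dist (dy (dx g) q) (dy (dx g) p) < e \<and> q \<in> V"
    using eventually_nhds_in_open[OF V] by eventually_elim auto
  then obtain W where W: "open W" "p \<in> W" "\<And>q. q \<in> W \<Longrightarrow> dist (dx (dy g) q) (dx (dy g) p) < e"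
    "\<And>q. q \<in> W \<Longrightarrow> dist (dy (dx g) q) (dy (dx g) p) < e" "W \<subseteq> V"
    unfolding eventually_nhds by blast
  obtain h where h: "h > 0" "cball (fst p) h \<times> cball (snd p) h \<subseteq> W"
    using box_near[OF W(1,2)] .
  obtain x y where p: "p = (x, y)" by force
  have inW: "(s, t) \<in> W" if "s \<in> {x..x+h}" "t \<in> {y..y+h}" for s t
    using that h by (auto simp: p cball_def dist_real_def intro!: subsetD[OF h(2)])
  have inV: "(s, t) \<in> V" if "s \<in> {x..x+h}" "t \<in> {y..y+h}" for s t using inW that W(5) by auto
  have "\<exists>s\<in>{x..x+h}. \<exists>t\<in>{y..y+h}. g (x+h, y+h) - g (x, y+h) - g (x+h, y) + g (x, y) = h * h * dy (dx g) (s, t)"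
    by (rule mixed_difference[OF h(1), of x y "\<lambda>s t. g (s, t)" "\<lambda>s t. dx g (s, t)"])
       (use differentiable_partials[OF diff(1)[OF inV]] differentiable_partials[OF diff(2)[OF inV]] in auto)
  then obtain s t where st: "s\<in>{x..x+h}" "t\<in>{y..y+h}"
    "g (x+h, y+h) - g (x, y+h) - g (x+h, y) + g (x, y) = h * h * dy (dx g) (s, t)" by blast
  \<comment> \<open>Exchanging the variables only permutes the middle terms of the second
    difference, so both mean values are taken of the same number.\<close>
  have "\<exists>t\<in>{y..y+h}. \<exists>s\<in>{x..x+h}. g (x+h, y+h) - g (x+h, y) - g (x, y+h) + g (x, y) = h * h * dx (dy g) (s, t)"
    by (rule mixed_difference[OF h(1), of y x "\<lambda>t s. g (s, t)" "\<lambda>t s. dy g (s, t)"])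
       (use differentiable_partials[OF diff(1)[OF inV]] differentiable_partials[OF diff(3)[OF inV]] in auto)
  then obtain s' t' where st': "s'\<in>{x..x+h}" "t'\<in>{y..y+h}"
    "g (x+h, y+h) - g (x+h, y) - g (x, y+h) + g (x, y) = h * h * dx (dy g) (s', t')" by blast
  have "h * h * dy (dx g) (s, t) = h * h * dx (dy g) (s', t')" using st(3) st'(3) by linarith
  then have "dy (dx g) (s, t) = dx (dy g) (s', t')" using h by simp
  moreover have "dist (dx (dy g) (s', t')) (dx (dy g) p) < e" "dist (dy (dx g) (s, t)) (dy (dx g) p) < e"
    using W inW st st' by auto
  moreover have "\<bar>u - v\<bar> \<le> \<bar>w - u\<bar> + \<bar>w - v\<bar>" for u v w :: real by linarith
  from this[of "dx (dy g) p" "dy (dx g) p" "dx (dy g) (s', t')"]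
  have "2 * e \<le> dist (dx (dy g) (s', t')) (dx (dy g) p) + dist (dx (dy g) (s', t')) (dy (dx g) p)"
    by (simp add: e_def dist_real_def)
  ultimately show False by simp
qed

lemma function_sheaf_smooth: "function_sheaf smooth_functions"
proof (unfold_locales, goal_cases)
  have smoothI: "(\<And>n. times_cont_differentiable n V g) \<Longrightarrow> g \<in> smooth_functions V"
    and smoothD: "g \<in> smooth_functions V \<Longrightarrow> times_cont_differentiable n V g" for g n V
    by (simp_all add: smooth_functions_def)
  have diff: "g \<in> smooth_functions V \<Longrightarrow> p \<in> V \<Longrightarrow> g differentiable (at p)" for g V p
    using smoothD[of g V 1] by simp
  {
    case (1 g V V')
    have "times_cont_differentiable n V f \<Longrightarrow> times_cont_differentiable n V' f" for n f
      using 1 by (induction n arbitrary: f) (auto intro: continuous_on_subset)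
    then show ?case using 1 by (intro smoothI) (blast dest: smoothD)
  next
    case (2 g V h)
    then show ?case by (blast intro: smoothI tcd_cong dest: smoothD)
  next
    case (3 V c)
    show ?case by (rule smoothI, rule tcd_const)
  next
    case (4 g V h)
    then show ?case using smoothD by (auto intro!: smoothI[of V] tcd_add)
  next
    case (5 g V h)
    then show ?case using smoothD by (auto intro!: smoothI[of V] tcd_mult)
  next
    case (6 g V)
    then show ?case using smoothD by (auto intro!: smoothI[of V] tcd_inverse)
  next
    case (7 g V)
    have "times_cont_differentiable n V (dx g)" for n using smoothD[OF 7(1), of "Suc n"] by simp
    then show ?case by (rule smoothI)
  next
    case (8 g V)
    have "times_cont_differentiable n V (dy g)" for n using smoothD[OF 8(1), of "Suc n"] by simp
    then show ?case by (rule smoothI)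
  next
    case (9 g V p)
    then show ?case using differentiable_partials(1)[OF diff] by blast
  next
    case (10 g V p)
    then show ?case using differentiable_partials(2)[OF diff] by blast
  next
    case (11 g V p)
    then show ?case using smooth_dx_dy smoothD by blast
  }
qed

subsection \<open>Holomorphic functions\<close>

text \<open>Separate holomorphy with local boundedness is stable under partial differentiation by the
  Cauchy estimates, and it forces continuity; so the partial derivatives are continuous, which
  gives complex Frechet differentiability.\<close>

definition separately_holomorphic :: "(complex \<times> complex) set \<Rightarrow> (complex \<times> complex \<Rightarrow> complex) \<Rightarrow> bool" where
  "separately_holomorphic V g \<longleftrightarrow>
    (\<forall>p\<in>V. (\<lambda>s. g (s, snd p)) field_differentiable at (fst p) \<and> (\<lambda>t. g (fst p, t)) field_differentiable at (snd p)) \<and>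
    (\<forall>p\<in>V. \<exists>e>0. \<exists>M. \<forall>q \<in> cball (fst p) e \<times> cball (snd p) e. norm (g q) \<le> M)"

lemma separately_holomorphicD:
  assumes "separately_holomorphic V g" "(s, t) \<in> V"
  shows "((\<lambda>s. g (s, t)) has_field_derivative dx g (s, t)) (at s)"
    "((\<lambda>t. g (s, t)) has_field_derivative dy g (s, t)) (at t)"
  using assms unfolding separately_holomorphic_def dx_def dy_def
  by (auto simp: field_differentiable_derivI)

lemma separately_holomorphic_differentiable:
  assumes "separately_holomorphic V g" "(s, t) \<in> V"
  shows "(\<lambda>s. g (s, t)) field_differentiable at s" "(\<lambda>t. g (s, t)) field_differentiable at t"
  using assms unfolding separately_holomorphic_def by auto

lemma separately_holomorphic_box:
  assumes "open V" "separately_holomorphic V g" "(x, y) \<in> V"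
  obtains e M where "e > 0" "cball x e \<times> cball y e \<subseteq> V" "\<And>s t. s \<in> cball x e \<Longrightarrow> t \<in> cball y e \<Longrightarrow> norm (g (s, t)) \<le> M"
    "M \<ge> 0"
proof -
  obtain e where e: "e > 0" "cball x e \<times> cball y e \<subseteq> V"
    using box_near[OF assms(1,3)] by auto
  obtain e' M where e': "e' > 0" "\<forall>q \<in> cball x e' \<times> cball y e'. norm (g q) \<le> M"
    using assms(2,3) by (auto simp: separately_holomorphic_def)
  have "norm (g (x, y)) \<le> M" using e' by auto
  then have "M \<ge> 0" using norm_ge_zero order_trans by blast
  moreover have "cball x (min e e') \<times> cball y (min e e') \<subseteq> cball x e \<times> cball y e" by auto
  ultimately show ?thesis using e e' by (intro that[of "min e e'" M]) auto
qed

lemma holomorphic_on_pointwiseI: "(\<And>s. s \<in> S \<Longrightarrow> f field_differentiable at s) \<Longrightarrow> f holomorphic_on S"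
  by (simp add: holomorphic_on_def field_differentiable_at_within)

text \<open>Each point of the half disc is the centre of a disc of radius \<open>e/2\<close> inside
  the given one; Cauchy's inequality there bounds the derivative of order \<open>n\<close> by
  \<open>fact n * M / (e/2) ^ n\<close>.\<close>

lemma deriv_half_disc_bounds:
  fixes f :: "complex \<Rightarrow> complex"
  assumes e: "e > 0" and f: "\<And>s. s \<in> cball x e \<Longrightarrow> f field_differentiable at s"
    and M: "\<And>s. s \<in> cball x e \<Longrightarrow> norm (f s) \<le> M" and s: "s \<in> cball x (e/2)"
  shows "norm (deriv f s) \<le> 2 * M / e" "norm (deriv (deriv f) s) \<le> 8 * M / e\<^sup>2"
proof -
  have sub: "cball s (e/2) \<subseteq> cball x e"
  proof
    fix z assume "z \<in> cball s (e/2)"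
    with s dist_triangle[of x z s] show "z \<in> cball x e" by simp
  qed
  have hol: "f holomorphic_on ball s (e/2)"
    by (intro holomorphic_on_pointwiseI f subsetD[OF sub]) (auto simp: less_imp_le)
  have cont: "continuous_on (cball s (e/2)) f"
    using f sub by (intro continuous_at_imp_continuous_on ballI field_differentiable_imp_continuous_at) blast
  have "norm ((deriv ^^ n) f s) \<le> fact n * M / (e/2) ^ n" for n
    by (rule Cauchy_inequality[OF hol cont]) (use e sub M in \<open>auto simp: subset_iff dist_norm\<close>)
  from this[of 1] this[of 2] show "norm (deriv f s) \<le> 2 * M / e" "norm (deriv (deriv f) s) \<le> 8 * M / e\<^sup>2"
    by (auto simp: numeral_2_eq_2 field_simps)
qed

text \<open>Taylor's formula of order one on the convex half disc, with the Cauchy bound for the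
  second derivative. The constant depends on \<open>M\<close> and \<open>e\<close> alone, so the
  estimate is uniform over all slices of a bounded function of two variables.\<close>

lemma difference_quotient_bound:
  fixes f :: "complex \<Rightarrow> complex"
  assumes e: "e > 0" and f: "\<And>s. s \<in> cball x e \<Longrightarrow> f field_differentiable at s"
    and M: "\<And>s. s \<in> cball x e \<Longrightarrow> norm (f s) \<le> M" and z: "z \<in> cball x (e/2)" and w: "w \<in> cball x (e/2)"
  shows "norm (f z - f w - deriv f w * (z - w)) \<le> 8 * M / e\<^sup>2 * norm (z - w) ^ 2"
proof -
  have hol: "f holomorphic_on ball x e"
    by (intro holomorphic_on_pointwiseI f) (auto simp: less_imp_le)
  then have hol': "deriv f holomorphic_on ball x e" by (rule holomorphic_deriv) simp
  have sub: "cball x (e/2) \<subseteq> ball x e" using e by auto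
  have "norm ((deriv ^^ 0) f z - (\<Sum>i\<le>1. (deriv ^^ i) f w * (z - w) ^ i / fact i))
      \<le> 8 * M / e\<^sup>2 * norm (z - w) ^ Suc 1 / fact 1"
  proof (rule complex_Taylor[where f = "\<lambda>i. (deriv ^^ i) f", of "cball x (e/2)"])
    fix i :: nat and s assume "s \<in> cball x (e/2)" "i \<le> 1"
    then have "s \<in> ball x e" "i = 0 \<or> i = 1" using sub by auto
    then show "((deriv ^^ i) f has_field_derivative (deriv ^^ Suc i) f s) (at s within cball x (e/2))"
      using holomorphic_derivI[OF hol open_ball] holomorphic_derivI[OF hol' open_ball]
      by (auto intro: has_field_derivative_at_within)
  next
    fix s assume "s \<in> cball x (e/2)"
    then show "norm ((deriv ^^ Suc 1) f s) \<le> 8 * M / e\<^sup>2"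
      using deriv_half_disc_bounds(2)[OF e f M] by simp
  qed (use z w in auto)
  then show ?thesis by (simp add: algebra_simps numeral_2_eq_2)
qed

lemma separately_holomorphic_swap:
  assumes "separately_holomorphic V g"
  shows "separately_holomorphic (prod.swap ` V) (\<lambda>q. g (snd q, fst q))"
  using assms unfolding separately_holomorphic_def by fastforce

lemma open_swap:
  fixes V :: "('a::topological_space \<times> 'a) set"
  assumes "open V" shows "open (prod.swap ` V)"
proof -
  have "prod.swap ` V = prod.swap -` V" by force
  moreover have "open (prod.swap -` V)"
    by (rule open_vimage[OF assms]) (auto simp: prod.swap_def intro!: continuous_intros)
  ultimately show ?thesis by simp
qed

text \<open>Near a point, the difference quotients of \<open>g\<close> in the second variable converge uniformly in
  the first one.\<close>

lemma separately_holomorphic_mixed: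
  assumes V: "open V" and g: "separately_holomorphic V g" and p: "(x, y) \<in> V"
  shows "((\<lambda>s. dy g (s, y)) has_field_derivative dx (dy g) (x, y)) (at x)"
    "((\<lambda>t. dx g (x, t)) has_field_derivative dx (dy g) (x, y)) (at y)"
proof -
  obtain e M where e: "e > 0" "cball x e \<times> cball y e \<subseteq> V" "M \<ge> 0"
    and M: "\<And>s t. s \<in> cball x e \<Longrightarrow> t \<in> cball y e \<Longrightarrow> norm (g (s, t)) \<le> M"
    using separately_holomorphic_box[OF assms] by metis
  define \<phi> where "\<phi> h s = (g (s, y + h) - g (s, y)) / h" for h s
  define \<phi>' where "\<phi>' h s = (dx g (s, y + h) - dx g (s, y)) / h" for h s
  define F where "F = at (0 :: complex)"
  have small: "\<forall>\<^sub>F h in F. h \<noteq> 0 \<and> y + h \<in> cball y (e/2)"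
    unfolding F_def eventually_at using \<open>e > 0\<close> by (intro exI[of _ "e/2"]) (auto simp: dist_norm)
  have inV: "(s, t) \<in> V" if "s \<in> cball x e" "t \<in> cball y e" for s t using e that by auto
  have der: "((\<phi> h) has_field_derivative \<phi>' h s) (at s)" if "s \<in> cball x e" "h \<noteq> 0" "y + h \<in> cball y e" for h s
    unfolding \<phi>_def \<phi>'_def using that e(1)
    by (intro DERIV_cdivide DERIV_diff separately_holomorphicD(1)[OF g] inV) auto
  have cont: "\<forall>\<^sub>F h in F. continuous_on (cball x e) (\<phi> h) \<and>
      (\<forall>s\<in>ball x e. ((\<phi> h) has_field_derivative \<phi>' h s) (at s))"
    using small
  proof eventually_elim
    case (elim h)
    then have "y + h \<in> cball y e" using e(1) by auto
    with elim der show ?case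
      by (auto intro!: continuous_at_imp_continuous_on DERIV_isCont)
  qed
  have bound: "norm (\<phi> h s - dy g (s, y)) \<le> 8 * M / e\<^sup>2 * norm h"
    if "s \<in> cball x e" "h \<noteq> 0" "y + h \<in> cball y (e/2)" for h s
  proof -
    have "norm (g (s, y + h) - g (s, y) - deriv (\<lambda>t. g (s, t)) y * (y + h - y)) \<le> 8 * M / e\<^sup>2 * norm (y + h - y) ^ 2"
      by (rule difference_quotient_bound[OF e(1)])
        (use that e(1) M inV separately_holomorphic_differentiable(2)[OF g] in auto)
    then have "norm (g (s, y + h) - g (s, y) - dy g (s, y) * h) / norm h \<le> 8 * M / e\<^sup>2 * norm h"
      using that(2) e(1) by (simp add: dy_def power2_eq_square field_simps)
    moreover have "\<phi> h s - dy g (s, y) = (g (s, y + h) - g (s, y) - dy g (s, y) * h) / h"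
      using that(2) by (simp add: \<phi>_def field_simps)
    ultimately show ?thesis by (simp add: norm_divide)
  qed
  have "((\<lambda>h. 8 * M / e\<^sup>2 * norm h) \<longlongrightarrow> 0) F"
    unfolding F_def using e(1) by (auto intro!: tendsto_eq_intros)
  then have small': "\<forall>\<^sub>F h in F. 8 * M / e\<^sup>2 * norm h < \<epsilon>" if "\<epsilon> > 0" for \<epsilon>
    using that by (auto dest: order_tendstoD(2))
  have ulim: "uniform_limit (cball x e) \<phi> (\<lambda>s. dy g (s, y)) F"
  proof (rule uniform_limitI)
    fix \<epsilon> :: real assume "\<epsilon> > 0"
    from small'[OF this] small
    show "\<forall>\<^sub>F h in F. \<forall>s\<in>cball x e. dist (\<phi> h s) (dy g (s, y)) < \<epsilon>"
      by eventually_elim (use bound in \<open>fastforce simp: dist_norm\<close>)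
  qed
  have "F \<noteq> bot" by (simp add: F_def)
  \<comment> \<open>By Weierstrass' theorem the uniform limit is holomorphic and the derivatives
    \<open>\<phi>' h\<close> converge to its derivative. At \<open>x\<close> that convergence says
    that \<open>dx g\<close> is differentiable in the second variable, with the same value as
    \<open>dx (dy g)\<close>.\<close>
  from has_complex_derivative_uniform_limit[OF cont ulim this e(1)]
  obtain D where D: "\<And>w. w \<in> ball x e \<Longrightarrow> ((\<lambda>s. dy g (s, y)) has_field_derivative D w) (at w) \<and> ((\<lambda>h. \<phi>' h w) \<longlongrightarrow> D w) F"
    by metis
  have D1: "((\<lambda>s. dy g (s, y)) has_field_derivative D x) (at x)" and D2: "((\<lambda>h. \<phi>' h x) \<longlongrightarrow> D x) F"
    using D[of x] e(1) by auto
  have "D x = dx (dy g) (x, y)" using D1 by (simp add: dx_def DERIV_imp_deriv)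
  with D1 D2 show "((\<lambda>s. dy g (s, y)) has_field_derivative dx (dy g) (x, y)) (at x)"
    "((\<lambda>t. dx g (x, t)) has_field_derivative dx (dy g) (x, y)) (at y)"
    by (simp_all add: DERIV_def F_def \<phi>'_def)
qed

lemma separately_holomorphic_dy:
  assumes V: "open V" and g: "separately_holomorphic V g"
  shows "separately_holomorphic V (dy g)"
  unfolding separately_holomorphic_def
proof (safe)
  fix x y assume p: "(x, y) \<in> V"
  obtain e M where e: "e > 0" "cball x e \<times> cball y e \<subseteq> V" "M \<ge> 0"
    and M: "\<And>s t. s \<in> cball x e \<Longrightarrow> t \<in> cball y e \<Longrightarrow> norm (g (s, t)) \<le> M"
    using separately_holomorphic_box[OF assms p] by metis
  show "(\<lambda>s. dy g (s, snd (x, y))) field_differentiable at (fst (x, y))"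
    using separately_holomorphic_mixed(1)[OF assms p] by (auto simp: field_differentiable_def)
  have "(\<lambda>t. g (x, t)) holomorphic_on ball y e"
    using e(1) by (intro holomorphic_on_pointwiseI separately_holomorphic_differentiable(2)[OF g]
        subsetD[OF e(2)]) auto
  then have "deriv (\<lambda>t. g (x, t)) holomorphic_on ball y e" by (rule holomorphic_deriv) simp
  then show "(\<lambda>t. dy g (fst (x, y), t)) field_differentiable at (snd (x, y))"
    using e(1) by (simp add: dy_def holomorphic_on_imp_differentiable_at[of _ "ball y e"])
  have "norm (dy g (s, t)) \<le> 2 * M / e" if "s \<in> cball x e" "t \<in> cball y (e/2)" for s t
    unfolding dy_def fst_conv snd_conv using that M separately_holomorphic_differentiable(2)[OF g, of s] e
    by (intro deriv_half_disc_bounds(1)[where x = y] e(1)) (auto simp: subset_iff)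
  then show "\<exists>e>0. \<exists>M. \<forall>q\<in>cball (fst (x, y)) e \<times> cball (snd (x, y)) e. norm (dy g q) \<le> M"
  proof -
    assume b: "\<And>s t. s \<in> cball x e \<Longrightarrow> t \<in> cball y (e/2) \<Longrightarrow> norm (dy g (s, t)) \<le> 2 * M / e"
    have "\<forall>q\<in>cball x (e/2) \<times> cball y (e/2). norm (dy g q) \<le> 2 * M / e" using b e(1) by auto
    moreover have "e/2 > 0" using e(1) by simp
    ultimately show ?thesis unfolding fst_conv snd_conv by blast
  qed
qed

text \<open>Exchanging the coordinates preserves the class and turns \<open>dx\<close> into
  \<open>dy\<close>.\<close>

lemma separately_holomorphic_dx:
  assumes V: "open V" and g: "separately_holomorphic V g"
  shows "separately_holomorphic V (dx g)"
proof -
  have "dy (\<lambda>q. g (snd q, fst q)) = (\<lambda>q. dx g (snd q, fst q))"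
    by (simp add: dx_def dy_def fun_eq_iff)
  with separately_holomorphic_swap[OF separately_holomorphic_dy[OF open_swap[OF V] separately_holomorphic_swap[OF g]]]
  show ?thesis by (simp add: image_image prod.swap_def)
qed

text \<open>The increment splits into a change of the second variable, Lipschitz uniformly in the
  first by the Cauchy bound on \<open>dy g\<close>, and a change along the line through
  \<open>y\<close>, where \<open>g\<close> is holomorphic.\<close>

lemma separately_holomorphic_continuous:
  assumes V: "open V" and g: "separately_holomorphic V g"
  shows "continuous_on V g"
proof (intro continuous_at_imp_continuous_on ballI)
  fix p assume "p \<in> V"
  then obtain x y where p: "p = (x, y)" "(x, y) \<in> V" by (cases p) auto
  obtain e M where e: "e > 0" "cball x e \<times> cball y e \<subseteq> V" "M \<ge> 0"
    and M: "\<And>s t. s \<in> cball x e \<Longrightarrow> t \<in> cball y e \<Longrightarrow> norm (g (s, t)) \<le> M"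
    using separately_holomorphic_box[OF assms p(2)] by metis
  have b: "norm (g (s, t) - g (s, y)) \<le> 2 * M / e * norm (t - y)" if "s \<in> cball x e" "t \<in> cball y (e/2)" for s t
  proof (rule field_differentiable_bound[of "cball y (e/2)" "\<lambda>t. g (s, t)" "\<lambda>t. dy g (s, t)"])
    fix t assume t: "t \<in> cball y (e/2)"
    then have "(s, t) \<in> V" using that e by auto
    then show "((\<lambda>t. g (s, t)) has_field_derivative dy g (s, t)) (at t within cball y (e/2))"
      using separately_holomorphicD(2)[OF g] has_field_derivative_at_within by blast
    show "norm (dy g (s, t)) \<le> 2 * M / e"
      unfolding dy_def fst_conv snd_conv using t that M separately_holomorphic_differentiable(2)[OF g, of s] e
      by (intro deriv_half_disc_bounds(1)[where x = y] e(1)) (auto simp: subset_iff)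
  qed (use that e(1) in auto)
  have c: "isCont (\<lambda>s. g (s, y)) x"
    using separately_holomorphicD(1)[OF g p(2)] DERIV_isCont by blast
  have "((\<lambda>q. (g q - g (fst q, y)) + g (fst q, y)) \<longlongrightarrow> 0 + g (x, y)) (nhds (x, y))"
  proof (rule tendsto_add)
    have "((\<lambda>q. 2 * M / e * norm (snd q - y)) \<longlongrightarrow> 2 * M / e * norm (snd (x, y) - y)) (nhds (x, y))"
      by (intro tendsto_intros filterlim_ident)
    then have "((\<lambda>q. 2 * M / e * norm (snd q - y)) \<longlongrightarrow> 0) (nhds (x, y))" by simp
    moreover have "\<forall>\<^sub>F q in nhds (x, y). q \<in> ball x e \<times> ball y (e/2)"
      using e(1) by (intro eventually_nhds_in_open open_Times) auto
    then have "\<forall>\<^sub>F q in nhds (x, y). norm (g q - g (fst q, y)) \<le> 2 * M / e * norm (snd q - y)"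
      by eventually_elim (use b in force)
    ultimately show "((\<lambda>q. g q - g (fst q, y)) \<longlongrightarrow> 0) (nhds (x, y))" 
      by (rule Lim_null_comparison[rotated])
    have "filterlim fst (nhds x) (nhds (x, y))"
      using tendsto_fst[OF filterlim_ident, of "(x, y)"] by simp
    then show "((\<lambda>q. g (fst q, y)) \<longlongrightarrow> g (x, y)) (nhds (x, y))"
      using c unfolding continuous_at tendsto_at_iff_tendsto_nhds[of "\<lambda>s. g (s, y)" x]
      by (rule filterlim_compose[rotated])
  qed
  then show "isCont g p" by (simp add: continuous_at p tendsto_at_iff_tendsto_nhds)
qed

text \<open>One partial derivative at the point and continuity of the other yield the Frechet
  derivative; conversely, continuity on a compact box gives the local bound. Through this
  equivalence \<open>holomorphic_functions\<close> inherits stability under partial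
  derivatives.\<close>

lemma separately_holomorphic_iff:
  assumes V: "open V"
  shows "separately_holomorphic V g \<longleftrightarrow> g \<in> holomorphic_functions V"
proof
  assume g: "separately_holomorphic V g"
  have "(g has_derivative (\<lambda>(u, v). dx g (x, y) * u + dy g (x, y) * v)) (at (x, y))" if p: "(x, y) \<in> V" for x y
  proof -
    obtain e where e: "e > 0" "cball x e \<times> cball y e \<subseteq> V" using box_near[OF V p] by auto
    have "continuous_on V (dy g)"
      by (rule separately_holomorphic_continuous[OF V separately_holomorphic_dy[OF V g]])
    then have "isCont (dy g) (x, y)" using V p continuous_on_eq_continuous_at by blast
    then have "continuous (at (x, y) within ball x e \<times> ball y e) (dy g)"
      by (rule continuous_at_imp_continuous_at_within)
    then have "continuous (at (x, y) within ball x e \<times> ball y e) (\<lambda>q. blinfun_mult_right (dy g q))"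
      by (rule bounded_linear.continuous[OF bounded_linear_blinfun_mult_right])
    then have cont: "continuous (at (x, y) within ball x e \<times> ball y e) (\<lambda>(s, t). blinfun_mult_right (dy g (s, t)))"
      by (simp add: case_prod_beta')
    have fx: "((\<lambda>s. g (s, y)) has_derivative (*) (dx g (x, y))) (at x within ball x e)"
      using separately_holomorphicD(1)[OF g p] unfolding has_field_derivative_def
      by (rule has_derivative_at_withinI)
    have fy: "((\<lambda>t. g (s, t)) has_derivative blinfun_apply (blinfun_mult_right (dy g (s, t)))) (at t within ball y e)"
      if "s \<in> ball x e" "t \<in> ball y e" for s t
    proof -
      have "(s, t) \<in> V" using that by (intro subsetD[OF e(2)]) auto
      from separately_holomorphicD(2)[OF g this] show ?thesis
        unfolding has_field_derivative_def blinfun_mult_right.rep_eq by (rule has_derivative_at_withinI)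
    qed
    have "((\<lambda>(s, t). g (s, t)) has_derivative (\<lambda>(u, v). dx g (x, y) * u + blinfun_mult_right (dy g (x, y)) v))
        (at (x, y) within ball x e \<times> ball y e)"
      by (rule has_derivative_partialsI[OF fx fy cont]) (use e(1) in auto)
    moreover have "at (x, y) within ball x e \<times> ball y e = at (x, y)"
      using e(1) by (intro at_within_open open_Times) auto
    ultimately show ?thesis by (simp add: case_prod_beta')
  qed
  then have "\<exists>a b. (g has_derivative (\<lambda>(u, v). a * u + b * v)) (at p)" if "p \<in> V" for p
    using that by (cases p) blast
  then show "g \<in> holomorphic_functions V" unfolding holomorphic_functions_def by blast
next
  assume g: "g \<in> holomorphic_functions V"
  have h: "(\<lambda>s. g (s, snd p)) field_differentiable at (fst p)" "(\<lambda>t. g (fst p, t)) field_differentiable at (snd p)"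
    "isCont g p" if p: "p \<in> V" for p
  proof -
    obtain a b where D: "(g has_derivative (\<lambda>(u, v). a * u + b * v)) (at p)"
      using g p unfolding holomorphic_functions_def by blast
    have lin: "(\<lambda>(u, v). a * u + b * v) (c * u, 0) = c * (\<lambda>(u, v). a * u + b * v) (u, 0)"
      "(\<lambda>(u, v). a * u + b * v) (0, c * u) = c * (\<lambda>(u, v). a * u + b * v) (0, u)" for c u by simp_all
    show "(\<lambda>s. g (s, snd p)) field_differentiable at (fst p)"
      "(\<lambda>t. g (fst p, t)) field_differentiable at (snd p)"
      unfolding field_differentiable_def using has_derivative_partials(1,2)[OF D lin] by blast+
    show "isCont g p" using D has_derivative_continuous by blast
  qed
  have "\<exists>e>0. \<exists>M. \<forall>q \<in> cball (fst p) e \<times> cball (snd p) e. norm (g q) \<le> M" if p: "p \<in> V" for p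
  proof -
    obtain e where e: "e > 0" "cball (fst p) e \<times> cball (snd p) e \<subseteq> V" using box_near[OF V p] .
    have "continuous_on V g" by (intro continuous_at_imp_continuous_on ballI h(3))
    then have "continuous_on (cball (fst p) e \<times> cball (snd p) e) g" by (rule continuous_on_subset) fact
    then have "compact (g ` (cball (fst p) e \<times> cball (snd p) e))"
      by (rule compact_continuous_image) (rule compact_Times[OF compact_cball compact_cball])
    then have "bounded (g ` (cball (fst p) e \<times> cball (snd p) e))" by (rule compact_imp_bounded)
    then obtain M where "\<forall>z \<in> g ` (cball (fst p) e \<times> cball (snd p) e). norm z \<le> M"
      unfolding bounded_iff by (rule exE)
    then have "\<forall>q \<in> cball (fst p) e \<times> cball (snd p) e. norm (g q) \<le> M" by simp
    then show ?thesis using e(1) by blast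
  qed
  with h show "separately_holomorphic V g" unfolding separately_holomorphic_def by blast
qed

lemma function_sheaf_holomorphic: "function_sheaf holomorphic_functions"
proof (unfold_locales, goal_cases)
  case (1 g V V')
  then show ?case unfolding holomorphic_functions_def by blast
next
  case (2 g V h)
  show ?case unfolding holomorphic_functions_def
  proof safe
    fix x y assume p: "(x, y) \<in> V"
    with 2 obtain a b where D: "(g has_derivative (\<lambda>(u, v). a * u + b * v)) (at (x, y))"
      unfolding holomorphic_functions_def by blast
    have "(h has_derivative (\<lambda>(u, v). a * u + b * v)) (at (x, y))"
      by (rule has_derivative_transform_within_open[OF D 2(2) p]) (simp add: 2(3))
    then show "\<exists>a b. (h has_derivative (\<lambda>(u, v). a * u + b * v)) (at (x, y))" by blast
  qed
next
  case (3 V c)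
  have "((\<lambda>_. c) has_derivative (\<lambda>(u, v). 0 * u + 0 * v)) (at p)" for p :: "complex \<times> complex"
    by (simp add: case_prod_beta')
  then show ?case unfolding holomorphic_functions_def by blast
next
  case (4 g V h)
  show ?case unfolding holomorphic_functions_def
  proof safe
    fix x y assume "(x, y) \<in> V"
    with 4 obtain a b a' b' where D: "(g has_derivative (\<lambda>(u, v). a * u + b * v)) (at (x, y))"
      "(h has_derivative (\<lambda>(u, v). a' * u + b' * v)) (at (x, y))"
      unfolding holomorphic_functions_def by blast
    have "((\<lambda>p. g p + h p) has_derivative (\<lambda>(u, v). (a + a') * u + (b + b') * v)) (at (x, y))"
      by (rule has_derivative_eq_rhs[OF has_derivative_add[OF D]]) (auto simp: algebra_simps)
    then show "\<exists>a b. ((\<lambda>p. g p + h p) has_derivative (\<lambda>(u, v). a * u + b * v)) (at (x, y))" by blast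
  qed
next
  case (5 g V h)
  show ?case unfolding holomorphic_functions_def
  proof safe
    fix x y assume "(x, y) \<in> V"
    with 5 obtain a b a' b' where D: "(g has_derivative (\<lambda>(u, v). a * u + b * v)) (at (x, y))"
      "(h has_derivative (\<lambda>(u, v). a' * u + b' * v)) (at (x, y))"
      unfolding holomorphic_functions_def by blast
    have "((\<lambda>p. g p * h p) has_derivative (\<lambda>(u, v). (g (x, y) * a' + a * h (x, y)) * u +
        (g (x, y) * b' + b * h (x, y)) * v)) (at (x, y))"
      by (rule has_derivative_eq_rhs[OF has_derivative_mult[OF D]]) (auto simp: algebra_simps)
    then show "\<exists>a b. ((\<lambda>p. g p * h p) has_derivative (\<lambda>(u, v). a * u + b * v)) (at (x, y))" by blast
  qed
next
  case (6 g V)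
  show ?case unfolding holomorphic_functions_def
  proof safe
    fix x y assume "(x, y) \<in> V"
    with 6 obtain a b where D: "(g has_derivative (\<lambda>(u, v). a * u + b * v)) (at (x, y))" and "g (x, y) \<noteq> 0"
      unfolding holomorphic_functions_def by blast
    have "((\<lambda>p. inverse (g p)) has_derivative (\<lambda>(u, v). - (inverse (g (x, y)) * a * inverse (g (x, y))) * u +
        - (inverse (g (x, y)) * b * inverse (g (x, y))) * v)) (at (x, y))"
      by (rule has_derivative_eq_rhs[OF Deriv.has_derivative_inverse[OF \<open>g (x, y) \<noteq> 0\<close> D]])
        (auto simp: algebra_simps)
    then show "\<exists>a b. ((\<lambda>p. inverse (g p)) has_derivative (\<lambda>(u, v). a * u + b * v)) (at (x, y))" by blast
  qed
next
  case (7 g V)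
  then show ?case using separately_holomorphic_dx[of V g] separately_holomorphic_iff[of V] by simp
next
  case (8 g V)
  then show ?case using separately_holomorphic_dy[of V g] separately_holomorphic_iff[of V] by simp
next
  case (9 g V p)
  then show ?case using separately_holomorphicD(1)[of V g "fst p" "snd p"] separately_holomorphic_iff[of V] by simp
next
  case (10 g V p)
  then show ?case using separately_holomorphicD(2)[of V g "fst p" "snd p"] separately_holomorphic_iff[of V] by simp
next
  case (11 g V p)
  then have "((\<lambda>t. dx g (fst p, t)) has_field_derivative dx (dy g) p) (at (snd p))"
    using separately_holomorphic_mixed(2)[of V g "fst p" "snd p"] separately_holomorphic_iff[of V] by simp
  then show ?case by (simp add: dy_def[of "dx g"] DERIV_imp_deriv)
qed

section \<open>The trace of an endomorphism of a subspace\<close>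

definition mtrace :: "nat \<Rightarrow> 'a::comm_monoid_add mat \<Rightarrow> 'a" where
  "mtrace n A = (\<Sum>i<n. A $$ (i, i))"

lemma mtrace_mult_commute:
  fixes A B :: "'a::comm_semiring_0 mat"
  assumes A: "A \<in> carrier_mat n m" and B: "B \<in> carrier_mat m n"
  shows "mtrace n (A * B) = mtrace m (B * A)"
proof -
  have "mtrace n (A * B) = (\<Sum>i<n. \<Sum>j<m. A $$ (i, j) * B $$ (j, i))"
    using A B by (auto simp: mtrace_def scalar_prod_def atLeast0LessThan intro!: sum.cong)
  also have "\<dots> = (\<Sum>j<m. \<Sum>i<n. B $$ (j, i) * A $$ (i, j))"
    by (subst sum.swap) (simp add: mult.commute)
  also have "\<dots> = mtrace m (B * A)"
    using A B by (auto simp: mtrace_def scalar_prod_def atLeast0LessThan intro!: sum.cong)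
  finally show ?thesis .
qed

lemma mult_mat_unit_vec:
  fixes A :: "'a::semiring_1 mat"
  assumes "A \<in> carrier_mat n m" "j < m"
  shows "A *\<^sub>v unit_vec m j = col A j"
  using assms by (intro eq_vecI) auto

lemma mat_eqI_mult_vec:
  fixes A B :: "'a::semiring_1 mat"
  assumes A: "A \<in> carrier_mat n m" and B: "B \<in> carrier_mat n m"
    and eq: "\<And>v. v \<in> carrier_vec m \<Longrightarrow> A *\<^sub>v v = B *\<^sub>v v"
  shows "A = B"
proof (rule mat_col_eqI)
  fix j assume "j < dim_col B"
  then show "col A j = col B j"
    using eq[of "unit_vec m j"] mult_mat_unit_vec[OF A, of j] mult_mat_unit_vec[OF B, of j] A B by auto
qed (use A B in auto)

text \<open>Induction along the filtration of \<open>W\<close> by the subspaces \<open>S k\<close>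
  of vectors supported on the first \<open>k\<close> coordinates. Each step adds at most one column:
  a vector \<open>w\<close> whose coordinate \<open>k\<close> is nonzero.\<close>

lemma subspace_basis_mat:
  fixes W :: "'a::field Matrix.vec set"
  assumes W: "W \<subseteq> carrier_vec n" "0\<^sub>v n \<in> W"
    and add: "\<And>u v. u \<in> W \<Longrightarrow> v \<in> W \<Longrightarrow> u + v \<in> W"
    and smult: "\<And>c v. v \<in> W \<Longrightarrow> c \<cdot>\<^sub>v v \<in> W"
  shows "\<exists>m B. B \<in> carrier_mat n m \<and> bij_betw (\<lambda>c. B *\<^sub>v c) (carrier_vec m) W"
proof -
  define S where "S k = {v \<in> W. \<forall>i<n. k \<le> i \<longrightarrow> v $ i = 0}" for k
  have "\<exists>m B. B \<in> carrier_mat n m \<and> bij_betw (\<lambda>c. B *\<^sub>v c) (carrier_vec m) (S k)" if "k \<le> n" for k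
    using that
  proof (induction k)
    case 0
    have S0: "S 0 = {0\<^sub>v n}" using W by (auto simp: S_def intro!: eq_vecI)
    have "bij_betw (\<lambda>c. 0\<^sub>m n 0 *\<^sub>v c) (carrier_vec 0) (S 0)"
      unfolding S0 bij_betw_def by (auto simp: inj_on_def image_def scalar_prod_def intro!: eq_vecI bexI[of _ "0\<^sub>v 0"])
    then show ?case by (metis zero_carrier_mat)
  next
    case (Suc k)
    then obtain m B where B: "B \<in> carrier_mat n m" and bij: "bij_betw (\<lambda>c. B *\<^sub>v c) (carrier_vec m) (S k)" by auto
    have k: "k < n" using Suc.prems by simp
    have lower: "S k = {v \<in> S (Suc k). v $ k = 0}"
      using k by (auto simp: S_def le_Suc_eq Suc_le_eq)
    show ?case
    proof (cases "\<exists>w\<in>S (Suc k). w $ k \<noteq> 0")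
      case False
      then have "S (Suc k) = S k" using lower by auto
      with Suc show ?thesis by auto
    next
      case True
      then obtain w where w: "w \<in> S (Suc k)" "w $ k \<noteq> 0" by auto
      then have wn: "w \<in> carrier_vec n" using W by (auto simp: S_def)
      define B' where "B' = Matrix.mat n (Suc m) (\<lambda>(i, j). if j < m then B $$ (i, j) else w $ i)"
      have B': "B' \<in> carrier_mat n (Suc m)" by (simp add: B'_def)
      define low where "low c = Matrix.vec m (\<lambda>j. (c::'a Matrix.vec) $ j)" for c
      have lowc: "low c \<in> carrier_vec m" for c by (simp add: low_def)
      have Sdim: "S j \<subseteq> carrier_vec n" for j using W by (auto simp: S_def)
      have ex: "B' *\<^sub>v c = B *\<^sub>v low c + (c $ m) \<cdot>\<^sub>v w" if "c \<in> carrier_vec (Suc m)" for c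
        using that wn B by (intro eq_vecI)
          (auto simp: B'_def low_def scalar_prod_def mult.commute intro!: sum.cong)
      have Bl: "B *\<^sub>v c \<in> S k" if "c \<in> carrier_vec m" for c using bij that by (auto simp: bij_betw_def)
      have wk: "(B' *\<^sub>v c) $ k = c $ m * w $ k" if "c \<in> carrier_vec (Suc m)" for c
      proof -
        have "(B *\<^sub>v low c) $ k = 0" using Bl[OF lowc[of c]] k by (auto simp: S_def)
        then show ?thesis using ex[OF that] k wn B by simp
      qed
      have "bij_betw (\<lambda>c. B' *\<^sub>v c) (carrier_vec (Suc m)) (S (Suc k))"
        unfolding bij_betw_def
      proof safe
        show "inj_on (\<lambda>c. B' *\<^sub>v c) (carrier_vec (Suc m))"
        proof (rule inj_onI)
          fix c c' assume c: "c \<in> carrier_vec (Suc m)" "c' \<in> carrier_vec (Suc m)" "B' *\<^sub>v c = B' *\<^sub>v c'"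
          then have m: "c $ m = c' $ m" using wk w(2) by (metis mult_right_cancel)
          have "B *\<^sub>v low c + (c $ m) \<cdot>\<^sub>v w = B *\<^sub>v low c' + (c $ m) \<cdot>\<^sub>v w" using ex c m by metis
          then have eq: "(B *\<^sub>v low c + (c $ m) \<cdot>\<^sub>v w) $ i = (B *\<^sub>v low c' + (c $ m) \<cdot>\<^sub>v w) $ i" for i
            by simp
          have "B *\<^sub>v low c = B *\<^sub>v low c'"
          proof (rule eq_vecI)
            fix i assume "i < dim_vec (B *\<^sub>v low c')"
            then have "i < n" using B by simp
            with eq[of i] wn B show "(B *\<^sub>v low c) $ i = (B *\<^sub>v low c') $ i" by simp
          qed (use B in simp)
          then have "low c = low c'" using bij lowc by (auto simp: bij_betw_def inj_on_def)
          then have "c $ j = c' $ j" if "j < m" for j using that by (metis index_vec low_def)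
          with m show "c = c'" using c by (intro eq_vecI) (auto simp: less_Suc_eq)
        qed
      next
        fix c :: "'a Matrix.vec" assume c: "c \<in> carrier_vec (Suc m)"
        have "B *\<^sub>v low c \<in> W" using Bl[OF lowc[of c]] by (simp add: S_def)
        then have "B' *\<^sub>v c \<in> W" using ex[OF c] w add smult by (auto simp: S_def)
        moreover have "(B' *\<^sub>v c) $ i = 0" if "i < n" "Suc k \<le> i" for i
          using Bl[OF lowc[of c]] w that wn B ex[OF c] by (auto simp: S_def)
        ultimately show "B' *\<^sub>v c \<in> S (Suc k)" by (simp add: S_def)
      next
        fix v assume v: "v \<in> S (Suc k)"
        then have vn: "v \<in> carrier_vec n" using Sdim by auto
        \<comment> \<open>The multiple of \<open>w\<close> that clears coordinate \<open>k\<close>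
          of \<open>v\<close>, as in Gaussian elimination; \<open>a\<close> becomes the last
          coefficient.\<close>
        define a where "a = v $ k / w $ k"
        have "v + (-a) \<cdot>\<^sub>v w \<in> S (Suc k)" using v w add smult wn vn by (auto simp: S_def)
        moreover have "(v + (-a) \<cdot>\<^sub>v w) $ k = 0" using w(2) k vn wn by (simp add: a_def)
        ultimately have "v + (-a) \<cdot>\<^sub>v w \<in> S k" using lower by auto
        then have "v + (-a) \<cdot>\<^sub>v w \<in> (\<lambda>c. B *\<^sub>v c) ` carrier_vec m" using bij by (simp add: bij_betw_def)
        then obtain c where c: "c \<in> carrier_vec m" "B *\<^sub>v c = v + (-a) \<cdot>\<^sub>v w" by (metis imageE)
        define c' where "c' = Matrix.vec (Suc m) (\<lambda>j. if j < m then c $ j else a)"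
        have "c' \<in> carrier_vec (Suc m)" "low c' = c" "c' $ m = a" using c(1) by (auto simp: c'_def low_def)
        then have "B' *\<^sub>v c' = v + (-a) \<cdot>\<^sub>v w + a \<cdot>\<^sub>v w" using ex[of c'] c(2) by metis
        also have "\<dots> = v" using vn wn by (intro eq_vecI) auto
        finally show "v \<in> (\<lambda>c. B' *\<^sub>v c) ` carrier_vec (Suc m)" using \<open>c' \<in> _\<close> by (metis imageI)
      qed
      with B' show ?thesis by blast
    qed
  qed
  moreover have "S n = W" by (auto simp: S_def)
  ultimately show ?thesis by (metis order_refl)
qed

text \<open>If \<open>N\<close> is the matrix of \<open>K\<close> viewed as a map onto \<open>W\<close> with basis \<open>B\<close>, then \<open>K = B N\<close>, the
  restriction has matrix \<open>N B\<close>, and \<open>tr (N B) = tr (B N)\<close>.\<close>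

lemma trace_on_eq_mtrace:
  fixes K :: "'a::field mat"
  assumes W: "W \<subseteq> carrier_vec n" "0\<^sub>v n \<in> W"
    and add: "\<And>u v. u \<in> W \<Longrightarrow> v \<in> W \<Longrightarrow> u + v \<in> W"
    and smult: "\<And>c v. v \<in> W \<Longrightarrow> c \<cdot>\<^sub>v v \<in> W"
    and K: "K \<in> carrier_mat n n" and into: "\<And>v. v \<in> carrier_vec n \<Longrightarrow> K *\<^sub>v v \<in> W"
    and T: "\<And>v. v \<in> W \<Longrightarrow> T v = K *\<^sub>v v"
  shows "trace_on n W T = mtrace n K"
proof -
  have fact: "\<exists>N \<in> carrier_mat m n. K = B * N"
    if B: "B \<in> carrier_mat n m" "bij_betw (\<lambda>c. B *\<^sub>v c) (carrier_vec m) W" for m B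
  proof -
    have "\<exists>c\<in>carrier_vec m. B *\<^sub>v c = K *\<^sub>v v" if "v \<in> carrier_vec n" for v
    proof -
      have "K *\<^sub>v v \<in> (\<lambda>c. B *\<^sub>v c) ` carrier_vec m" using into[OF that] B(2) by (simp add: bij_betw_def)
      then show ?thesis by (metis imageE)
    qed
    then obtain c where c: "\<And>v. v \<in> carrier_vec n \<Longrightarrow> c v \<in> carrier_vec m \<and> B *\<^sub>v c v = K *\<^sub>v v" by metis
    define N where "N = Matrix.mat m n (\<lambda>(i, j). c (unit_vec n j) $ i)"
    have N: "N \<in> carrier_mat m n" by (simp add: N_def)
    have "K = B * N"
    proof (rule mat_col_eqI)
      fix j assume "j < dim_col (B * N)"
      then have j: "j < n" using N by simp
      have "col N j = c (unit_vec n j)" using j c[of "unit_vec n j"] by (intro eq_vecI) (auto simp: N_def)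
      then have "col (B * N) j = K *\<^sub>v unit_vec n j" using c[of "unit_vec n j"] col_mult2[OF B(1) N j] by simp
      then show "col K j = col (B * N) j" using mult_mat_unit_vec[OF K j] by simp
    qed (use K B N in auto)
    with N show ?thesis by blast
  qed
  have mat: "M = N * B \<longleftrightarrow> (\<forall>c\<in>carrier_vec m. T (B *\<^sub>v c) = B *\<^sub>v (M *\<^sub>v c))"
    if B: "B \<in> carrier_mat n m" "bij_betw (\<lambda>c. B *\<^sub>v c) (carrier_vec m) W" and N: "N \<in> carrier_mat m n" "K = B * N"
      and M: "M \<in> carrier_mat m m" for m B N M
  proof -
    have BN: "T (B *\<^sub>v c) = B *\<^sub>v ((N * B) *\<^sub>v c)" if c: "c \<in> carrier_vec m" for c
    proof -
      have "T (B *\<^sub>v c) = (B * N) *\<^sub>v (B *\<^sub>v c)" using T B(2) c N(2) by (auto simp: bij_betw_def)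
      also have "\<dots> = B *\<^sub>v (N *\<^sub>v (B *\<^sub>v c))" using B N c by (intro assoc_mult_mat_vec) auto
      also have "\<dots> = B *\<^sub>v ((N * B) *\<^sub>v c)" using B N c by (subst assoc_mult_mat_vec) auto
      finally show ?thesis .
    qed
    have "M = N * B" if eq: "\<forall>c\<in>carrier_vec m. T (B *\<^sub>v c) = B *\<^sub>v (M *\<^sub>v c)"
    proof (rule mat_eqI_mult_vec[OF M])
      show "N * B \<in> carrier_mat m m" by (rule mult_carrier_mat[OF N(1) B(1)])
      fix c :: "'a Matrix.vec" assume c: "c \<in> carrier_vec m"
      then have "B *\<^sub>v (M *\<^sub>v c) = B *\<^sub>v ((N * B) *\<^sub>v c)" using BN eq by simp
      moreover have "M *\<^sub>v c \<in> carrier_vec m" "(N * B) *\<^sub>v c \<in> carrier_vec m"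
        using mult_mat_vec_carrier M c mult_carrier_mat[OF N(1) B(1)] by blast+
      ultimately show "M *\<^sub>v c = (N * B) *\<^sub>v c" using B(2) by (auto simp: bij_betw_def inj_on_def)
    qed
    with BN show ?thesis by blast
  qed
  have tr: "mtrace m (N * B) = mtrace n K" if "B \<in> carrier_mat n m" "N \<in> carrier_mat m n" "K = B * N" for m B N
    using mtrace_mult_commute[OF that(1,2)] that(3) by simp
  obtain m B where B: "B \<in> carrier_mat n m" "bij_betw (\<lambda>c. B *\<^sub>v c) (carrier_vec m) W"
    using subspace_basis_mat[OF W add smult] by auto
  obtain N where N: "N \<in> carrier_mat m n" "K = B * N" using fact[OF B] by blast
  have NB: "N * B \<in> carrier_mat m m" by (rule mult_carrier_mat[OF N(1) B(1)])
  show ?thesis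
    unfolding trace_on_def
  proof (rule the_equality)
    show "\<exists>m B M. B \<in> carrier_mat n m \<and> M \<in> carrier_mat m m \<and> bij_betw (\<lambda>c. B *\<^sub>v c) (carrier_vec m) W \<and>
      (\<forall>c\<in>carrier_vec m. T (B *\<^sub>v c) = B *\<^sub>v (M *\<^sub>v c)) \<and> mtrace n K = (\<Sum>i<m. M $$ (i, i))"
      using B NB mat[OF B N NB, THEN iffD1, OF refl] tr[OF B(1) N, symmetric, unfolded mtrace_def[of m]]
      by (intro exI[of _ m] exI[of _ B] exI[of _ "N * B"] conjI)
  next
    fix t assume "\<exists>m B M. B \<in> carrier_mat n m \<and> M \<in> carrier_mat m m \<and> bij_betw (\<lambda>c. B *\<^sub>v c) (carrier_vec m) W \<and>
      (\<forall>c\<in>carrier_vec m. T (B *\<^sub>v c) = B *\<^sub>v (M *\<^sub>v c)) \<and> t = (\<Sum>i<m. M $$ (i, i))"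
    then obtain m B M where B: "B \<in> carrier_mat n m" "bij_betw (\<lambda>c. B *\<^sub>v c) (carrier_vec m) W"
      and M: "M \<in> carrier_mat m m" "\<forall>c\<in>carrier_vec m. T (B *\<^sub>v c) = B *\<^sub>v (M *\<^sub>v c)"
      and t: "t = mtrace m M" unfolding mtrace_def by blast
    \<comment> \<open>The same \<open>K\<close> is factored through an arbitrary basis, so the
      candidate \<open>t\<close> cannot depend on the basis.\<close>
    obtain N where N: "N \<in> carrier_mat m n" "K = B * N" using fact[OF B] by blast
    show "t = mtrace n K" using mat[OF B N M(1), THEN iffD2, OF M(2)] t tr[OF B(1) N] by metis
  qed
qed

section \<open>Products of linear forms\<close>

text \<open>The linear functional \<open>X\<^sup>a Y\<^sup>b \<mapsto> \<phi> a b\<close>, applied to the product of the linear forms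
  \<open>\<alpha> X + \<beta> Y\<close> in a list of pairs \<open>(\<alpha>, \<beta>)\<close>.\<close>

fun apply_forms :: "('a::comm_ring_1 \<times> 'a) list \<Rightarrow> (nat \<Rightarrow> nat \<Rightarrow> 'a) \<Rightarrow> 'a" where
  "apply_forms [] \<phi> = \<phi> 0 0"
| "apply_forms ((\<alpha>, \<beta>) # ls) \<phi> =
     \<alpha> * apply_forms ls (\<lambda>a b. \<phi> (Suc a) b) + \<beta> * apply_forms ls (\<lambda>a b. \<phi> a (Suc b))"

text \<open>Here \<open>l\<close> is the exponent of \<open>Y\<close>; the exponent of
  \<open>X\<close> is determined by homogeneity.\<close>

fun form_coeff :: "('a::comm_ring_1 \<times> 'a) list \<Rightarrow> nat \<Rightarrow> 'a" where
  "form_coeff [] l = (if l = 0 then 1 else 0)"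
| "form_coeff ((\<alpha>, \<beta>) # ls) l = \<alpha> * form_coeff ls l + \<beta> * (if l = 0 then 0 else form_coeff ls (l - 1))"

lemma form_coeff_eq_0: "length ls < l \<Longrightarrow> form_coeff ls l = 0"
  by (induction ls l rule: form_coeff.induct) auto

text \<open>The \<open>X\<close> part of a new form raises the exponent of \<open>X\<close> and the
  \<open>Y\<close> part shifts \<open>l\<close>, which are the two recursive calls of
  \<open>apply_forms\<close>. This translates a row of matrix coefficients into a functional that
  can be computed one factor at a time.\<close>

lemma sum_form_coeff:
  "(\<Sum>l\<le>length ls. form_coeff ls l * \<phi> (length ls - l) l) = apply_forms ls \<phi>"
proof (induction ls arbitrary: \<phi>)
  case (Cons v ls)
  obtain \<alpha> \<beta> where v: "v = (\<alpha>, \<beta>)" by (cases v)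
  let ?n = "length ls"
  have "(\<Sum>l\<le>Suc ?n. form_coeff (v # ls) l * \<phi> (Suc ?n - l) l) =
      \<alpha> * (\<Sum>l\<le>Suc ?n. form_coeff ls l * \<phi> (Suc ?n - l) l) +
      \<beta> * (\<Sum>l\<le>Suc ?n. (if l = 0 then 0 else form_coeff ls (l - 1)) * \<phi> (Suc ?n - l) l)"
    by (simp only: v form_coeff.simps sum_distrib_left sum.distrib[symmetric] distrib_right mult.assoc)
  also have "(\<Sum>l\<le>Suc ?n. form_coeff ls l * \<phi> (Suc ?n - l) l) =
      (\<Sum>l\<le>?n. form_coeff ls l * \<phi> (Suc (?n - l)) l)"
    by (simp add: form_coeff_eq_0 Suc_diff_le)
  also have "\<dots> = apply_forms ls (\<lambda>a b. \<phi> (Suc a) b)"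
    by (rule Cons.IH)
  also have "(\<Sum>l\<le>Suc ?n. (if l = 0 then 0 else form_coeff ls (l - 1)) * \<phi> (Suc ?n - l) l) =
      (\<Sum>l\<le>?n. form_coeff ls l * \<phi> (?n - l) (Suc l))"
    by (subst sum.atMost_Suc_shift) simp
  also have "\<dots> = apply_forms ls (\<lambda>a b. \<phi> a (Suc b))"
    by (rule Cons.IH)
  finally show ?case by (simp add: v)
qed simp

lemma apply_forms_add: "apply_forms ls (\<lambda>a b. \<phi> a b + \<psi> a b) = apply_forms ls \<phi> + apply_forms ls \<psi>"
proof (induction ls arbitrary: \<phi> \<psi>)
  case (Cons v ls)
  obtain \<alpha> \<beta> where "v = (\<alpha>, \<beta>)" by (cases v)
  then show ?case by (simp add: Cons.IH distrib_left)
qed simp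

lemma apply_forms_scale: "apply_forms ls (\<lambda>a b. c * \<phi> a b) = c * apply_forms ls \<phi>"
proof (induction ls arbitrary: \<phi>)
  case (Cons v ls)
  obtain \<alpha> \<beta> where "v = (\<alpha>, \<beta>)" by (cases v)
  then show ?case by (simp add: Cons.IH distrib_left mult.left_commute)
qed simp

text \<open>On these monomial values the functional is evaluation at the point
  \<open>(x, y)\<close>, which is multiplicative.\<close>

lemma apply_forms_monomial:
  "apply_forms ls (\<lambda>a b. x ^ a * y ^ b) = (\<Prod>l\<leftarrow>ls. fst l * x + snd l * y)"
proof (induction ls)
  case (Cons v ls)
  obtain \<alpha> \<beta> where v: "v = (\<alpha>, \<beta>)" by (cases v)
  have "apply_forms ls (\<lambda>a b. x ^ Suc a * y ^ b) = x * apply_forms ls (\<lambda>a b. x ^ a * y ^ b)"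
    "apply_forms ls (\<lambda>a b. x ^ a * y ^ Suc b) = y * apply_forms ls (\<lambda>a b. x ^ a * y ^ b)"
    by (simp_all only: apply_forms_scale[symmetric] power_Suc mult.assoc mult.left_commute[of _ y])
  then have "apply_forms (v # ls) (\<lambda>a b. x ^ a * y ^ b) =
      (\<alpha> * x + \<beta> * y) * apply_forms ls (\<lambda>a b. x ^ a * y ^ b)"
    by (simp only: v apply_forms.simps distrib_right mult.assoc)
  then show ?case by (simp add: Cons.IH v)
qed simp

text \<open>\<open>monomial_deriv x y u v a b\<close> is the derivative of \<open>x\<^sup>a y\<^sup>b\<close> when \<open>x\<close>, \<open>y\<close> have derivatives \<open>u\<close>, \<open>v\<close>.\<close>

definition monomial_deriv :: "'a::comm_ring_1 \<Rightarrow> 'a \<Rightarrow> 'a \<Rightarrow> 'a \<Rightarrow> nat \<Rightarrow> nat \<Rightarrow> 'a" where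
  "monomial_deriv x y u v a b = of_nat a * x ^ (a - 1) * y ^ b * u + of_nat b * x ^ a * y ^ (b - 1) * v"

text \<open>The product rule. Truncation in \<open>a - 1\<close> at \<open>a = 0\<close> does no
  harm, because the factor \<open>of_nat a\<close> vanishes there.\<close>

lemma monomial_deriv_Suc:
  "monomial_deriv x y u v (Suc a) b = x * monomial_deriv x y u v a b + u * (x ^ a * y ^ b)"
  "monomial_deriv x y u v a (Suc b) = y * monomial_deriv x y u v a b + v * (x ^ a * y ^ b)"
  by (cases a; cases b; simp add: monomial_deriv_def algebra_simps)+

lemma apply_forms_monomial_normalized:
  assumes "\<And>l. l \<in> set ls \<Longrightarrow> fst l * x + snd l * y = 1"
  shows "apply_forms ls (\<lambda>a b. x ^ a * y ^ b) = 1"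
proof -
  have "(\<Prod>l\<leftarrow>ls. fst l * x + snd l * y) = 1" using assms by (induction ls) auto
  then show ?thesis by (simp add: apply_forms_monomial)
qed

text \<open>The Leibniz rule for a product all of whose factors equal 1 at \<open>(x, y)\<close>:
  only the derivative of one factor survives in each summand.\<close>

lemma apply_forms_monomial_deriv:
  assumes "\<And>l. l \<in> set ls \<Longrightarrow> fst l * x + snd l * y = 1"
  shows "apply_forms ls (monomial_deriv x y u v) = (\<Sum>l\<leftarrow>ls. fst l * u + snd l * v)"
  using assms
proof (induction ls)
  case Nil
  then show ?case by (simp add: monomial_deriv_def)
next
  case (Cons w ls)
  obtain \<alpha> \<beta> where w: "w = (\<alpha>, \<beta>)" by (cases w)
  let ?D = "apply_forms ls (monomial_deriv x y u v)"
  have one: "apply_forms ls (\<lambda>a b. x ^ a * y ^ b) = 1"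
    using Cons.prems by (intro apply_forms_monomial_normalized) simp
  have "(\<lambda>a. monomial_deriv x y u v (Suc a)) = (\<lambda>a b. x * monomial_deriv x y u v a b + u * (x ^ a * y ^ b))"
    "(\<lambda>a b. monomial_deriv x y u v a (Suc b)) = (\<lambda>a b. y * monomial_deriv x y u v a b + v * (x ^ a * y ^ b))"
    by (intro ext, rule monomial_deriv_Suc)+
  then have "apply_forms (w # ls) (monomial_deriv x y u v) = \<alpha> * (x * ?D + u) + \<beta> * (y * ?D + v)"
    by (simp add: w apply_forms_add apply_forms_scale one)
  also have "\<dots> = (\<alpha> * x + \<beta> * y) * ?D + (\<alpha> * u + \<beta> * v)" by (simp add: algebra_simps)
  also have "\<alpha> * x + \<beta> * y = 1" using Cons.prems[of w] by (simp add: w)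
  finally show ?case using Cons by (simp add: w)
qed

text \<open>The symmetric bilinear form of a Hessian, evaluated at the coefficient vectors of two
  linear forms.\<close>

definition polar :: "'a::comm_ring_1 \<Rightarrow> 'a \<Rightarrow> 'a \<Rightarrow> 'a \<times> 'a \<Rightarrow> 'a \<times> 'a \<Rightarrow> 'a" where
  "polar xx xy yy l m = fst l * fst m * xx + (fst l * snd m + fst m * snd l) * xy + snd l * snd m * yy"

lemma polar_commute: "polar xx xy yy l m = polar xx xy yy m l"
  by (simp add: polar_def algebra_simps)

text \<open>The subleading universal coefficients satisfy these recursions.\<close>

lemma apply_forms_second_order:
  fixes S :: "nat \<Rightarrow> nat \<Rightarrow> 'a::comm_ring_1"
  assumes "\<And>l. l \<in> set ls \<Longrightarrow> fst l * x + snd l * y = 1"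
    and S: "S 0 0 = 0" "\<And>a b. S (Suc a) b = x * S a b + monomial_deriv x y xx xy a b"
      "\<And>a b. S a (Suc b) = y * S a b + monomial_deriv x y xy yy a b"
  shows "2 * apply_forms ls S =
    (\<Sum>l\<leftarrow>ls. \<Sum>m\<leftarrow>ls. polar xx xy yy l m) - (\<Sum>l\<leftarrow>ls. polar xx xy yy l l)"
  using assms(1)
proof (induction ls)
  case Nil
  then show ?case by (simp add: S)
next
  case (Cons w ls)
  obtain \<alpha> \<beta> where w: "w = (\<alpha>, \<beta>)" by (cases w)
  let ?S = "apply_forms ls S"
  have norm: "\<And>l. l \<in> set ls \<Longrightarrow> fst l * x + snd l * y = 1" using Cons.prems by simp
  have "apply_forms ls (\<lambda>a b. S (Suc a) b) = x * ?S + (\<Sum>l\<leftarrow>ls. fst l * xx + snd l * xy)"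
    by (simp only: S(2) apply_forms_add apply_forms_scale apply_forms_monomial_deriv[OF norm])
  moreover have "apply_forms ls (\<lambda>a b. S a (Suc b)) = y * ?S + (\<Sum>l\<leftarrow>ls. fst l * xy + snd l * yy)"
    by (simp only: S(3) apply_forms_add apply_forms_scale apply_forms_monomial_deriv[OF norm])
  ultimately have "apply_forms (w # ls) S = \<alpha> * (x * ?S + (\<Sum>l\<leftarrow>ls. fst l * xx + snd l * xy)) +
      \<beta> * (y * ?S + (\<Sum>l\<leftarrow>ls. fst l * xy + snd l * yy))"
    by (simp only: w apply_forms.simps)
  also have "\<dots> = (\<alpha> * x + \<beta> * y) * ?S +
      (\<alpha> * (\<Sum>l\<leftarrow>ls. fst l * xx + snd l * xy) + \<beta> * (\<Sum>l\<leftarrow>ls. fst l * xy + snd l * yy))"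
    by (simp add: algebra_simps)
  also have "\<alpha> * x + \<beta> * y = 1" using Cons.prems[of w] by (simp add: w)
  also have "\<alpha> * (\<Sum>l\<leftarrow>ls. fst l * xx + snd l * xy) + \<beta> * (\<Sum>l\<leftarrow>ls. fst l * xy + snd l * yy) =
      (\<Sum>m\<leftarrow>ls. polar xx xy yy w m)"
    unfolding sum_list_const_mult[symmetric] sum_list_addf[symmetric]
    by (intro arg_cong[of _ _ sum_list] map_cong refl) (simp add: polar_def w algebra_simps)
  \<comment> \<open>Each new form adds its pairings with the other forms, which yields a sum over
    unordered pairs. Doubling makes it a sum over ordered pairs without its diagonal, so that no
    division by 2 occurs in the ring.\<close>
  finally have "2 * apply_forms (w # ls) S = 2 * ?S + 2 * (\<Sum>m\<leftarrow>ls. polar xx xy yy w m)"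
    by (simp add: distrib_left)
  moreover have "(\<Sum>l\<leftarrow>ls. polar xx xy yy l w) = (\<Sum>m\<leftarrow>ls. polar xx xy yy w m)"
    by (simp add: polar_commute[of _ _ _ _ w])
  ultimately show ?case using Cons.IH[OF norm] by (simp add: sum_list_addf algebra_simps)
qed

subsection \<open>Lagrange interpolation at the points \<open>(x\<^sub>i, y\<^sub>i)\<close>\<close>

text \<open>The coefficients of the linear form
  \<open>(y j * X - x j * Y) / (x i * y j - y i * x j)\<close>.\<close>

definition lagrange_form :: "(nat \<Rightarrow> 'a::field) \<Rightarrow> (nat \<Rightarrow> 'a) \<Rightarrow> nat \<Rightarrow> nat \<Rightarrow> 'a \<times> 'a" where
  "lagrange_form x y i j = (y j * inverse (x i * y j - y i * x j), - (x j * inverse (x i * y j - y i * x j)))"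

definition lagrange_forms :: "nat \<Rightarrow> (nat \<Rightarrow> 'a::field) \<Rightarrow> (nat \<Rightarrow> 'a) \<Rightarrow> nat \<Rightarrow> ('a \<times> 'a) list" where
  "lagrange_forms r x y i = map (lagrange_form x y i) (filter (\<lambda>j. j \<noteq> i) [0..<r])"

definition lagrange_coeff :: "nat \<Rightarrow> (nat \<Rightarrow> 'a::field) \<Rightarrow> (nat \<Rightarrow> 'a) \<Rightarrow> nat \<Rightarrow> nat \<Rightarrow> 'a" where
  "lagrange_coeff r x y i = form_coeff (lagrange_forms r x y i)"

lemma length_lagrange_forms: "i < r \<Longrightarrow> length (lagrange_forms r x y i) = r - 1"
proof -
  assume "i < r"
  have "length (filter (\<lambda>j. j \<noteq> i) [0..<r]) = card ({..<r} - {i})"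
    by (subst distinct_card[symmetric]) (auto intro!: arg_cong[of _ _ card])
  then show ?thesis using \<open>i < r\<close> by (simp add: lagrange_forms_def)
qed

lemma sum_lagrange_coeff:
  assumes "i < r"
  shows "(\<Sum>l<r. lagrange_coeff r x y i l * \<phi> (r - 1 - l) l) = apply_forms (lagrange_forms r x y i) \<phi>"
proof -
  have "{..<r} = {..r - 1}" using assms by auto
  with sum_form_coeff[of "lagrange_forms r x y i" \<phi>] show ?thesis
    by (simp add: length_lagrange_forms[OF assms] lagrange_coeff_def)
qed

lemma lagrange_form_eval:
  fixes x y :: "nat \<Rightarrow> 'a::field"
  assumes "x i * y j - y i * x j \<noteq> 0"
  shows "fst (lagrange_form x y i j) * x i + snd (lagrange_form x y i j) * y i = 1"
    "fst (lagrange_form x y i j) * x j + snd (lagrange_form x y i j) * y j = 0"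
proof -
  have "fst (lagrange_form x y i j) * x i + snd (lagrange_form x y i j) * y i =
      (x i * y j - y i * x j) * inverse (x i * y j - y i * x j)"
    by (simp add: lagrange_form_def algebra_simps)
  then show "fst (lagrange_form x y i j) * x i + snd (lagrange_form x y i j) * y i = 1"
    using assms by simp
qed (simp add: lagrange_form_def)

lemma lagrange_forms_normalized:
  fixes x y :: "nat \<Rightarrow> 'a::field"
  assumes "\<And>j. j < r \<Longrightarrow> i \<noteq> j \<Longrightarrow> x i * y j - y i * x j \<noteq> 0" "l \<in> set (lagrange_forms r x y i)"
  shows "fst l * x i + snd l * y i = 1"
proof -
  obtain j where "l = lagrange_form x y i j" "j < r" "i \<noteq> j" using assms(2) by (auto simp: lagrange_forms_def)
  then show ?thesis using lagrange_form_eval(1)[of x i y j] assms(1) by metis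
qed

lemma lagrange_coeff_kronecker:
  fixes x y :: "nat \<Rightarrow> 'a::field"
  assumes i: "i < r" and m: "m < r" and ne: "\<And>j. j < r \<Longrightarrow> i \<noteq> j \<Longrightarrow> x i * y j - y i * x j \<noteq> 0"
  shows "(\<Sum>l<r. lagrange_coeff r x y i l * (x m ^ (r - 1 - l) * y m ^ l)) = (if i = m then 1 else 0)"
proof -
  have "(\<Sum>l<r. lagrange_coeff r x y i l * (x m ^ (r - 1 - l) * y m ^ l)) =
      apply_forms (lagrange_forms r x y i) (\<lambda>a b. x m ^ a * y m ^ b)"
    using sum_lagrange_coeff[OF i, of x y "\<lambda>a b. x m ^ a * y m ^ b"] .
  also have "\<dots> = (if i = m then 1 else 0)"
  proof (cases "i = m")
    case True
    have "fst l * x i + snd l * y i = 1" if "l \<in> set (lagrange_forms r x y i)" for l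
      by (rule lagrange_forms_normalized[of r i x y, OF _ that]) (rule ne)
    from apply_forms_monomial_normalized[of "lagrange_forms r x y i" "x i" "y i", OF this] show ?thesis
      using True by simp
  next
    case False
    have "lagrange_form x y i m \<in> set (lagrange_forms r x y i)"
      using False m by (auto simp: lagrange_forms_def)
    then have "(\<Prod>l\<leftarrow>lagrange_forms r x y i. fst l * x m + snd l * y m) = 0"
      using lagrange_form_eval(2)[of x i y m] ne[OF m False]
      unfolding prod_list_zero_iff set_map by (metis (no_types, lifting) imageI)
    then show ?thesis using False by (simp add: apply_forms_monomial)
  qed
  finally show ?thesis .
qed

lemma sum_list_lagrange_forms:
  "(\<Sum>l\<leftarrow>lagrange_forms r x y i. g l) = (\<Sum>j\<in>{..<r} - {i}. g (lagrange_form x y i j))"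
proof -
  have "{j \<in> {0..<r}. j \<noteq> i} = {..<r} - {i}" by auto
  then show ?thesis
    by (simp add: lagrange_forms_def o_def sum_list_distinct_conv_sum_set)
qed

section \<open>Sums over triples\<close>

lemma sum_pairs:
  fixes T :: "nat \<Rightarrow> nat \<Rightarrow> 'a::comm_monoid_add"
  shows "(\<Sum>i<d. \<Sum>j\<in>{..<d} - {i}. T i j) = (\<Sum>j<d. \<Sum>i<j. T i j + T j i)"
proof (induction d)
  case (Suc d)
  have "(\<Sum>j\<in>{..<Suc d} - {i}. T i j) = (\<Sum>j\<in>{..<d} - {i}. T i j) + T i d" if "i < d" for i
  proof -
    have "{..<Suc d} - {i} = insert d ({..<d} - {i})" using that by auto
    then show ?thesis by (simp add: add.commute)
  qed
  moreover have "{..<Suc d} - {d} = {..<d}" by auto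
  ultimately show ?case by (simp add: sum.distrib Suc.IH ac_simps)
qed simp

text \<open>Ordered triples of distinct indices are the six orderings of \<open>i < j < k\<close>.
  In the induction the new triples have \<open>d\<close> in one of three places, and the other two
  indices are handled by \<open>sum_pairs\<close>.\<close>

lemma sum_triples:
  fixes T :: "nat \<Rightarrow> nat \<Rightarrow> nat \<Rightarrow> 'a::comm_monoid_add"
  shows "(\<Sum>i<d. \<Sum>j\<in>{..<d} - {i}. \<Sum>k\<in>{..<d} - {i, j}. T i j k) =
    (\<Sum>k<d. \<Sum>j<k. \<Sum>i<j. T i j k + T i k j + T j i k + T j k i + T k i j + T k j i)"
proof (induction d)
  case (Suc d)
  have k: "(\<Sum>k\<in>{..<Suc d} - {i, j}. T i j k) = (\<Sum>k\<in>{..<d} - {i, j}. T i j k) + T i j d"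
    if "i < d" "j < d" for i j
  proof -
    have "{..<Suc d} - {i, j} = insert d ({..<d} - {i, j})" using that by auto
    then show ?thesis by (simp add: add.commute)
  qed
  have j: "(\<Sum>j\<in>{..<Suc d} - {i}. \<Sum>k\<in>{..<Suc d} - {i, j}. T i j k) =
      (\<Sum>j\<in>{..<d} - {i}. \<Sum>k\<in>{..<d} - {i, j}. T i j k) + (\<Sum>j\<in>{..<d} - {i}. T i j d) + (\<Sum>k\<in>{..<d} - {i}. T i d k)"
    if "i < d" for i
  proof -
    have "{..<Suc d} - {i} = insert d ({..<d} - {i})" "{..<Suc d} - {i, d} = {..<d} - {i}" using that by auto
    then have "(\<Sum>j\<in>{..<Suc d} - {i}. \<Sum>k\<in>{..<Suc d} - {i, j}. T i j k) =
        (\<Sum>j\<in>{..<d} - {i}. \<Sum>k\<in>{..<Suc d} - {i, j}. T i j k) + (\<Sum>k\<in>{..<d} - {i}. T i d k)"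
      by (simp add: add.commute)
    also have "(\<Sum>j\<in>{..<d} - {i}. \<Sum>k\<in>{..<Suc d} - {i, j}. T i j k) =
        (\<Sum>j\<in>{..<d} - {i}. (\<Sum>k\<in>{..<d} - {i, j}. T i j k) + T i j d)"
      using that by (intro sum.cong refl k) auto
    finally show ?thesis by (simp add: sum.distrib)
  qed
  have "{..<Suc d} - {d} = {..<d}" "\<And>j. {..<Suc d} - {d, j} = {..<d} - {j}" by auto
  then have "(\<Sum>i<Suc d. \<Sum>j\<in>{..<Suc d} - {i}. \<Sum>k\<in>{..<Suc d} - {i, j}. T i j k) =
      (\<Sum>i<d. \<Sum>j\<in>{..<Suc d} - {i}. \<Sum>k\<in>{..<Suc d} - {i, j}. T i j k) + (\<Sum>j<d. \<Sum>k\<in>{..<d} - {j}. T d j k)"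
    by simp
  also have "(\<Sum>i<d. \<Sum>j\<in>{..<Suc d} - {i}. \<Sum>k\<in>{..<Suc d} - {i, j}. T i j k) =
      (\<Sum>i<d. \<Sum>j\<in>{..<d} - {i}. \<Sum>k\<in>{..<d} - {i, j}. T i j k) +
      (\<Sum>i<d. \<Sum>j\<in>{..<d} - {i}. T i j d) + (\<Sum>i<d. \<Sum>j\<in>{..<d} - {i}. T i d j)"
    by (simp add: j sum.distrib)
  also note Suc.IH
  also note sum_pairs[of "\<lambda>i j. T i j d"]
  also note sum_pairs[of "\<lambda>i j. T i d j"]
  also note sum_pairs[of "\<lambda>i j. T d i j"]
  finally show ?case by (simp add: sum.distrib ac_simps)
qed simp

section \<open>Calculus in a structure sheaf\<close>

text \<open>The Boolean selects the variable, so that statements about \<open>x\<close> and \<open>y\<close> are proved once.\<close>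

definition pd :: "bool \<Rightarrow> ('k::real_normed_field \<times> 'k \<Rightarrow> 'k) \<Rightarrow> 'k \<times> 'k \<Rightarrow> 'k" where
  "pd c = (if c then dx else dy)"

lemma pd_simps [simp]: "pd True = dx" "pd False = dy"
  by (simp_all add: pd_def)

lemma pd_cong:
  assumes "open V" "p \<in> V" "\<And>q. q \<in> V \<Longrightarrow> g q = h q"
  shows "pd c g p = pd c h p"
  using partial_cong[OF assms] by (simp add: pd_def)

lemma dx_const [simp]: "dx (\<lambda>_. a) p = 0" and dy_const [simp]: "dy (\<lambda>_. a) p = 0"
  by (simp_all add: dx_def dy_def)

lemma pd_const [simp]: "pd c (\<lambda>_. a) p = 0"
  by (simp add: pd_def)

context function_sheaf
begin

lemma pd_closed: "g \<in> \<O> V \<Longrightarrow> open V \<Longrightarrow> pd c g \<in> \<O> V"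
  by (simp add: pd_def dx_closed dy_closed)

lemma pd_pd: "g \<in> \<O> V \<Longrightarrow> open V \<Longrightarrow> p \<in> V \<Longrightarrow> pd c (pd c' g) p = pd c' (pd c g) p"
  by (cases c; cases c'; simp add: dx_dy)

lemma pd_add:
  assumes "g \<in> \<O> V" "h \<in> \<O> V" "open V" "p \<in> V"
  shows "pd c (\<lambda>q. g q + h q) p = pd c g p + pd c h p"
proof -
  have "dx (\<lambda>q. g q + h q) p = dx g p + dx h p" unfolding dx_def[of "\<lambda>q. g q + h q"]
    by (intro DERIV_imp_deriv DERIV_add has_dx[OF assms(1,3,4)] has_dx[OF assms(2,3,4)])
  moreover have "dy (\<lambda>q. g q + h q) p = dy g p + dy h p" unfolding dy_def[of "\<lambda>q. g q + h q"]
    by (intro DERIV_imp_deriv DERIV_add has_dy[OF assms(1,3,4)] has_dy[OF assms(2,3,4)])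
  ultimately show ?thesis by (cases c) simp_all
qed

lemma pd_mult:
  assumes "g \<in> \<O> V" "h \<in> \<O> V" "open V" "p \<in> V"
  shows "pd c (\<lambda>q. g q * h q) p = pd c g p * h p + g p * pd c h p"
proof -
  have "dx (\<lambda>q. g q * h q) p = dx g p * h (fst p, snd p) + dx h p * g (fst p, snd p)" unfolding dx_def[of "\<lambda>q. g q * h q"]
    by (intro DERIV_imp_deriv DERIV_mult has_dx[OF assms(1,3,4)] has_dx[OF assms(2,3,4)])
  moreover have "dy (\<lambda>q. g q * h q) p = dy g p * h (fst p, snd p) + dy h p * g (fst p, snd p)" unfolding dy_def[of "\<lambda>q. g q * h q"]
    by (intro DERIV_imp_deriv DERIV_mult has_dy[OF assms(1,3,4)] has_dy[OF assms(2,3,4)])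
  ultimately show ?thesis by (cases c) (simp_all add: mult.commute)
qed

lemma scale: "g \<in> \<O> V \<Longrightarrow> open V \<Longrightarrow> (\<lambda>q. a * g q) \<in> \<O> V"
  using mult const by blast

lemma pd_scale:
  assumes "g \<in> \<O> V" "open V" "p \<in> V"
  shows "pd c (\<lambda>q. a * g q) p = a * pd c g p"
  using pd_mult[OF const assms(1,2,3)] assms by simp

lemma uminus: "g \<in> \<O> V \<Longrightarrow> open V \<Longrightarrow> (\<lambda>q. - g q) \<in> \<O> V"
  using scale[of g V "-1"] by simp

lemma diff: "g \<in> \<O> V \<Longrightarrow> h \<in> \<O> V \<Longrightarrow> open V \<Longrightarrow> (\<lambda>q. g q - h q) \<in> \<O> V"
  using add[of g V "\<lambda>q. - h q"] uminus[of h V] by simp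

lemma pd_diff:
  assumes "g \<in> \<O> V" "h \<in> \<O> V" "open V" "p \<in> V"
  shows "pd c (\<lambda>q. g q - h q) p = pd c g p - pd c h p"
  using pd_add[OF assms(1) uminus[OF assms(2,3)] assms(3,4), of c] pd_scale[OF assms(2-4), of c "-1"] by simp

lemma sum: "open V \<Longrightarrow> (\<And>i. i \<in> I \<Longrightarrow> g i \<in> \<O> V) \<Longrightarrow> (\<lambda>q. \<Sum>i\<in>I. g i q) \<in> \<O> V"
  by (induction I rule: infinite_finite_induct) (simp_all add: const add)

lemma pd_sum:
  assumes "open V" "p \<in> V"
  shows "(\<And>i. i \<in> I \<Longrightarrow> g i \<in> \<O> V) \<Longrightarrow> pd c (\<lambda>q. \<Sum>i\<in>I. g i q) p = (\<Sum>i\<in>I. pd c (g i) p)"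
proof (induction I rule: infinite_finite_induct)
  case (insert i I)
  then have "pd c (\<lambda>q. g i q + (\<Sum>i\<in>I. g i q)) p = pd c (g i) p + pd c (\<lambda>q. \<Sum>i\<in>I. g i q) p"
    using assms by (intro pd_add[OF _ _ assms]) (simp_all add: sum)
  with insert show ?case by simp
qed simp_all

lemma power: "open V \<Longrightarrow> g \<in> \<O> V \<Longrightarrow> (\<lambda>q. g q ^ n) \<in> \<O> V"
  by (induction n) (simp_all add: const mult)

lemma pd_power:
  assumes "g \<in> \<O> V" "open V" "p \<in> V"
  shows "pd c (\<lambda>q. g q ^ n) p = of_nat n * g p ^ (n - 1) * pd c g p"
proof (induction n)
  case (Suc n)
  have "pd c (\<lambda>q. g q * g q ^ n) p = pd c g p * g p ^ n + g p * pd c (\<lambda>q. g q ^ n) p"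
    by (rule pd_mult[OF assms(1) power[OF assms(2,1)] assms(2,3)])
  with Suc show ?case by (cases n) (simp_all add: algebra_simps)
qed simp

section \<open>Universal coefficients\<close>

lemma univ_coeff_closed: "g \<in> \<O> V \<Longrightarrow> open V \<Longrightarrow> univ_coeff g a b k \<in> \<O> V"
proof (induction g a b k rule: univ_coeff.induct)
  case (1 g k)
  then show ?case by (simp add: const)
next
  case (2 g b k)
  then show ?case by (cases k) (simp_all add: add mult dy_closed)
next
  case (3 g a b k)
  then show ?case by (cases k) (simp_all add: add mult dx_closed)
qed

text \<open>The definition provides the recursion in \<open>b\<close> only for \<open>a = 0\<close>.
  Induction on \<open>a\<close> extends it, using symmetry of mixed derivatives for \<open>g\<close>
  and for the coefficients themselves.\<close>

lemma univ_coeff_Suc_right: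
  assumes g: "g \<in> \<O> V" and V: "open V"
  shows "q \<in> V \<Longrightarrow> univ_coeff g a (Suc b) k q =
    dy (univ_coeff g a b k) q + dy g q * (if k = 0 then 0 else univ_coeff g a b (k - 1) q)"
proof (induction a arbitrary: k q)
  case (Suc a)
  note cl = univ_coeff_closed[OF g V] dx_closed[OF g V] dy_closed[OF g V]
    pd_closed[OF univ_coeff_closed[OF g V] V] pd_closed[OF pd_closed[OF g V] V]
  have pdpd: "dx (dy g) q = dy (dx g) q" "dx (dy (univ_coeff g a b k)) q = dy (dx (univ_coeff g a b k)) q" for k
    using dx_dy[OF _ V Suc.prems] cl(1) g by simp_all
  have cl': "dy (univ_coeff g a b k) \<in> \<O> V" "dx (univ_coeff g a b k) \<in> \<O> V" for k
    using cl dx_closed dy_closed V by simp_all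
  show ?case
  proof (cases k)
    case 0
    have "dx (univ_coeff g a (Suc b) 0) q = dx (dy (univ_coeff g a b 0)) q"
      by (rule partial_cong(1)[OF V Suc.prems]) (simp add: Suc.IH)
    then show ?thesis by (simp add: 0 pdpd)
  next
    case (Suc k')
    have eq: "dx (univ_coeff g a (Suc b) k) q =
        dx (\<lambda>q. dy (univ_coeff g a b k) q + dy g q * univ_coeff g a b k' q) q"
      by (rule partial_cong(1)[OF V Suc.prems]) (simp add: Suc.IH Suc)
    have dx: "dx (\<lambda>q. dy (univ_coeff g a b k) q + dy g q * univ_coeff g a b k' q) q =
        dx (dy (univ_coeff g a b k)) q + (dx (dy g) q * univ_coeff g a b k' q + dy g q * dx (univ_coeff g a b k') q)"
      using pd_add[where c = True, OF cl'(1)[of k] mult[OF cl(3) cl(1)[of a b k'] V] V Suc.prems]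
        pd_mult[where c = True, OF cl(3) cl(1)[of a b k'] V Suc.prems] by simp
    have "dy (univ_coeff g (Suc a) b k) q = dy (\<lambda>q. dx (univ_coeff g a b k) q + dx g q * univ_coeff g a b k' q) q"
      by (simp add: Suc)
    also have "\<dots> = dy (dx (univ_coeff g a b k)) q + (dy (dx g) q * univ_coeff g a b k' q + dx g q * dy (univ_coeff g a b k') q)"
      using pd_add[where c = False, OF cl'(2)[of k] mult[OF cl(2) cl(1)[of a b k'] V] V Suc.prems]
        pd_mult[where c = False, OF cl(2) cl(1)[of a b k'] V Suc.prems] by simp
    finally have dy: "dy (univ_coeff g (Suc a) b k) q =
      dy (dx (univ_coeff g a b k)) q + (dy (dx g) q * univ_coeff g a b k' q + dx g q * dy (univ_coeff g a b k') q)" .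
    have 1: "univ_coeff g (Suc a) (Suc b) k q = dx (univ_coeff g a (Suc b) k) q + dx g q * univ_coeff g a (Suc b) k' q"
      by (simp add: Suc)
    have 2: "univ_coeff g a (Suc b) k' q =
        dy (univ_coeff g a b k') q + dy g q * (if k' = 0 then 0 else univ_coeff g a b (k' - 1) q)"
      by (rule Suc.IH[OF Suc.prems])
    have 3: "univ_coeff g (Suc a) b k' q =
        dx (univ_coeff g a b k') q + dx g q * (if k' = 0 then 0 else univ_coeff g a b (k' - 1) q)"
      by simp
    have 4: "(if k = 0 then 0 else univ_coeff g (Suc a) b (k - 1) q) = univ_coeff g (Suc a) b k' q"
      by (simp add: Suc)
    show ?thesis unfolding 4 unfolding dy 1 2 3 eq dx pdpd by (simp add: algebra_simps)
  qed
qed simp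

lemma univ_coeff_inc:
  assumes "g \<in> \<O> V" "open V" "q \<in> V"
  shows "univ_coeff g (if c then Suc a else a) (if c then b else Suc b) k q =
    pd c (univ_coeff g a b k) q + pd c g q * (if k = 0 then 0 else univ_coeff g a b (k - 1) q)"
  using univ_coeff_Suc_right[OF assms] by (cases c) simp_all

lemma univ_coeff_above:
  assumes g: "g \<in> \<O> V" and V: "open V"
  shows "q \<in> V \<Longrightarrow> a + b < k \<Longrightarrow> univ_coeff g a b k q = 0"
proof (induction g a b k arbitrary: q rule: univ_coeff.induct)
  case (2 g b k)
  have "dy (univ_coeff g 0 b k) q = dy (\<lambda>_. 0) q"
    by (rule partial_cong(2)[OF V 2(3)]) (use 2 in simp)
  with 2 show ?case by simp
next
  case (3 g a b k)
  have "dx (univ_coeff g a b k) q = dx (\<lambda>_. 0) q"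
    by (rule partial_cong(1)[OF V 3(3)]) (use 3 in simp)
  with 3 show ?case by simp
qed simp

text \<open>A derivative of positive order contains no undifferentiated outer function; this is why
  the sums over \<open>k\<close> in jets may start at 1.\<close>

lemma univ_coeff_0:
  assumes V: "open V"
  shows "q \<in> V \<Longrightarrow> 0 < a + b \<Longrightarrow> k = 0 \<Longrightarrow> univ_coeff g a b k q = 0"
proof (induction g a b k arbitrary: q rule: univ_coeff.induct)
  case (2 g b k)
  have "dy (univ_coeff g 0 b k) q = 0"
  proof (cases "b = 0")
    case True
    then show ?thesis by simp
  next
    case False
    have "dy (univ_coeff g 0 b k) q = dy (\<lambda>_. 0) q"
      by (rule partial_cong(2)[OF V 2(3)]) (use 2 False in simp)
    then show ?thesis by simp
  qed
  with 2 show ?case by simp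
next
  case (3 g a b k)
  have "dx (univ_coeff g a b k) q = 0"
  proof (cases "a + b = 0")
    case True
    then show ?thesis by simp
  next
    case False
    have "dx (univ_coeff g a b k) q = dx (\<lambda>_. 0) q"
      by (rule partial_cong(1)[OF V 3(3)]) (use 3 False in simp)
    then show ?thesis by simp
  qed
  with 3 show ?case by simp
qed simp

lemma univ_coeff_top:
  assumes g: "g \<in> \<O> V" and V: "open V"
  shows "q \<in> V \<Longrightarrow> k = a + b \<Longrightarrow> univ_coeff g a b k q = dx g q ^ a * dy g q ^ b"
  using g
proof (induction g a b k arbitrary: q rule: univ_coeff.induct)
  case (2 g b k)
  have "dy (univ_coeff g 0 b k) q = dy (\<lambda>_. 0) q"
    by (rule partial_cong(2)[OF V 2(3)]) (use 2 univ_coeff_above[OF 2(5) V] in simp)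
  with 2 show ?case by simp
next
  case (3 g a b k)
  have "dx (univ_coeff g a b k) q = dx (\<lambda>_. 0) q"
    by (rule partial_cong(1)[OF V 3(3)]) (use 3 univ_coeff_above[OF 3(5) V] in simp)
  with 3 show ?case by simp
qed simp

lemma pd_monomial:
  assumes g: "g \<in> \<O> V" and V: "open V" "q \<in> V"
  shows "pd c (\<lambda>q. dx g q ^ a * dy g q ^ b) q =
    monomial_deriv (dx g q) (dy g q) (pd c (dx g) q) (pd c (dy g) q) a b"
  using pd_mult[OF power[OF V(1) dx_closed[OF g V(1)]] power[OF V(1) dy_closed[OF g V(1)]] V]
    pd_power[OF dx_closed[OF g V(1)] V] pd_power[OF dy_closed[OF g V(1)] V]
  by (simp add: monomial_deriv_def algebra_simps)

text \<open>At \<open>a = b = 0\<close> truncated subtraction would return the leading coefficient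
  1. The value 0 is the one with which the recursions start correctly.\<close>

definition subleading :: "('k \<times> 'k \<Rightarrow> 'k) \<Rightarrow> 'k \<times> 'k \<Rightarrow> nat \<Rightarrow> nat \<Rightarrow> 'k" where
  "subleading g q a b = (if a + b = 0 then 0 else univ_coeff g a b (a + b - 1) q)"

text \<open>In the recursion of the universal coefficients for \<open>k = a + b\<close> the
  differentiated coefficient is the leading one, a monomial in the first derivatives of
  \<open>g\<close>.\<close>

lemma subleading_inc:
  assumes g: "g \<in> \<O> V" and V: "open V" "q \<in> V"
  shows "subleading g q (if c then Suc a else a) (if c then b else Suc b) =
    pd c g q * subleading g q a b + monomial_deriv (dx g q) (dy g q) (pd c (dx g) q) (pd c (dy g) q) a b"
proof -
  have "pd c (univ_coeff g a b (a + b)) q = pd c (\<lambda>q. dx g q ^ a * dy g q ^ b) q"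
    by (rule pd_cong[OF V]) (rule univ_coeff_top[OF g V(1)], simp_all)
  moreover have "subleading g q (if c then Suc a else a) (if c then b else Suc b) =
      univ_coeff g (if c then Suc a else a) (if c then b else Suc b) (a + b) q"
    by (cases c) (simp_all add: subleading_def del: univ_coeff.simps)
  ultimately show ?thesis
    unfolding univ_coeff_inc[OF assms] pd_monomial[OF assms] by (simp add: subleading_def)
qed

lemma subleading_Suc:
  assumes "g \<in> \<O> V" "open V" "q \<in> V"
  shows "subleading g q (Suc a) b =
      dx g q * subleading g q a b + monomial_deriv (dx g q) (dy g q) (dx (dx g) q) (dx (dy g) q) a b"
    "subleading g q a (Suc b) =
      dy g q * subleading g q a b + monomial_deriv (dx g q) (dy g q) (dx (dy g) q) (dy (dy g) q) a b"
  using subleading_inc[OF assms, of True a b] subleading_inc[OF assms, of False a b] dx_dy[OF assms] by simp_all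

text \<open>The forms are kept as functions of the point and evaluated through \<open>map\<close>,
  so that the induction can run over the list.\<close>

lemma form_coeff_closed:
  assumes V: "open V"
  shows "(\<And>n. n < length ls \<Longrightarrow> (\<lambda>q. fst ((ls ! n) q)) \<in> \<O> V \<and> (\<lambda>q. snd ((ls ! n) q)) \<in> \<O> V) \<Longrightarrow>
    (\<lambda>q. form_coeff (map (\<lambda>h. h q) ls) l) \<in> \<O> V"
proof (induction ls arbitrary: l)
  case Nil
  then show ?case using V by (simp add: const)
next
  case (Cons h ls)
  have IH: "(\<lambda>q. form_coeff (map (\<lambda>h. h q) ls) l) \<in> \<O> V" for l
    using Cons.prems[of "Suc _"] by (intro Cons.IH) simp
  have h: "(\<lambda>q. fst (h q)) \<in> \<O> V" "(\<lambda>q. snd (h q)) \<in> \<O> V" using Cons.prems[of 0] by simp_all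
  have "form_coeff (map (\<lambda>h. h q) (h # ls)) l = fst (h q) * form_coeff (map (\<lambda>h. h q) ls) l +
      snd (h q) * (if l = 0 then 0 else form_coeff (map (\<lambda>h. h q) ls) (l - 1))" for q
    by (cases "h q") simp
  then show ?case using IH h V by (cases "l = 0") (simp_all add: add mult const)
qed

lemma lagrange_coeff_closed:
  assumes V: "open V" and xy: "\<And>j. j < r \<Longrightarrow> x j \<in> \<O> V" "\<And>j. j < r \<Longrightarrow> y j \<in> \<O> V"
    and i: "i < r" and ne: "\<And>j q. j < r \<Longrightarrow> i \<noteq> j \<Longrightarrow> q \<in> V \<Longrightarrow> x i q * y j q - y i q * x j q \<noteq> 0"
  shows "(\<lambda>q. lagrange_coeff r (\<lambda>j. x j q) (\<lambda>j. y j q) i l) \<in> \<O> V"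
proof -
  let ?f = "\<lambda>j q. lagrange_form (\<lambda>j. x j q) (\<lambda>j. y j q) i j"
  have cl: "(\<lambda>q. fst (?f j q)) \<in> \<O> V" "(\<lambda>q. snd (?f j q)) \<in> \<O> V" if "j < r" "j \<noteq> i" for j
  proof -
    have "(\<lambda>q. inverse (x i q * y j q - y i q * x j q)) \<in> \<O> V"
      using that xy i ne by (intro inverse diff mult V) auto
    then show "(\<lambda>q. fst (?f j q)) \<in> \<O> V" "(\<lambda>q. snd (?f j q)) \<in> \<O> V"
      using that xy V by (simp_all add: lagrange_form_def mult uminus)
  qed
  have "(\<lambda>q. form_coeff (map (\<lambda>h. h q) (map ?f (filter (\<lambda>j. j \<noteq> i) [0..<r]))) l) \<in> \<O> V"
  proof (rule form_coeff_closed[OF V])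
    fix n assume "n < length (map ?f (filter (\<lambda>j. j \<noteq> i) [0..<r]))"
    then have n: "n < length (filter (\<lambda>j. j \<noteq> i) [0..<r])" by simp
    then have "filter (\<lambda>j. j \<noteq> i) [0..<r] ! n \<in> set (filter (\<lambda>j. j \<noteq> i) [0..<r])" by (rule nth_mem)
    with n cl show "(\<lambda>q. fst ((map ?f (filter (\<lambda>j. j \<noteq> i) [0..<r]) ! n) q)) \<in> \<O> V \<and>
        (\<lambda>q. snd ((map ?f (filter (\<lambda>j. j \<noteq> i) [0..<r]) ! n) q)) \<in> \<O> V" by simp
  qed
  then show ?thesis by (simp add: lagrange_coeff_def lagrange_forms_def o_def)
qed

end

section \<open>The connection of a web\<close>

text \<open>The position of the \<open>i\<close>-th entry of \<open>\<omega>\<^sup>s\<close> in \<open>\<omega>\<close>, for \<open>s \<ge> 1\<close>.\<close>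

definition pos :: "nat \<Rightarrow> nat \<Rightarrow> nat \<Rightarrow> nat" where
  "pos d s i = (s - 1) * d + i"

lemma sum_pos:
  fixes g :: "nat \<Rightarrow> 'a::comm_monoid_add"
  shows "(\<Sum>a<d * n. g a) = (\<Sum>s\<in>{1..n}. \<Sum>i<d. g (pos d s i))"
proof -
  have "(\<Sum>a<d * n. g a) = (\<Sum>m<n. sum g {m * d..<m * d + d})"
    using sum.nat_group[of g d n] by (simp add: mult.commute)
  also have "\<dots> = (\<Sum>m<n. \<Sum>i<d. g (m * d + i))"
  proof (rule sum.cong[OF refl])
    fix m
    show "sum g {m * d..<m * d + d} = (\<Sum>i<d. g (m * d + i))"
      using sum.shift_bounds_nat_ivl[of g 0 "m * d" d] by (simp add: atLeast0LessThan add.commute)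
  qed
  also have "\<dots> = (\<Sum>s\<in>{1..n}. \<Sum>i<d. g (pos d s i))"
    by (rule sum.reindex_bij_witness[of _ "\<lambda>s. s - 1" Suc]) (auto simp: pos_def)
  finally show ?thesis .
qed

lemma pos_less:
  assumes "1 \<le> s" "s \<le> n" "i < d"
  shows "pos d s i < d * n"
proof -
  have "(s - 1) * d + i < (s - 1) * d + d" using assms(3) by simp
  also have "\<dots> = s * d" using assms(1) by (cases s) simp_all
  also have "\<dots> \<le> d * n" using assms(2) by simp
  finally show ?thesis by (simp add: pos_def)
qed

lemma pos_cases:
  assumes "a < d * n"
  obtains s i where "1 \<le> s" "s \<le> n" "i < d" "a = pos d s i"
proof (rule that[of "a div d + 1" "a mod d"])
  show "a mod d < d" using assms by (cases "d = 0") simp_all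
  have "a div d < n" using assms by (simp add: less_mult_imp_div_less mult.commute)
  then show "a div d + 1 \<le> n" by simp
qed (simp_all add: pos_def)

lemma pos_div_mod:
  assumes "1 \<le> s" "i < d"
  shows "pos d s i div d + 1 = s" "pos d s i mod d = i"
  using assms by (simp_all add: pos_def)

lemma pos_add: "1 \<le> s \<Longrightarrow> pos d s i + d = pos d (s + 1) i"
  by (cases s) (simp_all add: pos_def)

locale web = function_sheaf \<O> for \<O> :: "'k::real_normed_field sheaf" +
  fixes d :: nat and f :: "nat \<Rightarrow> 'k \<times> 'k \<Rightarrow> 'k" and U :: "('k \<times> 'k) set"
  assumes web: "planar_web \<O> d f U" and d3: "3 \<le> d"
begin

section \<open>The matrices of the web and their inverses\<close>

lemma open_U: "open U" and f_closed: "i < d \<Longrightarrow> f i \<in> \<O> U"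
  and wedge_nonzero: "q \<in> U \<Longrightarrow> i < d \<Longrightarrow> j < d \<Longrightarrow> i \<noteq> j \<Longrightarrow>
    dx (f i) q * dy (f j) q - dy (f i) q * dx (f j) q \<noteq> 0"
  using web by (auto simp: planar_web_def wedge_d_def)

abbreviation N :: nat where "N \<equiv> d * (d - 2)"

lemma total_dim: "total_dim d = N"
  by (simp add: total_dim_def)

text \<open>For \<open>r = d\<close> these are the entries of the inverse of
  \<open>P_mat d f d q\<close>. For smaller \<open>r\<close> they invert the square part of
  \<open>P_mat d f r q\<close> belonging to the first \<open>r\<close> functions, which is used to
  construct sections of \<open>E\<close>.\<close>

definition lag :: "nat \<Rightarrow> nat \<Rightarrow> nat \<Rightarrow> 'k \<times> 'k \<Rightarrow> 'k" where
  "lag r i l q = lagrange_coeff r (\<lambda>j. dx (f j) q) (\<lambda>j. dy (f j) q) i l"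

lemma lag_closed: "i < r \<Longrightarrow> r \<le> d \<Longrightarrow> lag r i l \<in> \<O> U"
  unfolding lag_def using wedge_nonzero
  by (intro lagrange_coeff_closed[OF open_U] dx_closed dy_closed f_closed open_U) auto

lemma lag_left_inverse:
  assumes "i < r" "m < r" "r \<le> d" "q \<in> U"
  shows "(\<Sum>l<r. lag r i l q * (dx (f m) q ^ (r - 1 - l) * dy (f m) q ^ l)) = (if i = m then 1 else 0)"
  unfolding lag_def using assms wedge_nonzero by (intro lagrange_coeff_kronecker) auto

text \<open>Interpolation gives a left inverse, and a left inverse of a square matrix over a field
  is two-sided.\<close>

lemma lag_right_inverse:
  assumes "l < r" "l' < r" "r \<le> d" "q \<in> U"
  shows "(\<Sum>i<r. dx (f i) q ^ (r - 1 - l) * dy (f i) q ^ l * lag r i l' q) = (if l = l' then 1 else 0)"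
proof -
  define A where "A = Matrix.mat r r (\<lambda>(i, l). lag r i l q)"
  define B where "B = Matrix.mat r r (\<lambda>(l, i). dx (f i) q ^ (r - 1 - l) * dy (f i) q ^ l)"
  have AB: "A \<in> carrier_mat r r" "B \<in> carrier_mat r r" by (simp_all add: A_def B_def)
  have "A * B = 1\<^sub>m r"
  proof (rule eq_matI)
    fix i j assume "i < dim_row (1\<^sub>m r :: 'k mat)" "j < dim_col (1\<^sub>m r :: 'k mat)"
    then have ij: "i < r" "j < r" by simp_all
    then show "(A * B) $$ (i, j) = 1\<^sub>m r $$ (i, j)"
      using lag_left_inverse[OF ij assms(3,4)]
      by (simp add: A_def B_def scalar_prod_def atLeast0LessThan)
  qed (simp_all add: A_def B_def)
  then have "B * A = 1\<^sub>m r" by (rule mat_mult_left_right_inverse[OF AB])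
  then have "(B * A) $$ (l, l') = (if l = l' then 1 else 0)" using assms by simp
  then show ?thesis using assms by (simp add: A_def B_def scalar_prod_def atLeast0LessThan)
qed

text \<open>\<open>A_mat\<close> is defined by the Gauss-Jordan inverse, whose dependence on the
  point is opaque. Uniqueness of inverses replaces it by Lagrange coefficients, which visibly lie in
  the structure sheaf.\<close>

lemma A_mat_entry:
  assumes q: "q \<in> U" and i: "i < d" and m: "m < d"
  shows "A_mat d f j q $$ (i, m) = - (\<Sum>l<d. lag d i l q * univ_coeff (f m) (d - 1 - l) l (d - j) q)"
proof -
  define Q where "Q = Matrix.mat d d (\<lambda>(i, l). lag d i l q)"
  have Q: "Q \<in> carrier_mat d d" and P: "P_mat d f d q \<in> carrier_mat d d" by (simp_all add: Q_def P_mat_def)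
  have QP: "Q * P_mat d f d q = 1\<^sub>m d"
  proof (rule eq_matI)
    fix i j assume "i < dim_row (1\<^sub>m d :: 'k mat)" "j < dim_col (1\<^sub>m d :: 'k mat)"
    then have ij: "i < d" "j < d" by simp_all
    then show "(Q * P_mat d f d q) $$ (i, j) = 1\<^sub>m d $$ (i, j)"
      using lag_left_inverse[OF ij _ q] by (simp add: Q_def P_mat_def scalar_prod_def atLeast0LessThan)
  qed (simp_all add: Q_def P_mat_def)
  then have PQ: "P_mat d f d q * Q = 1\<^sub>m d" by (rule mat_mult_left_right_inverse[OF Q P])
  have "P_mat d f d q \<in> Units (ring_mat TYPE('k) d undefined)"
    using Q P PQ QP unfolding Units_def ring_mat_simps by blast
  then obtain Q' where Q': "mat_inverse (P_mat d f d q) = Some Q'"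
    using mat_inverse(1)[OF P, of undefined] by blast
  then have inv: "P_mat d f d q * Q' = 1\<^sub>m d" "Q' \<in> carrier_mat d d"
    using mat_inverse(2)[OF P, of Q'] by auto
  have "Q' = (Q * P_mat d f d q) * Q'" using inv(2) by (simp add: QP)
  also have "\<dots> = Q" using assoc_mult_mat[OF Q P inv(2)] Q by (simp add: inv(1))
  finally have "the (mat_inverse (P_mat d f d q)) = Q" using Q' by simp
  then show ?thesis using i m
    by (simp add: A_mat_def Q_def G_mat_def scalar_prod_def atLeast0LessThan)
qed

lemma A_mat_closed:
  assumes "i < d" "m < d"
  shows "(\<lambda>q. A_mat d f j q $$ (i, m)) \<in> \<O> U"
proof (rule cong[OF _ open_U])
  show "(\<lambda>q. - (\<Sum>l<d. lag d i l q * univ_coeff (f m) (d - 1 - l) l (d - j) q)) \<in> \<O> U"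
    using assms by (intro uminus sum mult open_U lag_closed univ_coeff_closed f_closed) auto
qed (use A_mat_entry assms in simp)

text \<open>\<open>ext q \<omega> s i\<close> is \<open>\<omega>\<^sup>s\<^sub>i\<close> for \<open>s \<le> d - 2\<close>; for \<open>s = d - 1\<close> it is the component of \<open>\<omega>\<^sup>d\<^sup>-\<^sup>1\<close> that the
  derivatives of order \<open>d - 1\<close> of the relation impose.\<close>

definition ext :: "'k \<times> 'k \<Rightarrow> 'k Matrix.vec \<Rightarrow> nat \<Rightarrow> nat \<Rightarrow> 'k" where
  "ext q \<omega> s i = (if s \<le> d - 2 then \<omega> $ pos d s i
     else \<Sum>t\<in>{1..d - 2}. \<Sum>m<d. A_mat d f (d - t) q $$ (i, m) * \<omega> $ pos d t m)"

text \<open>Sections of the ambient trivial bundle; their values may lie outside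
  \<open>E\<close>.\<close>

definition vfield :: "('k \<times> 'k) set \<Rightarrow> ('k \<times> 'k \<Rightarrow> 'k Matrix.vec) \<Rightarrow> bool" where
  "vfield V \<omega> \<longleftrightarrow> (\<forall>q\<in>V. \<omega> q \<in> carrier_vec N) \<and> (\<forall>a<N. (\<lambda>q. \<omega> q $ a) \<in> \<O> V)"

lemma vfield_index:
  "vfield V \<omega> \<Longrightarrow> 1 \<le> s \<Longrightarrow> s \<le> d - 2 \<Longrightarrow> i < d \<Longrightarrow> (\<lambda>q. \<omega> q $ pos d s i) \<in> \<O> V"
  using pos_less[of s "d - 2" i d] by (simp add: vfield_def)

lemma ext_closed:
  assumes "vfield V \<omega>" "open V" "V \<subseteq> U" "1 \<le> s" "i < d"
  shows "(\<lambda>q. ext q (\<omega> q) s i) \<in> \<O> V"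
proof (cases "s \<le> d - 2")
  case True
  with assms show ?thesis by (simp add: ext_def vfield_index)
next
  case False
  have "(\<lambda>q. \<Sum>t\<in>{1..d - 2}. \<Sum>m<d. A_mat d f (d - t) q $$ (i, m) * \<omega> q $ pos d t m) \<in> \<O> V"
    using assms by (intro sum mult vfield_index restrict[OF A_mat_closed open_U]) auto
  with False show ?thesis by (simp add: ext_def)
qed

lemma ext_add:
  "\<lbrakk>u \<in> carrier_vec N; v \<in> carrier_vec N; 1 \<le> s; i < d\<rbrakk> \<Longrightarrow> ext q (u + v) s i = ext q u s i + ext q v s i"
  by (auto simp: ext_def pos_less distrib_left sum.distrib cong: sum.cong_simp)

lemma ext_smult:
  "\<lbrakk>v \<in> carrier_vec N; 1 \<le> s; i < d\<rbrakk> \<Longrightarrow> ext q (c \<cdot>\<^sub>v v) s i = c * ext q v s i"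
  by (auto simp: ext_def pos_less sum_distrib_left mult.left_commute cong: sum.cong_simp)

text \<open>With the extra level supplied by \<open>ext\<close>, both kinds of block rows of
  \<open>Delta_mat\<close> become the shift from \<open>s\<close> to \<open>s + 1\<close>.\<close>

lemma Delta_mat_mult:
  assumes \<omega>: "\<omega> \<in> carrier_vec N" and s: "1 \<le> s" "s \<le> d - 2" and i: "i < d"
  shows "(\<Sum>b<N. Delta_mat d f q $$ (pos d s i, b) * \<omega> $ b) = ext q \<omega> (s + 1) i"
proof -
  note a = pos_less[OF s i]
  have entry: "Delta_mat d f q $$ (pos d s i, b) =
      (if s \<le> d - 3 then (if b = pos d (s + 1) i then 1 else 0) else A_mat d f (d - (b div d + 1)) q $$ (i, b mod d))"
    if "b < N" for b
    using a that by (simp only: Delta_mat_def total_dim index_mat prod.case pos_div_mod[OF s(1) i] pos_add[OF s(1)])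
  show ?thesis
  proof (cases "s \<le> d - 3")
    case True
    then have "pos d (s + 1) i < N" using d3 by (intro pos_less i) simp_all
    moreover have "(\<Sum>b<N. Delta_mat d f q $$ (pos d s i, b) * \<omega> $ b) =
        (\<Sum>b<N. if b = pos d (s + 1) i then \<omega> $ b else 0)"
      by (intro sum.cong refl) (simp add: entry True)
    moreover have "s + 1 \<le> d - 2" using True d3 by simp
    ultimately show ?thesis by (simp add: ext_def)
  next
    case False
    have "(\<Sum>b<N. Delta_mat d f q $$ (pos d s i, b) * \<omega> $ b) =
        (\<Sum>b<N. A_mat d f (d - (b div d + 1)) q $$ (i, b mod d) * \<omega> $ b)"
      by (intro sum.cong refl) (simp add: entry False)
    also have "\<dots> = (\<Sum>t\<in>{1..d - 2}. \<Sum>m<d. A_mat d f (d - t) q $$ (i, m) * \<omega> $ pos d t m)"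
      unfolding sum_pos by (intro sum.cong refl) (simp add: pos_div_mod[simplified])
    finally show ?thesis using False s d3 by (simp add: ext_def)
  qed
qed

section \<open>The connection in coordinates\<close>

definition nab :: "bool \<Rightarrow> ('k \<times> 'k \<Rightarrow> 'k Matrix.vec) \<Rightarrow> 'k \<times> 'k \<Rightarrow> 'k Matrix.vec" where
  "nab c = (if c then nabla_x d f else nabla_y d f)"

text \<open>An entry of the connection matrix \<open>DDx_mat * Delta_mat\<close> or
  \<open>DDy_mat * Delta_mat\<close>; the diagonal left factor rescales row
  \<open>a\<close>.\<close>

definition gam :: "bool \<Rightarrow> nat \<Rightarrow> nat \<Rightarrow> 'k \<times> 'k \<Rightarrow> 'k" where
  "gam c a b q = pd c (f (a mod d)) q * Delta_mat d f q $$ (a, b)"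

lemma nab_carrier: "nab c \<omega> q \<in> carrier_vec N"
  by (rule carrier_vecI) (simp add: nab_def nabla_x_def nabla_y_def DDx_mat_def DDy_mat_def mat_diag_def total_dim)

lemma nab_index:
  assumes \<omega>: "\<omega> q \<in> carrier_vec N" and a: "a < N"
  shows "nab c \<omega> q $ a = pd c (\<lambda>q. \<omega> q $ a) q - (\<Sum>b<N. gam c a b q * \<omega> q $ b)"
proof -
  have D: "Delta_mat d f q \<in> carrier_mat N N" by (simp add: Delta_mat_def total_dim)
  have "DDx_mat d f q * Delta_mat d f q = Matrix.mat N N (\<lambda>(a, b). gam True a b q)"
    "DDy_mat d f q * Delta_mat d f q = Matrix.mat N N (\<lambda>(a, b). gam False a b q)"
    by (simp_all add: DDx_mat_def DDy_mat_def total_dim mat_diag_mult_left[OF D] gam_def)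
  then show ?thesis using assms
    by (cases c) (simp_all add: nab_def nabla_x_def nabla_y_def total_dim scalar_prod_def atLeast0LessThan)
qed

text \<open>Block \<open>s\<close> measures the failure of the chain rule, by which the derivative
  of level \<open>s\<close> would be the derivative of \<open>f i\<close> times level
  \<open>s + 1\<close>.\<close>

lemma nab_block:
  assumes "\<omega> q \<in> carrier_vec N" "1 \<le> s" "s \<le> d - 2" "i < d"
  shows "nab c \<omega> q $ pos d s i =
    pd c (\<lambda>q. \<omega> q $ pos d s i) q - pd c (f i) q * ext q (\<omega> q) (s + 1) i"
proof -
  have "(\<Sum>b<N. gam c (pos d s i) b q * \<omega> q $ b) =
      pd c (f i) q * (\<Sum>b<N. Delta_mat d f q $$ (pos d s i, b) * \<omega> q $ b)"
    using assms(2,4) by (simp add: gam_def sum_distrib_left mult.assoc pos_div_mod)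
  then show ?thesis
    using nab_index[of \<omega> q "pos d s i" c] pos_less[OF assms(2-4)] assms(1)
    by (simp add: Delta_mat_mult[OF assms])
qed

lemma nab_vfield:
  assumes \<omega>: "vfield V \<omega>" and V: "open V" "V \<subseteq> U"
  shows "vfield V (nab c \<omega>)"
  unfolding vfield_def
proof (intro conjI ballI allI impI)
  fix a assume "a < N"
  then obtain s i where si: "1 \<le> s" "s \<le> d - 2" "i < d" and a: "a = pos d s i"
    by (rule pos_cases)
  have "(\<lambda>q. pd c (\<lambda>q. \<omega> q $ a) q - pd c (f i) q * ext q (\<omega> q) (s + 1) i) \<in> \<O> V"
    using \<omega> V si \<open>a < N\<close> restrict[OF f_closed open_U V, OF si(3)]
    by (intro diff mult pd_closed ext_closed) (auto simp: vfield_def)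
  then show "(\<lambda>q. nab c \<omega> q $ a) \<in> \<O> V"
    by (rule cong[OF _ V(1)]) (use \<omega> nab_block si in \<open>simp add: a vfield_def\<close>)
qed (rule nab_carrier)

text \<open>For \<open>\<omega>\<^sup>s = (h\<^sub>i\<^sup>(\<^sup>s\<^sup>)(f\<^sub>i))\<^sub>i\<close> this is \<open>\<partial>\<^sub>x\<^sup>a \<partial>\<^sub>y\<^sup>b\<close> of \<open>\<Sum>\<^sub>i h\<^sub>i(f\<^sub>i)\<close>.\<close>

definition jet :: "'k \<times> 'k \<Rightarrow> 'k Matrix.vec \<Rightarrow> nat \<Rightarrow> nat \<Rightarrow> 'k" where
  "jet q \<omega> a b = (\<Sum>i<d. \<Sum>k\<in>{1..a + b}. univ_coeff (f i) a b k q * ext q \<omega> k i)"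

lemma jet_add:
  "u \<in> carrier_vec N \<Longrightarrow> v \<in> carrier_vec N \<Longrightarrow> jet q (u + v) a b = jet q u a b + jet q v a b"
  by (simp add: jet_def ext_add distrib_left sum.distrib cong: sum.cong_simp)

lemma jet_smult: "v \<in> carrier_vec N \<Longrightarrow> jet q (c \<cdot>\<^sub>v v) a b = c * jet q v a b"
  by (simp add: jet_def ext_smult sum_distrib_left mult.left_commute cong: sum.cong_simp)

lemma jet_diff:
  assumes "u \<in> carrier_vec N" "v \<in> carrier_vec N"
  shows "jet q (u - v) a b = jet q u a b - jet q v a b"
proof -
  have "u - v = u + (-1) \<cdot>\<^sub>v v" using assms by (intro eq_vecI) auto
  then show ?thesis using assms by (simp add: jet_add jet_smult del: smult_vec_def)
qed

lemma jet_closed: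
  assumes "vfield V \<omega>" "open V" "V \<subseteq> U"
  shows "(\<lambda>q. jet q (\<omega> q) a b) \<in> \<O> V"
  unfolding jet_def
  using assms by (intro sum mult ext_closed univ_coeff_closed restrict[OF f_closed open_U]) auto

lemma univ_coeff_f_top:
  "q \<in> U \<Longrightarrow> i < d \<Longrightarrow> univ_coeff (f i) a b (a + b) q = dx (f i) q ^ a * dy (f i) q ^ b"
  by (rule univ_coeff_top[OF f_closed open_U]) simp_all

lemma jet_top:
  assumes q: "q \<in> U" and ab: "a + b = d - 1"
  shows "jet q \<omega> a b = 0"
proof -
  have d1: "a + b = Suc (d - 2)" "a = d - 1 - b" "b < d" using ab d3 by simp_all
  let ?m = "\<lambda>i. dx (f i) q ^ a * dy (f i) q ^ b"
  \<comment> \<open>Since \<open>A_mat\<close> is minus the inverse of \<open>P_mat\<close> times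
    \<open>G_mat\<close>, multiplying it by row \<open>b\<close> of \<open>P_mat\<close> leaves
    minus row \<open>b\<close> of \<open>G_mat\<close>.\<close>
  have top: "(\<Sum>i<d. ?m i * A_mat d f (d - t) q $$ (i, m)) = - univ_coeff (f m) a b t q"
    if "m < d" "t \<in> {1..d - 2}" for m t
  proof -
    have "t \<le> d" using that(2) by auto
    then have "d - (d - t) = t" by simp
    then have "(\<Sum>i<d. ?m i * A_mat d f (d - t) q $$ (i, m)) =
        - (\<Sum>i<d. \<Sum>l<d. ?m i * lag d i l q * univ_coeff (f m) (d - 1 - l) l t q)"
      using that(1) by (simp add: A_mat_entry[OF q] sum_distrib_left sum_negf mult.assoc)
    also have "(\<Sum>i<d. \<Sum>l<d. ?m i * lag d i l q * univ_coeff (f m) (d - 1 - l) l t q) =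
        (\<Sum>l<d. (\<Sum>i<d. ?m i * lag d i l q) * univ_coeff (f m) (d - 1 - l) l t q)"
      by (subst sum.swap) (simp add: sum_distrib_right)
    also have "\<dots> = (\<Sum>l<d. (if b = l then 1 else 0) * univ_coeff (f m) (d - 1 - l) l t q)"
      by (intro sum.cong refl arg_cong2[of _ _ _ _ "(*)"])
        (use lag_right_inverse[OF d1(3) _ order_refl q] in \<open>simp add: d1(2)\<close>)
    also have "\<dots> = (\<Sum>l<d. if b = l then univ_coeff (f m) (d - 1 - l) l t q else 0)"
      by (intro sum.cong refl) simp
    also have "\<dots> = univ_coeff (f m) a b t q"
      using d1(2,3) by simp
    finally show ?thesis .
  qed
  have "jet q \<omega> a b = (\<Sum>i<d. (\<Sum>t\<in>{1..d - 2}. univ_coeff (f i) a b t q * \<omega> $ pos d t i)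
      + ?m i * (\<Sum>t\<in>{1..d - 2}. \<Sum>m<d. A_mat d f (d - t) q $$ (i, m) * \<omega> $ pos d t m))"
    unfolding jet_def
  proof (rule sum.cong[OF refl])
    fix i assume "i \<in> {..<d}"
    then have i: "i < d" by simp
    have "(\<Sum>k\<in>{1..a + b}. univ_coeff (f i) a b k q * ext q \<omega> k i) =
        (\<Sum>k\<in>{1..d - 2}. univ_coeff (f i) a b k q * ext q \<omega> k i) + univ_coeff (f i) a b (a + b) q * ext q \<omega> (a + b) i"
      unfolding d1(1) by simp
    also have "(\<Sum>k\<in>{1..d - 2}. univ_coeff (f i) a b k q * ext q \<omega> k i) =
        (\<Sum>k\<in>{1..d - 2}. univ_coeff (f i) a b k q * \<omega> $ pos d k i)"
      by (intro sum.cong refl) (simp add: ext_def)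
    also have "ext q \<omega> (a + b) i = (\<Sum>t\<in>{1..d - 2}. \<Sum>m<d. A_mat d f (d - t) q $$ (i, m) * \<omega> $ pos d t m)"
      unfolding d1(1) by (simp add: ext_def)
    finally show "(\<Sum>k\<in>{1..a + b}. univ_coeff (f i) a b k q * ext q \<omega> k i) =
        (\<Sum>t\<in>{1..d - 2}. univ_coeff (f i) a b t q * \<omega> $ pos d t i)
        + ?m i * (\<Sum>t\<in>{1..d - 2}. \<Sum>m<d. A_mat d f (d - t) q $$ (i, m) * \<omega> $ pos d t m)"
      by (simp add: univ_coeff_f_top[OF q i])
  qed
  also have "\<dots> = (\<Sum>i<d. \<Sum>t\<in>{1..d - 2}. univ_coeff (f i) a b t q * \<omega> $ pos d t i)
      + (\<Sum>i<d. ?m i * (\<Sum>t\<in>{1..d - 2}. \<Sum>m<d. A_mat d f (d - t) q $$ (i, m) * \<omega> $ pos d t m))"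
    by (rule sum.distrib)
  also have "(\<Sum>i<d. ?m i * (\<Sum>t\<in>{1..d - 2}. \<Sum>m<d. A_mat d f (d - t) q $$ (i, m) * \<omega> $ pos d t m)) =
      (\<Sum>i<d. \<Sum>t\<in>{1..d - 2}. \<Sum>m<d. ?m i * A_mat d f (d - t) q $$ (i, m) * \<omega> $ pos d t m)"
    by (simp only: sum_distrib_left mult.assoc)
  also have "\<dots> = (\<Sum>t\<in>{1..d - 2}. \<Sum>i<d. \<Sum>m<d. ?m i * A_mat d f (d - t) q $$ (i, m) * \<omega> $ pos d t m)"
    by (rule sum.swap)
  also have "\<dots> = (\<Sum>t\<in>{1..d - 2}. \<Sum>m<d. \<Sum>i<d. ?m i * A_mat d f (d - t) q $$ (i, m) * \<omega> $ pos d t m)"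
    by (intro sum.cong refl sum.swap)
  also have "\<dots> = (\<Sum>t\<in>{1..d - 2}. \<Sum>m<d. - univ_coeff (f m) a b t q * \<omega> $ pos d t m)"
    by (rule sum.cong[OF refl], rule sum.cong[OF refl], subst sum_distrib_right[symmetric], subst top) auto
  also have "\<dots> = - (\<Sum>i<d. \<Sum>t\<in>{1..d - 2}. univ_coeff (f i) a b t q * \<omega> $ pos d t i)"
    by (subst sum.swap) (simp add: sum_negf)
  finally show ?thesis by simp
qed

text \<open>The block \<open>G_mat j r\<close> carries the coefficients of index
  \<open>k = r - j\<close>, and \<open>P_mat r\<close> those of the leading index
  \<open>k = r - 1\<close>.\<close>

lemma MM_row_index:
  assumes q: "q \<in> U" and r: "2 \<le> r" "r \<le> d - 1" and l: "l < r"
  shows "MM_row d f q r \<omega> $ l = jet q \<omega> (r - 1 - l) l"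
proof -
  have r1: "r - 1 - l + l = Suc (r - 2)" using r l by simp
  let ?C = "\<lambda>i k. univ_coeff (f i) (r - 1 - l) l k q"
  have blk: "block d s \<omega> $ i = \<omega> $ pos d s i" if "i < d" for s i
    using that by (simp add: block_def pos_def)
  have dimb: "dim_vec (block d s \<omega>) = d" for s by (simp add: block_def)
  have "MM_row d f q r \<omega> $ l = (\<Sum>j = 2..r - 1. \<Sum>i<d. ?C i (r - j) * \<omega> $ pos d (r - j) i) +
      (\<Sum>i<d. dx (f i) q ^ (r - 1 - l) * dy (f i) q ^ l * \<omega> $ pos d (r - 1) i)"
    using l by (simp add: MM_row_def G_mat_def P_mat_def scalar_prod_def dimb blk atLeast0LessThan)
  also have "(\<Sum>j = 2..r - 1. \<Sum>i<d. ?C i (r - j) * \<omega> $ pos d (r - j) i) =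
      (\<Sum>k\<in>{1..r - 2}. \<Sum>i<d. ?C i k * \<omega> $ pos d k i)"
    by (rule sum.reindex_bij_witness[of _ "\<lambda>k. r - k" "\<lambda>j. r - j"]) auto
  also have "\<dots> = (\<Sum>i<d. \<Sum>k\<in>{1..r - 2}. ?C i k * \<omega> $ pos d k i)"
    by (rule sum.swap)
  also have "\<dots> + (\<Sum>i<d. dx (f i) q ^ (r - 1 - l) * dy (f i) q ^ l * \<omega> $ pos d (r - 1) i) =
      (\<Sum>i<d. (\<Sum>k\<in>{1..r - 2}. ?C i k * \<omega> $ pos d k i) + ?C i (r - 1) * \<omega> $ pos d (r - 1) i)"
    unfolding sum.distrib
    by (intro arg_cong2[of _ _ _ _ "(+)"] sum.cong refl)
      (use univ_coeff_f_top[OF q, of _ "r - 1 - l" l] l in simp)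
  also have "\<dots> = jet q \<omega> (r - 1 - l) l"
    unfolding jet_def
  proof (rule sum.cong[OF refl])
    fix i
    have e: "ext q \<omega> k i = \<omega> $ pos d k i" if "k \<le> r - 1" for k using that r by (simp add: ext_def)
    have eq: "(\<Sum>k\<in>{1..Suc (r - 2)}. ?C i k * ext q \<omega> k i) =
        (\<Sum>k\<in>{1..Suc (r - 2)}. ?C i k * \<omega> $ pos d k i)"
    proof (rule sum.cong[OF refl])
      fix k assume "k \<in> {1..Suc (r - 2)}"
      then have "k \<le> r - 1" using r by auto
      then show "?C i k * ext q \<omega> k i = ?C i k * \<omega> $ pos d k i" by (simp add: e)
    qed
    have r2: "r - 1 = Suc (r - 2)" using r by simp
    show "(\<Sum>k\<in>{1..r - 2}. ?C i k * \<omega> $ pos d k i) + ?C i (r - 1) * \<omega> $ pos d (r - 1) i =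
        (\<Sum>k\<in>{1..r - 1 - l + l}. ?C i k * ext q \<omega> k i)"
      unfolding r1 eq unfolding r2 by simp
  qed
  finally show ?thesis .
qed

lemma fibre_iff_jet:
  assumes q: "q \<in> U"
  shows "\<omega> \<in> fibre d f q \<longleftrightarrow>
    \<omega> \<in> carrier_vec N \<and> (\<forall>a b. 1 \<le> a + b \<longrightarrow> a + b \<le> d - 2 \<longrightarrow> jet q \<omega> a b = 0)"
proof -
  have "MM_row d f q r \<omega> = 0\<^sub>v r \<longleftrightarrow> (\<forall>l<r. jet q \<omega> (r - 1 - l) l = 0)" if "r \<in> {2..d - 1}" for r
  proof -
    have dim: "dim_vec (MM_row d f q r \<omega>) = r" by (simp add: MM_row_def)
    have "MM_row d f q r \<omega> = 0\<^sub>v r \<longleftrightarrow> (\<forall>l<r. MM_row d f q r \<omega> $ l = 0)"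
      by (auto intro!: eq_vecI simp: dim)
    also have "\<dots> \<longleftrightarrow> (\<forall>l<r. jet q \<omega> (r - 1 - l) l = 0)"
      using MM_row_index[OF q] that by auto
    finally show ?thesis .
  qed
  moreover have "(\<forall>r\<in>{2..d - 1}. \<forall>l<r. jet q \<omega> (r - 1 - l) l = 0) \<longleftrightarrow>
      (\<forall>a b. 1 \<le> a + b \<longrightarrow> a + b \<le> d - 2 \<longrightarrow> jet q \<omega> a b = 0)"
  proof safe
    fix a b assume h: "\<forall>r\<in>{2..d - 1}. \<forall>l<r. jet q \<omega> (r - 1 - l) l = 0" and ab: "1 \<le> a + b" "a + b \<le> d - 2"
    have "a + b + 1 \<in> {2..d - 1}" "b < a + b + 1" using ab by auto
    with h have "jet q \<omega> (a + b + 1 - 1 - b) b = 0" by blast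
    then show "jet q \<omega> a b = 0" by simp
  next
    fix r l assume h: "\<forall>a b. 1 \<le> a + b \<longrightarrow> a + b \<le> d - 2 \<longrightarrow> jet q \<omega> a b = 0" and "r \<in> {2..d - 1}" "l < r"
    then show "jet q \<omega> (r - 1 - l) l = 0" by (intro h[rule_format]) auto
  qed
  ultimately show ?thesis by (auto simp: fibre_def total_dim)
qed

lemma jet_nab:
  assumes \<omega>: "vfield V \<omega>" and V: "open V" "V \<subseteq> U" "q \<in> V" and ab: "1 \<le> a + b" "a + b \<le> d - 2"
  shows "jet q (nab c \<omega> q) a b =
    pd c (\<lambda>q. jet q (\<omega> q) a b) q - jet q (\<omega> q) (if c then Suc a else a) (if c then b else Suc b)"
proof -
  define n where "n = a + b"
  have n: "n \<le> d - 2" "1 \<le> n" "(if c then Suc a else a) + (if c then b else Suc b) = Suc n"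
    using ab by (simp_all add: n_def)
  have qU: "q \<in> U" and carr: "\<omega> q \<in> carrier_vec N" using V \<omega> by (auto simp: vfield_def)
  let ?a = "if c then Suc a else a" and ?b = "if c then b else Suc b"
  let ?C = "\<lambda>i k. univ_coeff (f i) a b k" and ?e = "\<lambda>k i q. ext q (\<omega> q) k i"
  have fV: "f i \<in> \<O> V" if "i < d" for i using restrict[OF f_closed open_U V(1,2)] that by simp
  have CV: "?C i k \<in> \<O> V" if "i < d" for i k by (rule univ_coeff_closed[OF fV[OF that] V(1)])
  have eV: "?e k i \<in> \<O> V" if "i < d" "1 \<le> k" for i k using ext_closed[OF \<omega> V(1,2)] that by simp
  have "pd c (\<lambda>q. jet q (\<omega> q) a b) q =
      (\<Sum>i<d. pd c (\<lambda>q. \<Sum>k\<in>{1..n}. ?C i k q * ?e k i q) q)"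
    unfolding jet_def n_def
    by (rule pd_sum[OF V(1,3)]) (use CV eV in \<open>auto intro!: sum mult V(1)\<close>)
  also have "\<dots> = (\<Sum>i<d. \<Sum>k\<in>{1..n}. pd c (?C i k) q * ?e k i q + ?C i k q * pd c (?e k i) q)"
    by (rule sum.cong[OF refl], subst pd_sum[OF V(1,3)], use CV eV in \<open>simp add: mult V\<close>,
        rule sum.cong[OF refl], rule pd_mult[OF _ _ V(1,3)], use CV eV in simp_all)
  finally have pdj: "pd c (\<lambda>q. jet q (\<omega> q) a b) q =
      (\<Sum>i<d. \<Sum>k\<in>{1..n}. pd c (?C i k) q * ?e k i q + ?C i k q * pd c (?e k i) q)" .
  have nabj: "jet q (nab c \<omega> q) a b =
      (\<Sum>i<d. \<Sum>k\<in>{1..n}. ?C i k q * (pd c (?e k i) q - pd c (f i) q * ?e (k + 1) i q))"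
    unfolding jet_def n_def[symmetric]
  proof (rule sum.cong[OF refl], rule sum.cong[OF refl])
    fix i k assume "i \<in> {..<d}" "k \<in> {1..n}"
    then have ik: "1 \<le> k" "k \<le> d - 2" "i < d" using n by auto
    then have "ext q (nab c \<omega> q) k i = pd c (?e k i) q - pd c (f i) q * ?e (k + 1) i q"
      using nab_block[where \<omega> = \<omega> and c = c, OF carr ik] by (simp add: ext_def)
    then show "?C i k q * ext q (nab c \<omega> q) k i = ?C i k q * (pd c (?e k i) q - pd c (f i) q * ?e (k + 1) i q)"
      by simp
  qed
  \<comment> \<open>The recursion splits the raised coefficients. Differentiated ones vanish at the
    new top index, multiplied ones at index 0; after a shift of \<open>k\<close> the latter pair
    \<open>?C i k\<close> with level \<open>k + 1\<close>, exactly the term that \<open>nab\<close>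
    subtracts.\<close>
  have incj: "jet q (\<omega> q) ?a ?b =
      (\<Sum>i<d. (\<Sum>k\<in>{1..n}. pd c (?C i k) q * ?e k i q) + (\<Sum>k\<in>{1..n}. ?C i k q * (pd c (f i) q * ?e (k + 1) i q)))"
    unfolding jet_def n(3)
  proof (rule sum.cong[OF refl])
    fix i assume "i \<in> {..<d}"
    then have i: "i < d" by simp
    have top: "pd c (?C i (Suc n)) q = 0"
    proof -
      have "pd c (?C i (Suc n)) q = pd c (\<lambda>_. 0) q"
        by (rule pd_cong[OF V(1,3)]) (simp add: univ_coeff_above[OF fV[OF i] V(1)] n_def)
      then show ?thesis by simp
    qed
    have zero: "?C i 0 q = 0" by (rule univ_coeff_0[OF open_U qU _ refl]) (use ab(1) in linarith)
    have "(\<Sum>k\<in>{1..Suc n}. univ_coeff (f i) ?a ?b k q * ?e k i q) =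
        (\<Sum>k\<in>{1..Suc n}. pd c (?C i k) q * ?e k i q + pd c (f i) q * ?C i (k - 1) q * ?e k i q)"
    proof (rule sum.cong[OF refl])
      fix k assume "k \<in> {1..Suc n}"
      then have "k \<noteq> 0" by simp
      then show "univ_coeff (f i) ?a ?b k q * ?e k i q =
          pd c (?C i k) q * ?e k i q + pd c (f i) q * ?C i (k - 1) q * ?e k i q"
        unfolding univ_coeff_inc[OF fV[OF i] V(1,3)] by (simp add: distrib_right)
    qed
    also have "\<dots> = (\<Sum>k\<in>{1..Suc n}. pd c (?C i k) q * ?e k i q) +
        (\<Sum>k\<in>{1..Suc n}. pd c (f i) q * ?C i (k - 1) q * ?e k i q)"
      by (rule sum.distrib)
    also have "(\<Sum>k\<in>{1..Suc n}. pd c (?C i k) q * ?e k i q) = (\<Sum>k\<in>{1..n}. pd c (?C i k) q * ?e k i q)"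
      by (simp add: top)
    also have "(\<Sum>k\<in>{1..Suc n}. pd c (f i) q * ?C i (k - 1) q * ?e k i q) =
        (\<Sum>k\<in>{0..n}. pd c (f i) q * ?C i k q * ?e (k + 1) i q)"
      by (rule sum.reindex_bij_witness[of _ Suc "\<lambda>k. k - 1"]) auto
    also have "\<dots> = (\<Sum>k\<in>{1..n}. ?C i k q * (pd c (f i) q * ?e (k + 1) i q))"
      by (simp add: sum.atLeast_Suc_atMost[of 0 n] zero mult_ac)
    finally show "(\<Sum>k\<in>{1..Suc n}. univ_coeff (f i) ?a ?b k q * ?e k i q) =
        (\<Sum>k\<in>{1..n}. pd c (?C i k) q * ?e k i q) + (\<Sum>k\<in>{1..n}. ?C i k q * (pd c (f i) q * ?e (k + 1) i q))" .
  qed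
  show ?thesis
    unfolding pdj nabj incj
    by (simp only: sum.distrib right_diff_distrib sum_subtractf) simp
qed

text \<open>Expanding by \<open>jet_nab\<close> twice gives an expression symmetric in the two
  variables. For \<open>a + b = d - 2\<close> the second expansion is out of range, but the raised
  jets have order \<open>d - 1\<close> and vanish for every vector.\<close>

lemma jet_nab_nab:
  assumes \<omega>: "vfield V \<omega>" and V: "open V" "V \<subseteq> U" "p \<in> V" and ab: "1 \<le> a + b" "a + b \<le> d - 2"
  shows "jet p (nab False (nab True \<omega>) p) a b = jet p (nab True (nab False \<omega>) p) a b"
proof -
  let ?J = "\<lambda>a b q. jet q (\<omega> q) a b"
  have nab: "vfield V (nab c \<omega>)" for c using nab_vfield[OF \<omega> V(1,2)] .
  have J: "?J a b \<in> \<O> V" for a b by (rule jet_closed[OF \<omega> V(1,2)])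
  have 1: "jet p (nab c (nab c' \<omega>) p) a b =
      pd c (pd c' (?J a b)) p - pd c (?J (if c' then Suc a else a) (if c' then b else Suc b)) p
      - jet p (nab c' \<omega> p) (if c then Suc a else a) (if c then b else Suc b)" for c c'
  proof -
    have "pd c (\<lambda>q. jet q (nab c' \<omega> q) a b) p =
        pd c (\<lambda>q. pd c' (?J a b) q - ?J (if c' then Suc a else a) (if c' then b else Suc b) q) p"
      by (rule pd_cong[OF V(1,3)]) (rule jet_nab[OF \<omega> V(1,2) _ ab])
    also have "\<dots> = pd c (pd c' (?J a b)) p - pd c (?J (if c' then Suc a else a) (if c' then b else Suc b)) p"
      by (rule pd_diff[OF pd_closed[OF J V(1)] J V(1,3)])
    finally show ?thesis using jet_nab[OF nab V ab, of c c'] by simp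
  qed
  have top: "jet q v a' b' = 0" if "q \<in> V" "a' + b' = d - 1" for q v a' b'
    using jet_top that V(2) by blast
  have pdtop: "pd c (?J a' b') p = 0" if "a' + b' = d - 1" for c a' b'
  proof -
    have "pd c (?J a' b') p = pd c (\<lambda>_. 0) p" by (rule pd_cong[OF V(1,3)]) (rule top, use that in simp_all)
    then show ?thesis by simp
  qed
  note mixed = pd_pd[OF J V(1,3), of True False a b]
  show ?thesis
  proof (cases "a + b = d - 2")
    case True
    then have "a + Suc b = d - 1" "Suc a + b = d - 1" using d3 by simp_all
    then show ?thesis using 1[of False True] 1[of True False] mixed
      by (simp add: top[OF V(3)] pdtop[of _ _ True, simplified] pdtop[of _ _ False, simplified])
  next
    case False
    have 2: "jet p (nab True \<omega> p) a (Suc b) = dx (?J a (Suc b)) p - ?J (Suc a) (Suc b) p"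
      "jet p (nab False \<omega> p) (Suc a) b = dy (?J (Suc a) b) p - ?J (Suc a) (Suc b) p"
      using jet_nab[OF \<omega> V, of a "Suc b" True] jet_nab[OF \<omega> V, of "Suc a" b False] ab False by simp_all
    show ?thesis using 1[of False True] 1[of True False] mixed 2 by simp
  qed
qed

lemma K_op_nab: "K_op d f \<omega> p = nab False (nab True \<omega>) p - nab True (nab False \<omega>) p"
  by (simp add: K_op_def nab_def)

text \<open>So \<open>\<nabla>\<^sup>0\<close> induces a flat connection on the quotient by \<open>E\<close>.\<close>

lemma K_op_in_fibre:
  assumes \<omega>: "vfield V \<omega>" and V: "open V" "V \<subseteq> U" "p \<in> V"
  shows "K_op d f \<omega> p \<in> fibre d f p"
proof -
  have "p \<in> U" using V by auto
  moreover have "jet p (K_op d f \<omega> p) a b = 0" if "1 \<le> a + b" "a + b \<le> d - 2" for a b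
    using jet_nab_nab[OF assms that] by (simp add: K_op_nab jet_diff nab_carrier)
  moreover have "K_op d f \<omega> p \<in> carrier_vec N"
    unfolding K_op_nab using nab_carrier nab_carrier by (rule minus_carrier_vec)
  ultimately show ?thesis by (simp add: fibre_iff_jet)
qed

section \<open>The curvature as a matrix on the trivial bundle\<close>

lemma gam_closed:
  assumes "a < N" "b < N"
  shows "gam c a b \<in> \<O> U"
proof -
  have d: "0 < d" using d3 by simp
  obtain s i where a: "1 \<le> s" "s \<le> d - 2" "i < d" "a = pos d s i" using pos_cases[OF assms(1)] .
  have "(\<lambda>q. Delta_mat d f q $$ (a, b)) \<in> \<O> U"
    using assms A_mat_closed[of "a mod d" "b mod d"] const[OF open_U] d
    by (cases "Suc (a div d) \<le> d - 3") (simp_all add: Delta_mat_def total_dim)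
  then show ?thesis
    unfolding gam_def[abs_def] using d by (intro mult pd_closed f_closed open_U) simp_all
qed

text \<open>With connection matrices \<open>X\<close> and \<open>Y\<close> for the two variables,
  this is the x-derivative of \<open>Y\<close> minus the y-derivative of \<open>X\<close> plus the
  commutator \<open>Y * X - X * Y\<close>.\<close>

definition K_mat :: "'k \<times> 'k \<Rightarrow> 'k mat" where
  "K_mat p = Matrix.mat N N (\<lambda>(a, b). pd True (gam False a b) p - pd False (gam True a b) p +
     (\<Sum>e<N. gam False a e p * gam True e b p - gam True a e p * gam False e b p))"

lemma K_mat_carrier: "K_mat p \<in> carrier_mat N N"
  by (simp add: K_mat_def)

text \<open>In \<open>nn\<close> the terms with derivatives of \<omega> are symmetric in
  \<open>c\<close> and \<open>c'\<close> and cancel, the second derivatives because they commute. So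
  \<open>K_op\<close> depends on \<omega> only through its value at \<open>p\<close>.\<close>

lemma K_op_eq_K_mat:
  assumes \<omega>: "vfield V \<omega>" and V: "open V" "V \<subseteq> U" "p \<in> V"
  shows "K_op d f \<omega> p = K_mat p *\<^sub>v \<omega> p"
proof (rule eq_vecI)
  have carr: "\<omega> q \<in> carrier_vec N" if "q \<in> V" for q using \<omega> that by (simp add: vfield_def)
  have oV: "(\<lambda>q. \<omega> q $ a) \<in> \<O> V" if "a < N" for a using \<omega> that by (simp add: vfield_def)
  have gV: "gam c a b \<in> \<O> V" if "a < N" "b < N" for c a b
    using restrict[OF gam_closed[OF that] open_U V(1,2)] .
  show "dim_vec (K_op d f \<omega> p) = dim_vec (K_mat p *\<^sub>v \<omega> p)"
    unfolding K_op_nab using nab_carrier[of _ _ p] K_mat_carrier[of p] by simp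
  fix a assume "a < dim_vec (K_mat p *\<^sub>v \<omega> p)"
  then have a: "a < N" by (simp add: K_mat_def)
  have nn: "nab c (nab c' \<omega>) p $ a = pd c (pd c' (\<lambda>q. \<omega> q $ a)) p
      - (\<Sum>b<N. pd c (gam c' a b) p * \<omega> p $ b + gam c' a b p * pd c (\<lambda>q. \<omega> q $ b) p)
      - (\<Sum>b<N. gam c a b p * pd c' (\<lambda>q. \<omega> q $ b) p)
      + (\<Sum>b<N. (\<Sum>e<N. gam c a e p * gam c' e b p) * \<omega> p $ b)" for c c'
  proof -
    have "pd c (\<lambda>q. nab c' \<omega> q $ a) p =
        pd c (\<lambda>q. pd c' (\<lambda>q. \<omega> q $ a) q - (\<Sum>b<N. gam c' a b q * \<omega> q $ b)) p"
      by (rule pd_cong[OF V(1,3)]) (rule nab_index[OF carr a])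
    also have "\<dots> = pd c (pd c' (\<lambda>q. \<omega> q $ a)) p - pd c (\<lambda>q. \<Sum>b<N. gam c' a b q * \<omega> q $ b) p"
      by (rule pd_diff[OF pd_closed[OF oV[OF a] V(1)] _ V(1,3)]) (intro sum mult oV gV V(1) a; simp)
    also have "pd c (\<lambda>q. \<Sum>b<N. gam c' a b q * \<omega> q $ b) p = (\<Sum>b<N. pd c (\<lambda>q. gam c' a b q * \<omega> q $ b) p)"
      by (rule pd_sum[OF V(1,3)]) (intro mult oV gV V(1) a; simp)
    also have "\<dots> = (\<Sum>b<N. pd c (gam c' a b) p * \<omega> p $ b + gam c' a b p * pd c (\<lambda>q. \<omega> q $ b) p)"
      by (rule sum.cong[OF refl], rule pd_mult[OF gV[OF a] oV V(1,3)]) simp_all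
    finally have 1: "pd c (\<lambda>q. nab c' \<omega> q $ a) p = pd c (pd c' (\<lambda>q. \<omega> q $ a)) p
        - (\<Sum>b<N. pd c (gam c' a b) p * \<omega> p $ b + gam c' a b p * pd c (\<lambda>q. \<omega> q $ b) p)" .
    have "(\<Sum>b<N. gam c a b p * nab c' \<omega> p $ b) =
        (\<Sum>b<N. gam c a b p * (pd c' (\<lambda>q. \<omega> q $ b) p - (\<Sum>e<N. gam c' b e p * \<omega> p $ e)))"
      by (intro sum.cong refl arg_cong2[of _ _ _ _ "(*)"] nab_index carr V) simp
    also have "\<dots> = (\<Sum>b<N. gam c a b p * pd c' (\<lambda>q. \<omega> q $ b) p) -
        (\<Sum>b<N. \<Sum>e<N. gam c a b p * gam c' b e p * \<omega> p $ e)"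
      by (simp only: right_diff_distrib sum_subtractf sum_distrib_left mult.assoc)
    also have "(\<Sum>b<N. \<Sum>e<N. gam c a b p * gam c' b e p * \<omega> p $ e) =
        (\<Sum>e<N. (\<Sum>b<N. gam c a b p * gam c' b e p) * \<omega> p $ e)"
      by (subst sum.swap) (simp only: sum_distrib_right)
    finally show ?thesis using nab_index[where c = c and \<omega> = "nab c' \<omega>" and q = p, OF nab_carrier a] 1 by simp
  qed
  have mixed: "dy (dx (\<lambda>q. \<omega> q $ a)) p = dx (dy (\<lambda>q. \<omega> q $ a)) p"
    using dx_dy[OF oV[OF a] V(1,3)] by simp
  have "K_op d f \<omega> p $ a = nab False (nab True \<omega>) p $ a - nab True (nab False \<omega>) p $ a"
    unfolding K_op_nab using a nab_carrier[of True "nab False \<omega>" p] by simp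
  also have "\<dots> = (\<Sum>b<N. pd True (gam False a b) p * \<omega> p $ b) - (\<Sum>b<N. pd False (gam True a b) p * \<omega> p $ b)
      + (\<Sum>b<N. (\<Sum>e<N. gam False a e p * gam True e b p) * \<omega> p $ b)
      - (\<Sum>b<N. (\<Sum>e<N. gam True a e p * gam False e b p) * \<omega> p $ b)"
    unfolding nn by (simp add: mixed sum.distrib)
  also have "\<dots> = (\<Sum>b<N. (pd True (gam False a b) p - pd False (gam True a b) p +
      (\<Sum>e<N. gam False a e p * gam True e b p - gam True a e p * gam False e b p)) * \<omega> p $ b)"
    by (simp only: distrib_right left_diff_distrib sum.distrib sum_subtractf) simp
  also have "\<dots> = (K_mat p *\<^sub>v \<omega> p) $ a"
    using a carr[OF V(3)] by (simp add: K_mat_def scalar_prod_def atLeast0LessThan)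
  finally show "K_op d f \<omega> p $ a = (K_mat p *\<^sub>v \<omega> p) $ a" .
qed

text \<open>Any vector is the value of a constant field. Such a field is in general no section of
  \<open>E\<close>, so this rests on \<open>K_op_in_fibre\<close> covering the whole trivial
  bundle.\<close>

lemma K_mat_in_fibre:
  assumes p: "p \<in> U" and v: "v \<in> carrier_vec N"
  shows "K_mat p *\<^sub>v v \<in> fibre d f p"
proof -
  have "vfield U (\<lambda>_. v)" using v open_U by (simp add: vfield_def const)
  from K_op_in_fibre[OF this open_U order_refl p] K_op_eq_K_mat[OF this open_U order_refl p]
  show ?thesis by simp
qed

subsection \<open>Local sections of the kernel bundle\<close>

text \<open>The blocks \<open>\<omega>\<^sup>s\<close> are found recursively: the constant vector \<open>v\<^sup>s\<close> is corrected by a right inverse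
  of \<open>P\<^sub>s\<^sub>+\<^sub>1\<close>, built from the first \<open>s + 1\<close> functions; the correction vanishes at \<open>p\<close>.\<close>

lemma section_blocks:
  assumes p: "p \<in> U" and v: "v \<in> fibre d f p"
  shows "n \<le> d - 2 \<Longrightarrow> \<exists>W. (\<forall>s\<in>{1..n}. \<forall>i<d. W s i \<in> \<O> U \<and> W s i p = v $ pos d s i) \<and>
    (\<forall>q\<in>U. \<forall>a b. 1 \<le> a + b \<longrightarrow> a + b \<le> n \<longrightarrow>
      (\<Sum>i<d. \<Sum>k\<in>{1..a + b}. univ_coeff (f i) a b k q * W k i q) = 0)"
proof (induction n)
  case 0
  show ?case
    by (rule exI[of _ "\<lambda>_ _ _. 0"], rule conjI, simp, intro ballI allI impI, simp)
next
  case (Suc n)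
  then obtain W where W0: "\<forall>s\<in>{1..n}. \<forall>i<d. W s i \<in> \<O> U \<and> W s i p = v $ pos d s i"
    and Weq0: "\<forall>q\<in>U. \<forall>a b. 1 \<le> a + b \<longrightarrow> a + b \<le> n \<longrightarrow>
      (\<Sum>i<d. \<Sum>k\<in>{1..a + b}. univ_coeff (f i) a b k q * W k i q) = 0"
    using Suc_leD by blast
  have W: "W s i \<in> \<O> U" "W s i p = v $ pos d s i" if "s \<in> {1..n}" "i < d" for s i
    using W0 that by blast+
  have Weq: "(\<Sum>i<d. \<Sum>k\<in>{1..a + b}. univ_coeff (f i) a b k q * W k i q) = 0"
    if "q \<in> U" "1 \<le> a + b" "a + b \<le> n" for q a b
    using Weq0 that by blast
  define s r where "s = Suc n" and "r = Suc s"
  have r: "r \<le> d" using Suc.prems by (simp add: r_def s_def)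
  have jet0: "jet p v a b = 0" if "1 \<le> a + b" "a + b \<le> d - 2" for a b
    using v that p by (simp add: fibre_iff_jet)
  \<comment> \<open>The residual of the equation of order \<open>s\<close> in row \<open>l\<close>
    when block \<open>s\<close> is frozen at its value in \<open>v\<close>; \<open>s - l\<close> is
    \<open>r - 1 - l\<close>.\<close>
  define R where "R l q = (\<Sum>i<d. (\<Sum>k\<in>{1..n}. univ_coeff (f i) (s - l) l k q * W k i q) +
      dx (f i) q ^ (s - l) * dy (f i) q ^ l * v $ pos d s i)" for l q
  \<comment> \<open>Only the first \<open>r\<close> components are corrected, since
    \<open>lag r\<close> inverts the corresponding columns.\<close>
  define W' where "W' i q = v $ pos d s i - (if i < r then \<Sum>l<r. lag r i l q * R l q else 0)" for i q
  have RU: "R l \<in> \<O> U" for l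
    unfolding R_def[abs_def]
    by (intro sum add mult W(1) univ_coeff_closed f_closed power dx_closed dy_closed const open_U; simp)
  have W'U: "W' i \<in> \<O> U" if "i < d" for i
  proof (cases "i < r")
    case True
    then have "(\<lambda>q. \<Sum>l<r. lag r i l q * R l q) \<in> \<O> U"
      using r by (intro sum mult lag_closed RU open_U) simp_all
    then show ?thesis using True by (simp add: W'_def[abs_def] diff const open_U)
  next
    case False
    then show ?thesis by (simp add: W'_def[abs_def] const open_U)
  qed
  \<comment> \<open>At \<open>p\<close> the residual is a jet of \<open>v\<close> itself, which
    vanishes because \<open>v\<close> lies in the fibre.\<close>
  have Rp: "R l p = 0" if "l < r" for l
  proof -
    have sl: "s - l + l = Suc n" using that by (simp add: r_def s_def)
    have "R l p = jet p v (s - l) l"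
      unfolding R_def jet_def sl
    proof (rule sum.cong[OF refl])
      fix i assume "i \<in> {..<d}"
      then have i: "i < d" by simp
      have top: "univ_coeff (f i) (s - l) l (Suc n) p = dx (f i) p ^ (s - l) * dy (f i) p ^ l"
        using univ_coeff_f_top[OF p i, of "s - l" l] unfolding sl .
      have "(\<Sum>k\<in>{1..Suc n}. univ_coeff (f i) (s - l) l k p * ext p v k i) =
          (\<Sum>k\<in>{1..n}. univ_coeff (f i) (s - l) l k p * ext p v k i) + univ_coeff (f i) (s - l) l (Suc n) p * ext p v (Suc n) i"
        by simp
      also have "(\<Sum>k\<in>{1..n}. univ_coeff (f i) (s - l) l k p * ext p v k i) =
          (\<Sum>k\<in>{1..n}. univ_coeff (f i) (s - l) l k p * W k i p)"
        by (rule sum.cong[OF refl]) (use Suc.prems W(2) i in \<open>simp add: ext_def\<close>)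
      also have "ext p v (Suc n) i = v $ pos d s i"
        using Suc.prems by (simp add: ext_def s_def)
      finally show "(\<Sum>k\<in>{1..n}. univ_coeff (f i) (s - l) l k p * W k i p) +
          dx (f i) p ^ (s - l) * dy (f i) p ^ l * v $ pos d s i =
          (\<Sum>k\<in>{1..Suc n}. univ_coeff (f i) (s - l) l k p * ext p v k i)"
        unfolding top by simp
    qed
    also have "\<dots> = 0" using sl Suc.prems by (intro jet0) simp_all
    finally show ?thesis .
  qed
  have W'p: "W' i p = v $ pos d s i" for i by (simp add: W'_def Rp)
  have W'eq: "(\<Sum>i<d. (\<Sum>k\<in>{1..n}. univ_coeff (f i) a b k q * W k i q) + dx (f i) q ^ a * dy (f i) q ^ b * W' i q) = 0"
    if q: "q \<in> U" and ab: "a + b = s" for q a b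
  proof -
    have a: "a = s - b" "a = r - 1 - b" "b < r" using ab by (simp_all add: r_def)
    let ?m = "\<lambda>i. dx (f i) q ^ a * dy (f i) q ^ b"
    have "(\<Sum>i<d. ?m i * (if i < r then \<Sum>l<r. lag r i l q * R l q else 0)) =
        (\<Sum>i<r. ?m i * (\<Sum>l<r. lag r i l q * R l q))"
      by (rule sum.mono_neutral_cong_right) (use r in auto)
    also have "\<dots> = (\<Sum>i<r. \<Sum>l<r. ?m i * lag r i l q * R l q)"
      by (simp only: sum_distrib_left mult.assoc)
    also have "\<dots> = (\<Sum>l<r. (\<Sum>i<r. ?m i * lag r i l q) * R l q)"
      by (subst sum.swap) (simp only: sum_distrib_right)
    also have "\<dots> = (\<Sum>l<r. if b = l then R l q else 0)"
      by (rule sum.cong[OF refl], subst a(2), subst lag_right_inverse[OF a(3) _ r q]) simp_all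
    also have "\<dots> = R b q" using a(3) by simp
    finally have corr: "(\<Sum>i<d. ?m i * (if i < r then \<Sum>l<r. lag r i l q * R l q else 0)) = R b q" .
    have "(\<Sum>i<d. (\<Sum>k\<in>{1..n}. univ_coeff (f i) a b k q * W k i q) + ?m i * W' i q) =
        R b q - (\<Sum>i<d. ?m i * (if i < r then \<Sum>l<r. lag r i l q * R l q else 0))"
      unfolding R_def[of b] a(1)[symmetric] W'_def right_diff_distrib
      by (simp only: sum_subtractf[symmetric] add_diff_eq)
    then show ?thesis by (simp only: corr diff_self)
  qed
  let ?W = "W(s := W')"
  have "(\<Sum>i<d. \<Sum>k\<in>{1..a + b}. univ_coeff (f i) a b k q * ?W k i q) = 0"
    if q: "q \<in> U" and ab: "1 \<le> a + b" "a + b \<le> Suc n" for q a b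
  proof (cases "a + b \<le> n")
    case True
    have "(\<Sum>i<d. \<Sum>k\<in>{1..a + b}. univ_coeff (f i) a b k q * ?W k i q) =
        (\<Sum>i<d. \<Sum>k\<in>{1..a + b}. univ_coeff (f i) a b k q * W k i q)"
      by (rule sum.cong[OF refl], rule sum.cong[OF refl]) (use True in \<open>simp add: s_def\<close>)
    then show ?thesis using Weq[OF q ab(1) True] by simp
  next
    case False
    then have ab': "a + b = Suc n" using ab by simp
    have "(\<Sum>i<d. \<Sum>k\<in>{1..a + b}. univ_coeff (f i) a b k q * ?W k i q) =
        (\<Sum>i<d. (\<Sum>k\<in>{1..n}. univ_coeff (f i) a b k q * W k i q) + dx (f i) q ^ a * dy (f i) q ^ b * W' i q)"
    proof (rule sum.cong[OF refl])
      fix i assume "i \<in> {..<d}"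
      then have top: "univ_coeff (f i) a b (Suc n) q = dx (f i) q ^ a * dy (f i) q ^ b"
        using univ_coeff_f_top[OF q, of i a b] unfolding ab' by simp
      have "(\<Sum>k\<in>{1..n}. univ_coeff (f i) a b k q * ?W k i q) = (\<Sum>k\<in>{1..n}. univ_coeff (f i) a b k q * W k i q)"
        by (rule sum.cong[OF refl]) (simp add: s_def)
      then show "(\<Sum>k\<in>{1..a + b}. univ_coeff (f i) a b k q * ?W k i q) =
          (\<Sum>k\<in>{1..n}. univ_coeff (f i) a b k q * W k i q) + dx (f i) q ^ a * dy (f i) q ^ b * W' i q"
        unfolding ab' by (simp add: top s_def)
    qed
    then show ?thesis using W'eq[OF q, of a b] ab' by (simp add: s_def)
  qed
  moreover have "?W s' i \<in> \<O> U \<and> ?W s' i p = v $ pos d s' i" if "s' \<in> {1..Suc n}" "i < d" for s' i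
    using that W W'U W'p by (cases "s' = s") (auto simp: s_def)
  ultimately show ?case by (intro exI[of _ ?W] conjI ballI allI impI) blast+
qed

text \<open>This provides the witness that the definite description in \<open>curv_endo\<close>
  requires; the section is even defined on all of \<open>U\<close>.\<close>

lemma exists_section:
  assumes p: "p \<in> U" and v: "v \<in> fibre d f p"
  shows "\<exists>\<omega>. vfield U \<omega> \<and> (\<forall>q\<in>U. \<omega> q \<in> fibre d f q) \<and> \<omega> p = v"
proof -
  obtain W where W0: "\<forall>s\<in>{1..d - 2}. \<forall>i<d. W s i \<in> \<O> U \<and> W s i p = v $ pos d s i"
    and Weq0: "\<forall>q\<in>U. \<forall>a b. 1 \<le> a + b \<longrightarrow> a + b \<le> d - 2 \<longrightarrow>
      (\<Sum>i<d. \<Sum>k\<in>{1..a + b}. univ_coeff (f i) a b k q * W k i q) = 0"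
    using section_blocks[OF assms order_refl] by blast
  have W: "W s i \<in> \<O> U" "W s i p = v $ pos d s i" if "s \<in> {1..d - 2}" "i < d" for s i
    using W0 that by blast+
  have Weq: "(\<Sum>i<d. \<Sum>k\<in>{1..a + b}. univ_coeff (f i) a b k q * W k i q) = 0"
    if "q \<in> U" "1 \<le> a + b" "a + b \<le> d - 2" for q a b
    using Weq0 that by blast
  define \<omega> where "\<omega> q = Matrix.vec N (\<lambda>a. W (a div d + 1) (a mod d) q)" for q
  have \<omega>: "\<omega> q $ pos d s i = W s i q" if "1 \<le> s" "s \<le> d - 2" "i < d" for q s i
    using pos_less[OF that] by (simp only: \<omega>_def index_vec pos_div_mod[OF that(1,3)])
  have carr: "\<omega> q \<in> carrier_vec N" for q by (simp add: \<omega>_def)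
  have "(\<lambda>q. \<omega> q $ a) \<in> \<O> U" if a: "a < N" for a
  proof -
    obtain s i where "1 \<le> s" "s \<le> d - 2" "i < d" "a = pos d s i" using pos_cases[OF a] .
    then show ?thesis using W(1)[of s i] by (simp add: \<omega>)
  qed
  then have vf: "vfield U \<omega>" by (simp add: vfield_def carr)
  have jet: "jet q (\<omega> q) a b = 0" if q: "q \<in> U" and ab: "1 \<le> a + b" "a + b \<le> d - 2" for q a b
  proof -
    have "jet q (\<omega> q) a b = (\<Sum>i<d. \<Sum>k\<in>{1..a + b}. univ_coeff (f i) a b k q * W k i q)"
      unfolding jet_def
      by (rule sum.cong[OF refl], rule sum.cong[OF refl]) (use ab in \<open>simp add: ext_def \<omega>\<close>)
    then show ?thesis using Weq[OF that] by simp
  qed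
  have "\<omega> p = v"
  proof (rule eq_vecI)
    have "v \<in> carrier_vec N" using v p by (simp add: fibre_iff_jet)
    then show "dim_vec (\<omega> p) = dim_vec v" by (simp add: \<omega>_def)
    fix a assume "a < dim_vec v"
    then have a: "a < N" using \<open>v \<in> carrier_vec N\<close> by simp
    obtain s i where "1 \<le> s" "s \<le> d - 2" "i < d" "a = pos d s i" using pos_cases[OF a] .
    then show "\<omega> p $ a = v $ a" using W(2)[of s i] by (simp add: \<omega>)
  qed
  moreover have "\<omega> q \<in> fibre d f q" if "q \<in> U" for q
    using that carr jet by (simp add: fibre_iff_jet)
  ultimately show ?thesis using vf by blast
qed

lemma curv_endo_eq:
  assumes p: "p \<in> U" and v: "v \<in> fibre d f p"
  shows "curv_endo d f \<O> p v = K_mat p *\<^sub>v v"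
  unfolding curv_endo_def
proof (rule the_equality)
  obtain \<omega> where \<omega>: "vfield U \<omega>" "\<forall>q\<in>U. \<omega> q \<in> fibre d f q" "\<omega> p = v"
    using exists_section[OF assms] by blast
  then have "\<omega> \<in> sections_E d f \<O> U" unfolding sections_E_def vfield_def total_dim by blast
  then show "\<exists>V \<omega>. open V \<and> p \<in> V \<and> \<omega> \<in> sections_E d f \<O> V \<and> \<omega> p = v \<and> K_mat p *\<^sub>v v = K_op d f \<omega> p"
    using K_op_eq_K_mat[OF \<omega>(1) open_U order_refl p] open_U p \<omega>(3) by metis
next
  fix w assume "\<exists>V \<omega>. open V \<and> p \<in> V \<and> \<omega> \<in> sections_E d f \<O> V \<and> \<omega> p = v \<and> w = K_op d f \<omega> p"
  then obtain V \<omega> where V: "open V" "p \<in> V" and \<omega>: "\<omega> \<in> sections_E d f \<O> V" "\<omega> p = v" "w = K_op d f \<omega> p"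
    by blast
  \<comment> \<open>The domain of a competing section may leave \<open>U\<close>, where nothing is
    known about the web, so it is cut down.\<close>
  have VU: "open (V \<inter> U)" "V \<inter> U \<subseteq> U" "p \<in> V \<inter> U" using V open_U p by auto
  have "vfield (V \<inter> U) \<omega>"
    unfolding vfield_def
  proof (intro conjI ballI allI impI)
    fix q assume "q \<in> V \<inter> U"
    then show "\<omega> q \<in> carrier_vec N" using \<omega>(1) by (simp add: sections_E_def fibre_def total_dim)
  next
    fix a assume "a < N"
    then have "(\<lambda>q. \<omega> q $ a) \<in> \<O> V" using \<omega>(1) by (simp add: sections_E_def total_dim)
    then show "(\<lambda>q. \<omega> q $ a) \<in> \<O> (V \<inter> U)" by (rule restrict) (use V VU in auto)
  qed
  from K_op_eq_K_mat[OF this VU] show "w = K_mat p *\<^sub>v v" using \<omega> by simp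
qed

subsection \<open>The trace of the curvature\<close>

lemma trace_on_curv_endo:
  assumes p: "p \<in> U"
  shows "trace_on (total_dim d) (fibre d f p) (curv_endo d f \<O> p) = mtrace N (K_mat p)"
  unfolding total_dim
proof (rule trace_on_eq_mtrace)
  show "fibre d f p \<subseteq> carrier_vec N" by (auto simp: fibre_def total_dim)
  have 0: "0\<^sub>v N = 0 \<cdot>\<^sub>v (0\<^sub>v N :: 'k Matrix.vec)" by (intro eq_vecI) auto
  have "jet p (0\<^sub>v N) a b = 0" for a b
    by (subst 0, subst jet_smult) auto
  then show "0\<^sub>v N \<in> fibre d f p" by (simp add: fibre_iff_jet[OF p])
  show "u + v \<in> fibre d f p" if "u \<in> fibre d f p" "v \<in> fibre d f p" for u v
    using that by (simp add: fibre_iff_jet[OF p] jet_add)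
  show "c \<cdot>\<^sub>v v \<in> fibre d f p" if "v \<in> fibre d f p" for c v
    using that by (simp add: fibre_iff_jet[OF p] jet_smult)
qed (use K_mat_carrier K_mat_in_fibre[OF p] curv_endo_eq[OF p] in auto)

text \<open>The quadratic part of \<open>K_mat\<close> is a commutator and has trace zero; the trace
  of the rest commutes with differentiation.\<close>

lemma mtrace_K_mat:
  assumes p: "p \<in> U"
  shows "mtrace N (K_mat p) = pd True (\<lambda>q. \<Sum>a<N. gam False a a q) p - pd False (\<lambda>q. \<Sum>a<N. gam True a a q) p"
proof -
  have "mtrace N (K_mat p) = (\<Sum>a<N. pd True (gam False a a) p) - (\<Sum>a<N. pd False (gam True a a) p) +
      ((\<Sum>a<N. \<Sum>e<N. gam False a e p * gam True e a p) - (\<Sum>a<N. \<Sum>e<N. gam True a e p * gam False e a p))"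
    by (simp add: mtrace_def K_mat_def sum.distrib sum_subtractf)
  also have "(\<Sum>a<N. \<Sum>e<N. gam True a e p * gam False e a p) = (\<Sum>a<N. \<Sum>e<N. gam False a e p * gam True e a p)"
    by (subst sum.swap) (simp add: mult.commute)
  also have "(\<Sum>a<N. pd True (gam False a a) p) = pd True (\<lambda>q. \<Sum>a<N. gam False a a q) p"
    by (rule pd_sum[OF open_U p, symmetric]) (simp add: gam_closed)
  also have "(\<Sum>a<N. pd False (gam True a a) p) = pd False (\<lambda>q. \<Sum>a<N. gam True a a q) p"
    by (rule pd_sum[OF open_U p, symmetric]) (simp add: gam_closed)
  finally show ?thesis by simp
qed

text \<open>Shift rows have zero diagonal. The last diagonal block lies in block column
  \<open>d - 2\<close>, and \<open>d - (d - 2) = 2\<close>.\<close>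

lemma sum_gam_diag:
  "(\<Sum>a<N. gam c a a q) = (\<Sum>i<d. pd c (f i) q * A_mat d f 2 q $$ (i, i))"
proof -
  have "(\<Sum>i<d. gam c (pos d s i) (pos d s i) q) =
      (if s = d - 2 then \<Sum>i<d. pd c (f i) q * A_mat d f 2 q $$ (i, i) else 0)" if s: "s \<in> {1..d - 2}" for s
  proof -
    have s1: "1 \<le> s" "s \<le> d - 2" using s by auto
    have "gam c (pos d s i) (pos d s i) q = (if s = d - 2 then pd c (f i) q * A_mat d f 2 q $$ (i, i) else 0)"
      if "i < d" for i
    proof -
      note div = pos_div_mod[OF s1(1) that]
      have "Delta_mat d f q $$ (pos d s i, pos d s i) =
          (if s \<le> d - 3 then if pos d s i = pos d s i + d then 1 else 0 else A_mat d f (d - s) q $$ (i, i))"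
        using pos_less[OF s1 that] by (simp only: Delta_mat_def total_dim index_mat prod.case div)
      moreover have "d - (d - 2) = 2" "s \<le> d - 3 \<longleftrightarrow> s \<noteq> d - 2" using d3 s1 by auto
      ultimately show ?thesis using d3 by (auto simp: gam_def div(2))
    qed
    then show ?thesis by simp
  qed
  then have "(\<Sum>a<N. gam c a a q) =
      (\<Sum>s\<in>{1..d - 2}. if s = d - 2 then \<Sum>i<d. pd c (f i) q * A_mat d f 2 q $$ (i, i) else 0)"
    unfolding sum_pos by (rule sum.cong[OF refl])
  also have "\<dots> = (\<Sum>i<d. pd c (f i) q * A_mat d f 2 q $$ (i, i))"
    using d3 by (subst sum.delta) auto
  finally show ?thesis .
qed

text \<open>On the diagonal the row of the inverse and the universal coefficients belong to the same
  function. Hence all forms of the row equal 1 at the gradient from which the coefficients are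
  built, as \<open>apply_forms_second_order\<close> requires.\<close>

lemma A_mat_diag:
  assumes q: "q \<in> U" and i: "i < d"
  shows "2 * A_mat d f 2 q $$ (i, i) = - (\<Sum>j\<in>{..<d} - {i}. \<Sum>k\<in>{..<d} - {i, j}.
    polar (dx (dx (f i)) q) (dx (dy (f i)) q) (dy (dy (f i)) q)
      (lagrange_form (\<lambda>j. dx (f j) q) (\<lambda>j. dy (f j) q) i j)
      (lagrange_form (\<lambda>j. dx (f j) q) (\<lambda>j. dy (f j) q) i k))"
proof -
  let ?S = "subleading (f i) q"
  let ?x = "\<lambda>j. dx (f j) q" and ?y = "\<lambda>j. dy (f j) q"
  let ?B = "\<lambda>j k. polar (dx (dx (f i)) q) (dx (dy (f i)) q) (dy (dy (f i)) q)
      (lagrange_form ?x ?y i j) (lagrange_form ?x ?y i k)"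
  have "A_mat d f 2 q $$ (i, i) = - (\<Sum>l<d. lagrange_coeff d ?x ?y i l * ?S (d - 1 - l) l)"
    unfolding A_mat_entry[OF q i i] lag_def
  proof (rule arg_cong[of _ _ uminus], rule sum.cong[OF refl])
    fix l assume "l \<in> {..<d}"
    then have "d - 1 - l + l = d - 1" by auto
    then have "?S (d - 1 - l) l = univ_coeff (f i) (d - 1 - l) l (d - 2) q"
      unfolding subleading_def using d3 by (simp add: numeral_2_eq_2)
    then show "lagrange_coeff d ?x ?y i l * univ_coeff (f i) (d - 1 - l) l (d - 2) q =
        lagrange_coeff d ?x ?y i l * ?S (d - 1 - l) l" by simp
  qed
  also have "\<dots> = - apply_forms (lagrange_forms d ?x ?y i) ?S"
    using sum_lagrange_coeff[OF i, of ?x ?y ?S] by simp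
  finally have "2 * A_mat d f 2 q $$ (i, i) = - (2 * apply_forms (lagrange_forms d ?x ?y i) ?S)" by simp
  also have "2 * apply_forms (lagrange_forms d ?x ?y i) ?S =
      (\<Sum>j\<in>{..<d} - {i}. \<Sum>k\<in>{..<d} - {i}. ?B j k) - (\<Sum>j\<in>{..<d} - {i}. ?B j j)"
  proof -
    have norm: "fst l * dx (f i) q + snd l * dy (f i) q = 1" if "l \<in> set (lagrange_forms d ?x ?y i)" for l
      by (rule lagrange_forms_normalized[of d i ?x ?y, OF _ that]) (rule wedge_nonzero[OF q i])
    have "?S 0 0 = 0" by (simp add: subleading_def)
    from apply_forms_second_order[where S = ?S, OF norm this subleading_Suc[OF f_closed[OF i] open_U q]]
    show ?thesis by (simp only: sum_list_lagrange_forms)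
  qed
  also have "\<dots> = (\<Sum>j\<in>{..<d} - {i}. \<Sum>k\<in>{..<d} - {i, j}. ?B j k)"
  proof -
    have "(\<Sum>k\<in>{..<d} - {i}. ?B j k) = (\<Sum>k\<in>{..<d} - {i, j}. ?B j k) + ?B j j" if "j \<in> {..<d} - {i}" for j
    proof -
      have "{..<d} - {i} - {j} = {..<d} - {i, j}" by auto
      then show ?thesis using sum.remove[of "{..<d} - {i}" j "?B j"] that by simp
    qed
    then show ?thesis by (simp add: sum.distrib)
  qed
  finally show ?thesis .
qed

end

text \<open>The two Lagrange forms are spelled out in terms of the functions, so that the summand
  depends on \<open>g\<close>, \<open>h\<close>, \<open>k\<close> only and can be recognised in
  every web containing them.\<close>

definition triple_term :: "bool \<Rightarrow> ('k::real_normed_field \<times> 'k \<Rightarrow> 'k) \<Rightarrow> ('k \<times> 'k \<Rightarrow> 'k) \<Rightarrow> ('k \<times> 'k \<Rightarrow> 'k) \<Rightarrow> 'k \<times> 'k \<Rightarrow> 'k" where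
  "triple_term c g h k q = pd c g q * polar (dx (dx g) q) (dx (dy g) q) (dy (dy g) q)
     (dy h q * inverse (dx g q * dy h q - dy g q * dx h q), - (dx h q * inverse (dx g q * dy h q - dy g q * dx h q)))
     (dy k q * inverse (dx g q * dy k q - dy g q * dx k q), - (dx k q * inverse (dx g q * dy k q - dy g q * dx k q)))"

text \<open>The trace of \<open>DD\<^sub>x \<Delta>\<close> (or \<open>DD\<^sub>y \<Delta>\<close>) for the 3-web of \<open>g\<close>, \<open>h\<close>, \<open>k\<close>.\<close>

definition web3_form :: "bool \<Rightarrow> ('k::real_normed_field \<times> 'k \<Rightarrow> 'k) \<Rightarrow> ('k \<times> 'k \<Rightarrow> 'k) \<Rightarrow> ('k \<times> 'k \<Rightarrow> 'k) \<Rightarrow> 'k \<times> 'k \<Rightarrow> 'k" where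
  "web3_form c g h k q = - inverse 2 * (triple_term c g h k q + triple_term c g k h q + triple_term c h g k q +
     triple_term c h k g q + triple_term c k g h q + triple_term c k h g q)"

section \<open>Splitting the trace over sub-3-webs\<close>

context web
begin

lemma triple_term_closed:
  assumes "i < d" "j < d" "k < d" "i \<noteq> j" "i \<noteq> k"
  shows "triple_term c (f i) (f j) (f k) \<in> \<O> U"
  unfolding triple_term_def[abs_def] polar_def fst_conv snd_conv
  using assms wedge_nonzero
  by (intro mult add uminus inverse diff pd_closed dx_closed dy_closed f_closed open_U) auto

lemma web3_form_closed:
  assumes "i < j" "j < k" "k < d"
  shows "web3_form c (f i) (f j) (f k) \<in> \<O> U"
  unfolding web3_form_def[abs_def]
  using assms by (intro scale add triple_term_closed open_U) auto

lemma sum_gam_eq_web3_forms: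
  assumes q: "q \<in> U"
  shows "(\<Sum>a<N. gam c a a q) = (\<Sum>k<d. \<Sum>j<k. \<Sum>i<j. web3_form c (f i) (f j) (f k) q)"
proof -
  let ?T = "\<lambda>i j k. triple_term c (f i) (f j) (f k) q"
  have "2 * (\<Sum>a<N. gam c a a q) = (\<Sum>i<d. pd c (f i) q * (2 * A_mat d f 2 q $$ (i, i)))"
    by (simp add: sum_gam_diag sum_distrib_left mult.left_commute)
  also have "\<dots> = (\<Sum>i<d. - (\<Sum>j\<in>{..<d} - {i}. \<Sum>k\<in>{..<d} - {i, j}. ?T i j k))"
  proof (rule sum.cong[OF refl])
    fix i assume "i \<in> {..<d}"
    then have i: "i < d" by simp
    show "pd c (f i) q * (2 * A_mat d f 2 q $$ (i, i)) = - (\<Sum>j\<in>{..<d} - {i}. \<Sum>k\<in>{..<d} - {i, j}. ?T i j k)"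
      unfolding A_mat_diag[OF q i] by (simp add: triple_term_def lagrange_form_def sum_distrib_left)
  qed
  also have "\<dots> = - (\<Sum>k<d. \<Sum>j<k. \<Sum>i<j. ?T i j k + ?T i k j + ?T j i k + ?T j k i + ?T k i j + ?T k j i)"
    unfolding sum_negf sum_triples ..
  \<comment> \<open>Halving is possible because a real normed field has characteristic zero. The
    sign comes from the definition of \<open>A_mat\<close>.\<close>
  finally have "(\<Sum>a<N. gam c a a q) =
      - inverse 2 * (\<Sum>k<d. \<Sum>j<k. \<Sum>i<j. ?T i j k + ?T i k j + ?T j i k + ?T j k i + ?T k i j + ?T k j i)"
    by (simp add: field_simps)
  then show ?thesis by (simp only: web3_form_def sum_distrib_left)
qed

text \<open>Stated for every web with \<open>3 \<le> d\<close>, so that one formula evaluates the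
  given web and, at \<open>d = 3\<close>, each Blaschke curvature.\<close>

lemma trace_curvature_formula:
  assumes p: "p \<in> U"
  shows "trace_on (total_dim d) (fibre d f p) (curv_endo d f \<O> p) =
    (\<Sum>k<d. \<Sum>j<k. \<Sum>i<j. dx (web3_form False (f i) (f j) (f k)) p - dy (web3_form True (f i) (f j) (f k)) p)"
proof -
  have "pd c (\<lambda>q. \<Sum>a<N. gam c' a a q) p = (\<Sum>k<d. \<Sum>j<k. \<Sum>i<j. pd c (web3_form c' (f i) (f j) (f k)) p)" for c c'
  proof -
    have cl: "web3_form c' (f i) (f j) (f k) \<in> \<O> U" if "k \<in> {..<d}" "j \<in> {..<k}" "i \<in> {..<j}" for i j k
      using that by (intro web3_form_closed) auto
    have "pd c (\<lambda>q. \<Sum>a<N. gam c' a a q) p = pd c (\<lambda>q. \<Sum>k<d. \<Sum>j<k. \<Sum>i<j. web3_form c' (f i) (f j) (f k) q) p"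
      by (rule pd_cong[OF open_U p]) (rule sum_gam_eq_web3_forms)
    also have "\<dots> = (\<Sum>k<d. pd c (\<lambda>q. \<Sum>j<k. \<Sum>i<j. web3_form c' (f i) (f j) (f k) q) p)"
      by (rule pd_sum[OF open_U p]) (intro sum open_U cl; assumption)
    also have "\<dots> = (\<Sum>k<d. \<Sum>j<k. pd c (\<lambda>q. \<Sum>i<j. web3_form c' (f i) (f j) (f k) q) p)"
      by (rule sum.cong[OF refl], rule pd_sum[OF open_U p]) (intro sum open_U cl; assumption)
    also have "\<dots> = (\<Sum>k<d. \<Sum>j<k. \<Sum>i<j. pd c (web3_form c' (f i) (f j) (f k)) p)"
      by (rule sum.cong[OF refl], rule sum.cong[OF refl], rule pd_sum[OF open_U p]) (intro cl; assumption)
    finally show ?thesis .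
  qed
  from this[of True False] this[of False True] show ?thesis
    by (simp add: trace_on_curv_endo[OF p] mtrace_K_mat[OF p] sum_subtractf)
qed

lemma subweb3:
  assumes "i < j" "j < k" "k < d"
  shows "web \<O> 3 (\<lambda>n. [f i, f j, f k] ! n) U"
proof unfold_locales
  have less3: "n < 3 \<longleftrightarrow> n = 0 \<or> n = 1 \<or> n = 2" for n :: nat by auto
  show "planar_web \<O> 3 (\<lambda>n. [f i, f j, f k] ! n) U"
    using assms f_closed wedge_nonzero open_U
    unfolding planar_web_def wedge_d_def less3 by auto
qed simp

lemma trace_Curv_eq_sum_Blaschke:
  assumes p: "p \<in> U"
  shows "trace_Curv \<O> d f p u v = (\<Sum>k<d. \<Sum>j<k. \<Sum>i<j. Blaschke \<O> (f i) (f j) (f k) p u v)"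
proof -
  have "Blaschke \<O> (f i) (f j) (f k) p u v =
      (dx (web3_form False (f i) (f j) (f k)) p - dy (web3_form True (f i) (f j) (f k)) p) * dx_wedge_dy p u v"
    if "k \<in> {..<d}" "j \<in> {..<k}" "i \<in> {..<j}" for i j k
  proof -
    \<comment> \<open>For this web the triple sum has the single summand with indices 0, 1, 2, that
      is the one formed from \<open>f i\<close>, \<open>f j\<close>, \<open>f k\<close>.\<close>
    interpret sub: web \<O> 3 "\<lambda>n. [f i, f j, f k] ! n" U using that by (intro subweb3) auto
    show ?thesis
      unfolding Blaschke_def trace_Curv_def sub.trace_curvature_formula[OF p]
      by (simp add: eval_nat_numeral)
  qed
  then show ?thesis
    unfolding trace_Curv_def trace_curvature_formula[OF p] sum_distrib_right
    by (intro sum.cong refl) simp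
qed

end

theorem mainTheorem1:
  fixes d :: nat
  assumes "3 \<le> d"
  shows "(\<forall>(U :: (real \<times> real) set) (f :: nat \<Rightarrow> real \<times> real \<Rightarrow> real).
            planar_web smooth_functions d f U \<longrightarrow>
            (\<forall>p\<in>U. \<forall>u v. trace_Curv smooth_functions d f p u v =
               (\<Sum>k<d. \<Sum>j<k. \<Sum>i<j. Blaschke smooth_functions (f i) (f j) (f k) p u v))) \<and>
         (\<forall>(U :: (complex \<times> complex) set) (f :: nat \<Rightarrow> complex \<times> complex \<Rightarrow> complex).
            planar_web holomorphic_functions d f U \<longrightarrow>
            (\<forall>p\<in>U. \<forall>u v. trace_Curv holomorphic_functions d f p u v =
               (\<Sum>k<d. \<Sum>j<k. \<Sum>i<j. Blaschke holomorphic_functions (f i) (f j) (f k) p u v)))"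
proof (intro conjI allI impI ballI)
  fix U :: "(real \<times> real) set" and f p u v
  assume "planar_web smooth_functions d f U" and p: "p \<in> U"
  then have "web smooth_functions d f U"
    using function_sheaf_smooth assms by (simp add: web_def web_axioms_def)
  then show "trace_Curv smooth_functions d f p u v =
      (\<Sum>k<d. \<Sum>j<k. \<Sum>i<j. Blaschke smooth_functions (f i) (f j) (f k) p u v)"
    using p by (rule web.trace_Curv_eq_sum_Blaschke)
next
  fix U :: "(complex \<times> complex) set" and f p u v
  assume "planar_web holomorphic_functions d f U" and p: "p \<in> U"
  then have "web holomorphic_functions d f U"
    using function_sheaf_holomorphic assms by (simp add: web_def web_axioms_def)
  then show "trace_Curv holomorphic_functions d f p u v =
      (\<Sum>k<d. \<Sum>j<k. \<Sum>i<j. Blaschke holomorphic_functions (f i) (f j) (f k) p u v)"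
    using p by (rule web.trace_Curv_eq_sum_Blaschke)
qed

end
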